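(* Let $B$ be a compact Hausdorff space and $\mathcal G\to B$ a bundle of compact Lie groups. Let $\pi_Y:Y\to B$ and $\pi_X:X\to B$ be compact $\mathcal G$-fiber bundles and let $f_t:Y\to X$, $0\le t\le1$, be a continuous homotopy of $\mathcal G$-equivariant maps satisfying $\pi_X\circ f_t=\pi_Y$. Suppose that $E$ is a $\mathcal G$-equivariant vector bundle over $X$. Then $f_0^*E\cong f_1^*E$ as $\mathcal G$-equivariant vector bundles over $Y$.
   Context: A bundle of compact Lie groups $\mathcal G\to B$ with typical fiber a compact Lie group $G$ is a locally trivial fiber bundle with typical fiber $G$ and structure group $\operatorname{Aut}(G)$. A $\mathcal G$-fiber bundle is a fiber bundle $Y\to B$ with a continuous fiberwise action $\mathcal G\times_BY\to Y$. A $\mathcal G$-equivariant vector bundle $E\to Y$ is a finite-dimensional complex vector bundle with a continuous action of $\mathcal G$ on its total space such that the projection to $Y$ is equivariant and the maps $E_y\to E_{gy}$ are linear. A continuous homotopy means that $(y,t)\mapsto f_t(y)$ is continuous on $Y\times[0,1]$.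
   Formalization: Y is assumed compact Hausdorff rather than merely compact; for non-Hausdorff compact Y the claim fails (for example, line bundles over the four-point pseudocircle times [0,1], with B a point and trivial group). *)

theory Defs
  imports "HOL-Analysis.Analysis" "HOL-Algebra.Group_Action" "HOL-Algebra.Algebraic_Closure_Type"
begin

section \<open>Compact Lie groups\<close>

text \<open>
  Real coordinate spaces are the library spaces \<^term>\<open>Euclidean_space n\<close> (sequences vanishing from
  index \<open>n\<close> on), so that dimension 0, i.e. finite groups, is included.  A function on an open subset
  is of class \<open>C\<^sup>k\<close> if all iterated partial derivatives up to order \<open>k\<close> exist and are continuous.
\<close>

definition partial_deriv :: "nat \<Rightarrow> ((nat \<Rightarrow> real) \<Rightarrow> real) \<Rightarrow> (nat \<Rightarrow> real) \<Rightarrow> real" where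
  "partial_deriv i f x = deriv (\<lambda>t. f (x(i := t))) (x i)"

primrec Ck_on :: "nat \<Rightarrow> nat \<Rightarrow> (nat \<Rightarrow> real) set \<Rightarrow> ((nat \<Rightarrow> real) \<Rightarrow> real) \<Rightarrow> bool" where
  "Ck_on 0 n U f \<longleftrightarrow> continuous_map (subtopology (Euclidean_space n) U) euclideanreal f"
| "Ck_on (Suc k) n U f \<longleftrightarrow>
     continuous_map (subtopology (Euclidean_space n) U) euclideanreal f \<and>
     (\<forall>i<n. (\<forall>x\<in>U. (\<lambda>t. f (x(i := t))) field_differentiable (at (x i))) \<and>
            Ck_on k n U (partial_deriv i f))"

definition smooth_on :: "nat \<Rightarrow> (nat \<Rightarrow> real) set \<Rightarrow> ((nat \<Rightarrow> real) \<Rightarrow> nat \<Rightarrow> real) \<Rightarrow> bool" where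
  "smooth_on n U f \<longleftrightarrow> openin (Euclidean_space n) U \<and> (\<forall>k j. Ck_on k n U (\<lambda>x. f x j))"

definition smooth_atlas ::
  "'a topology \<Rightarrow> nat \<Rightarrow> ('a set \<times> ('a \<Rightarrow> nat \<Rightarrow> real)) set \<Rightarrow> bool" where
  "smooth_atlas T n \<A> \<longleftrightarrow>
     (\<forall>(U, \<phi>)\<in>\<A>. openin T U \<and> openin (Euclidean_space n) (\<phi> ` U) \<and>
        homeomorphic_map (subtopology T U) (subtopology (Euclidean_space n) (\<phi> ` U)) \<phi>) \<and>
     (\<Union>(U, \<phi>)\<in>\<A>. U) = topspace T \<and>
     (\<forall>(U, \<phi>)\<in>\<A>. \<forall>(V, \<psi>)\<in>\<A>. smooth_on n (\<phi> ` (U \<inter> V)) (\<lambda>x. \<psi> (inv_into U \<phi> x)))"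

text \<open>
  \<open>first_half n\<close> and \<open>second_half n\<close> identify \<^term>\<open>Euclidean_space (n + n)\<close> with the product of two
  copies of \<^term>\<open>Euclidean_space n\<close>; this gives the product charts in which multiplication is smooth.
\<close>

definition first_half :: "nat \<Rightarrow> (nat \<Rightarrow> real) \<Rightarrow> nat \<Rightarrow> real" where
  "first_half n z = (\<lambda>i. if i < n then z i else 0)"

definition second_half :: "nat \<Rightarrow> (nat \<Rightarrow> real) \<Rightarrow> nat \<Rightarrow> real" where
  "second_half n z = (\<lambda>i. if i < n then z (n + i) else 0)"

definition lie_group ::
  "'a monoid \<Rightarrow> 'a topology \<Rightarrow> nat \<Rightarrow> ('a set \<times> ('a \<Rightarrow> nat \<Rightarrow> real)) set \<Rightarrow> bool" where
  "lie_group G T n \<A> \<longleftrightarrow>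
     group G \<and> topspace T = carrier G \<and>
     Hausdorff_space T \<and> second_countable T \<and> smooth_atlas T n \<A> \<and>
     continuous_map (prod_topology T T) T (\<lambda>(g, h). g \<otimes>\<^bsub>G\<^esub> h) \<and>
     continuous_map T T (\<lambda>g. inv\<^bsub>G\<^esub> g) \<and>
     (\<forall>(U, \<phi>)\<in>\<A>. \<forall>(V, \<psi>)\<in>\<A>. \<forall>(W, \<theta>)\<in>\<A>.
        smooth_on (n + n)
          {z \<in> topspace (Euclidean_space (n + n)).
             first_half n z \<in> \<phi> ` U \<and> second_half n z \<in> \<psi> ` V \<and>
             inv_into U \<phi> (first_half n z) \<otimes>\<^bsub>G\<^esub> inv_into V \<psi> (second_half n z) \<in> W}
          (\<lambda>z. \<theta> (inv_into U \<phi> (first_half n z) \<otimes>\<^bsub>G\<^esub> inv_into V \<psi> (second_half n z)))) \<and>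
     (\<forall>(U, \<phi>)\<in>\<A>. \<forall>(V, \<psi>)\<in>\<A>.
        smooth_on n (\<phi> ` {g \<in> U. inv\<^bsub>G\<^esub> g \<in> V}) (\<lambda>x. \<psi> (inv\<^bsub>G\<^esub> (inv_into U \<phi> x))))"

definition compact_lie_group :: "'a monoid \<Rightarrow> 'a topology \<Rightarrow> bool" where
  "compact_lie_group G T \<longleftrightarrow> compact_space T \<and> (\<exists>n \<A>. lie_group G T n \<A>)"

text \<open>
  The topological group \<open>Aut(G)\<close>, with the compact-open topology.  Continuous homomorphisms of Lie
  groups are smooth, and continuous bijections of compact Hausdorff spaces are homeomorphisms, so
  these are the Lie group automorphisms of a compact Lie group.
\<close>

definition Aut_topology :: "'a monoid \<Rightarrow> 'a topology \<Rightarrow> ('a \<Rightarrow> 'a) topology" where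
  "Aut_topology G T =
     topology_generated_by
       {{\<alpha> \<in> auto G. continuous_map T T \<alpha> \<and> \<alpha> ` K \<subseteq> W} | K W. compactin T K \<and> openin T W}"


section \<open>Spaces over a base\<close>

record ('t, 'b) space_over =
  tspace :: "'t topology"
  bproj :: "'t \<Rightarrow> 'b"

definition fiber :: "('t, 'b, 'm) space_over_scheme \<Rightarrow> 'b \<Rightarrow> 't set" where
  "fiber E b = {e \<in> topspace (tspace E). bproj E e = b}"

definition local_trivialization ::
  "'f topology \<Rightarrow> 'b topology \<Rightarrow> ('t, 'b, 'm) space_over_scheme \<Rightarrow> 'b set \<Rightarrow> ('b \<times> 'f \<Rightarrow> 't) \<Rightarrow> bool" where
  "local_trivialization F B E U \<phi> \<longleftrightarrow>
     openin B U \<and>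
     homeomorphic_map (prod_topology (subtopology B U) F)
       (subtopology (tspace E) {e \<in> topspace (tspace E). bproj E e \<in> U}) \<phi> \<and>
     (\<forall>b\<in>U. \<forall>x\<in>topspace F. bproj E (\<phi> (b, x)) = b)"

definition fiber_bundle :: "'f topology \<Rightarrow> 'b topology \<Rightarrow> ('t, 'b, 'm) space_over_scheme \<Rightarrow> bool" where
  "fiber_bundle F B E \<longleftrightarrow>
     continuous_map (tspace E) B (bproj E) \<and>
     (\<forall>b\<in>topspace B. \<exists>U \<phi>. b \<in> U \<and> local_trivialization F B E U \<phi>)"


section \<open>Bundles of compact Lie groups and their actions\<close>

record ('g, 'b) group_bundle = "('g, 'b) space_over" +
  fgroup :: "'b \<Rightarrow> 'g monoid"

text \<open>
  Structure group \<open>Aut(G)\<close>: the transition functions of the bundle atlas \<open>\<A>\<close> are continuous maps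
  into \<open>Aut(G)\<close>.  The group structure on the fibers is the one transported from \<open>G\<close> by the charts.
\<close>

definition transition ::
  "'h monoid \<Rightarrow> ('b \<times> 'h \<Rightarrow> 'g) \<Rightarrow> ('b \<times> 'h \<Rightarrow> 'g) \<Rightarrow> 'b \<Rightarrow> 'h \<Rightarrow> 'h" where
  "transition G \<phi> \<psi> b = (\<lambda>h\<in>carrier G. inv_into (carrier G) (\<lambda>k. \<psi> (b, k)) (\<phi> (b, h)))"

definition lie_group_bundle ::
  "'h monoid \<Rightarrow> 'h topology \<Rightarrow> 'b topology \<Rightarrow> ('g, 'b) group_bundle \<Rightarrow> bool" where
  "lie_group_bundle G T B \<G> \<longleftrightarrow>
     compact_lie_group G T \<and>
     continuous_map (tspace \<G>) B (bproj \<G>) \<and>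
     (\<forall>b\<in>topspace B. group (fgroup \<G> b) \<and> carrier (fgroup \<G> b) = fiber \<G> b) \<and>
     (\<exists>\<A>. (\<Union>(U, \<phi>)\<in>\<A>. U) = topspace B \<and>
        (\<forall>(U, \<phi>)\<in>\<A>. local_trivialization T B \<G> U \<phi> \<and>
           (\<forall>b\<in>U. (\<lambda>h. \<phi> (b, h)) \<in> iso G (fgroup \<G> b))) \<and>
        (\<forall>(U, \<phi>)\<in>\<A>. \<forall>(V, \<psi>)\<in>\<A>.
           continuous_map (subtopology B (U \<inter> V)) (Aut_topology G T) (transition G \<phi> \<psi>)))"

text \<open>
  A continuous fiberwise action \<open>\<G> \<times>\<^sub>B Z \<rightarrow> Z\<close>, for a space \<open>Z\<close> over \<open>B\<close> with projection \<open>q\<close>; the values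
  of \<open>a\<close> outside \<open>\<G> \<times>\<^sub>B Z\<close> are irrelevant.
\<close>

definition fiberwise_action ::
  "'b topology \<Rightarrow> ('g, 'b) group_bundle \<Rightarrow> 'z topology \<Rightarrow> ('z \<Rightarrow> 'b) \<Rightarrow> ('g \<Rightarrow> 'z \<Rightarrow> 'z) \<Rightarrow> bool" where
  "fiberwise_action B \<G> Z q a \<longleftrightarrow>
     continuous_map (subtopology (prod_topology (tspace \<G>) Z) {(g, z). bproj \<G> g = q z}) Z
       (\<lambda>(g, z). a g z) \<and>
     (\<forall>b\<in>topspace B.
        group_action (fgroup \<G> b) {z \<in> topspace Z. q z = b}
          (\<lambda>g. \<lambda>z\<in>{z \<in> topspace Z. q z = b}. a g z))"

record ('t, 'b, 'g) G_space = "('t, 'b) space_over" +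
  act :: "'g \<Rightarrow> 't \<Rightarrow> 't"

definition G_fiber_bundle ::
  "'f topology \<Rightarrow> 'b topology \<Rightarrow> ('g, 'b) group_bundle \<Rightarrow> ('t, 'b, 'g) G_space \<Rightarrow> bool" where
  "G_fiber_bundle F B \<G> Yb \<longleftrightarrow>
     fiber_bundle F B Yb \<and> fiberwise_action B \<G> (tspace Yb) (bproj Yb) (act Yb)"

definition G_map ::
  "('g, 'b) group_bundle \<Rightarrow> ('y, 'b, 'g) G_space \<Rightarrow> ('x, 'b, 'g) G_space \<Rightarrow> ('y \<Rightarrow> 'x) \<Rightarrow> bool" where
  "G_map \<G> Yb Xb f \<longleftrightarrow>
     continuous_map (tspace Yb) (tspace Xb) f \<and>
     (\<forall>y\<in>topspace (tspace Yb). bproj Xb (f y) = bproj Yb y) \<and>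
     (\<forall>g\<in>topspace (tspace \<G>). \<forall>y\<in>topspace (tspace Yb).
        bproj \<G> g = bproj Yb y \<longrightarrow> f (act Yb g y) = act Xb g (f y))"


section \<open>Equivariant vector bundles\<close>

abbreviation complex_ring :: "complex ring" where
  "complex_ring \<equiv> ring_of_type_algebra"

definition linear_map ::
  "(complex, 'u, 'm) module_scheme \<Rightarrow> (complex, 'v, 'n) module_scheme \<Rightarrow> ('u \<Rightarrow> 'v) \<Rightarrow> bool" where
  "linear_map M N h \<longleftrightarrow>
     h \<in> carrier M \<rightarrow> carrier N \<and>
     (\<forall>u\<in>carrier M. \<forall>v\<in>carrier M. h (u \<oplus>\<^bsub>M\<^esub> v) = h u \<oplus>\<^bsub>N\<^esub> h v) \<and>
     (\<forall>c. \<forall>u\<in>carrier M. h (c \<odot>\<^bsub>M\<^esub> u) = c \<odot>\<^bsub>N\<^esub> h u)"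

text \<open>
  \<open>\<complex>\<^sup>n\<close>, encoded like \<^term>\<open>Euclidean_space n\<close>.  In records of type \<open>module\<close> the ring components
  \<open>mult\<close> and \<open>one\<close> carry no meaning.
\<close>

definition complex_space :: "nat \<Rightarrow> (nat \<Rightarrow> complex) topology" where
  "complex_space n = subtopology (product_topology (\<lambda>_. euclidean) UNIV) {z. \<forall>i\<ge>n. z i = 0}"

definition complex_module :: "nat \<Rightarrow> (complex, nat \<Rightarrow> complex) module" where
  "complex_module n =
     \<lparr>carrier = {z. \<forall>i\<ge>n. z i = 0}, mult = undefined, one = undefined,
      zero = (\<lambda>_. 0), add = (\<lambda>u v i. u i + v i), smult = (\<lambda>c u i. c * u i)\<rparr>"

record ('e, 'x, 'g) equivariant_vb = "('e, 'x, 'g) G_space" +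
  vfiber :: "'x \<Rightarrow> (complex, 'e) module"

text \<open>The rank is locally constant, but need not be constant on a disconnected base.\<close>

definition vector_bundle :: "'x topology \<Rightarrow> ('e, 'x, 'g) equivariant_vb \<Rightarrow> bool" where
  "vector_bundle M E \<longleftrightarrow>
     continuous_map (tspace E) M (bproj E) \<and>
     (\<forall>x\<in>topspace M. module complex_ring (vfiber E x) \<and> carrier (vfiber E x) = fiber E x) \<and>
     (\<forall>x\<in>topspace M. \<exists>U n \<phi>. x \<in> U \<and> local_trivialization (complex_space n) M E U \<phi> \<and>
        (\<forall>u\<in>U. linear_map (complex_module n) (vfiber E u) (\<lambda>v. \<phi> (u, v))))"

definition equivariant_vector_bundle ::
  "'b topology \<Rightarrow> ('g, 'b) group_bundle \<Rightarrow> ('x, 'b, 'g) G_space \<Rightarrow> ('e, 'x, 'g) equivariant_vb \<Rightarrow> bool"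
  where
  "equivariant_vector_bundle B \<G> Xb E \<longleftrightarrow>
     vector_bundle (tspace Xb) E \<and>
     fiberwise_action B \<G> (tspace E) (bproj Xb \<circ> bproj E) (act E) \<and>
     (\<forall>g\<in>topspace (tspace \<G>). \<forall>e\<in>topspace (tspace E).
        bproj \<G> g = bproj Xb (bproj E e) \<longrightarrow> bproj E (act E g e) = act Xb g (bproj E e)) \<and>
     (\<forall>g\<in>topspace (tspace \<G>). \<forall>x\<in>topspace (tspace Xb).
        bproj \<G> g = bproj Xb x \<longrightarrow> linear_map (vfiber E x) (vfiber E (act Xb g x)) (act E g))"

definition pullback_vb ::
  "('y \<Rightarrow> 'x) \<Rightarrow> ('y, 'b, 'g) G_space \<Rightarrow> ('e, 'x, 'g) equivariant_vb \<Rightarrow> ('y \<times> 'e, 'y, 'g) equivariant_vb"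
  where
  "pullback_vb f Yb E =
     \<lparr>tspace = subtopology (prod_topology (tspace Yb) (tspace E)) {(y, e). f y = bproj E e},
      bproj = fst,
      act = (\<lambda>g (y, e). (act Yb g y, act E g e)),
      vfiber = (\<lambda>y. \<lparr>carrier = {y} \<times> carrier (vfiber E (f y)), mult = undefined, one = undefined,
        zero = (y, \<zero>\<^bsub>vfiber E (f y)\<^esub>),
        add = (\<lambda>(_, u) (_, v). (y, u \<oplus>\<^bsub>vfiber E (f y)\<^esub> v)),
        smult = (\<lambda>c (_, u). (y, c \<odot>\<^bsub>vfiber E (f y)\<^esub> u))\<rparr>)\<rparr>"

definition equivariant_vb_isomorphic ::
  "('g, 'b) group_bundle \<Rightarrow> ('y, 'b, 'g) G_space \<Rightarrow>
   ('d, 'y, 'g) equivariant_vb \<Rightarrow> ('e, 'y, 'g) equivariant_vb \<Rightarrow> bool" where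
  "equivariant_vb_isomorphic \<G> Yb D E \<longleftrightarrow>
     (\<exists>\<Phi>. homeomorphic_map (tspace D) (tspace E) \<Phi> \<and>
        (\<forall>d\<in>topspace (tspace D). bproj E (\<Phi> d) = bproj D d) \<and>
        (\<forall>y\<in>topspace (tspace Yb). linear_map (vfiber D y) (vfiber E y) \<Phi>) \<and>
        (\<forall>g\<in>topspace (tspace \<G>). \<forall>d\<in>topspace (tspace D).
           bproj \<G> g = bproj Yb (bproj D d) \<longrightarrow> \<Phi> (act D g d) = act E g (\<Phi> d)))"

end

theory Submission
  imports Defs "HOL-Library.Function_Algebras"
begin

text \<open>
  Averaging over the fibres of \<open>\<G>\<close> is done without Haar measure.  Pulling \<open>E\<close> back to \<open>Y \<times> [0,1]\<close>, a finite
  frame makes it the image of a continuous family of idempotent matrices \<open>e\<^sub>s(y)\<close>, and the action of \<open>g\<close>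
  becomes a matrix \<open>\<rho>\<^sub>s(g, y)\<close>.  For fixed \<open>t\<close>, let \<open>M(y, s)\<close> be the Chebyshev centre of the orbit of
  \<open>e\<^sub>s e\<^sub>t\<close>, i.e. the minimiser over all matrices \<open>Q\<close> of
  \<open>sup\<^sub>g |\<rho>\<^sub>s(g, y) Q \<rho>\<^sub>t(g, y)\<^sup>-\<^sup>1 - e\<^sub>s(g y) e\<^sub>t(g y)|\<^sup>2 + |Q - e\<^sub>s(y) Q e\<^sub>t(y)|\<^sup>2\<close>.
  As a supremum over a compact set of strictly convex functions of \<open>Q\<close>, this has a unique minimiser.
  Uniqueness makes \<open>M\<close> equivariant, compactness makes it continuous, and \<open>M(y, t) = e\<^sub>t(y)\<close>; hence \<open>M(_, s)\<close>
  is an isomorphism \<open>f\<^sub>t\<^sup>*E \<cong> f\<^sub>s\<^sup>*E\<close> for \<open>s\<close> near \<open>t\<close>, and \<open>[0,1]\<close> is connected.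
\<close>

section \<open>Chebyshev centres depending on a parameter\<close>

text \<open>The matrix \<open>e_s e_t\<close> maps the fibre at time \<open>t\<close> to the fibre
  at time \<open>s\<close> and for \<open>s = t\<close> is the identity of the bundle, but the frame
  is built from bump functions that ignore the action, so this map is in general not equivariant.
  The first term of the cost compares every translate of \<open>Q\<close> with it. That term sees
  \<open>Q\<close> only through \<open>e_s Q e_t\<close>, since \<open>rho\<close> absorbs the
  idempotents on both sides; the second term measures exactly the rest of \<open>Q\<close>. Hence
  \<open>Q\<close> can be recovered from the residuals at any single \<open>g\<close>, which is the
  source both of strict convexity and of coercivity. The second term vanishes on every translate, so
  it does not disturb equivariance.

  The fibres of \<open>\<G>\<close> vary with the base point. As a supremum over the fibre itself
  the cost is chart-free, so the minimiser is defined globally; in a chart of \<open>\<G>\<close> it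
  becomes a supremum over one fixed compact group, so continuity is checked locally.

  The idempotents may have varying rank. Adding \<open>(1 - e_s)(1 - e_t)\<close> to
  \<open>M\<close> gives a matrix that is the identity for \<open>s = t\<close>, and its inverse on
  all of C^I induces the inverse bundle map.\<close>

definition fsupp :: "'j set \<Rightarrow> ('j \<Rightarrow> complex) set" where
  "fsupp J = {Q. \<forall>j. j \<notin> J \<longrightarrow> Q j = 0}"

text \<open>\<open>fsupp J\<close>, with the product topology, stands for C^J, for vectors and
  matrices alike. The box is a product of discs and, off \<open>J\<close>, of points, hence compact
  by Tychonoff.\<close>

lemma compact_fsupp_box:
  "compact {Q \<in> fsupp J. \<forall>j. norm (Q j) \<le> C}"
proof (cases "C \<ge> 0")
  case True
  have "{Q \<in> fsupp J. \<forall>j. norm (Q j) \<le> C}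
      = (\<Pi>\<^sub>E j\<in>UNIV. if j \<in> J then cball 0 C else {0})" (is "_ = ?P")
    using True by (fastforce simp: fsupp_def PiE_iff split: if_splits)
  moreover have "compactin (product_topology (\<lambda>_. euclidean) UNIV) ?P"
    unfolding compactin_PiE by (auto simp: compactin_euclidean_iff)
  ultimately show ?thesis
    by (simp add: euclidean_product_topology)
next
  case False
  then have "\<not> norm (Q j) \<le> C" for Q :: "'a \<Rightarrow> complex" and j
    using norm_ge_zero[of "Q j"] by linarith
  then have "{Q \<in> fsupp J. \<forall>j. norm (Q j) \<le> C} = {}" by blast
  then show ?thesis by (simp only: compact_empty)
qed

text \<open>The sublevel set of \<open>F Q0\<close> lies in one compact box, so a minimum over that
  box is global.\<close>

lemma coercive_attains_min:
  fixes F :: "('j \<Rightarrow> complex) \<Rightarrow> real"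
  assumes cont: "continuous_on (fsupp J) F" and Q0: "Q0 \<in> fsupp J"
    and coercive: "\<And>Q j. Q \<in> fsupp J \<Longrightarrow> F Q \<le> F Q0 \<Longrightarrow> norm (Q j) \<le> C"
  obtains Q where "Q \<in> fsupp J" "\<And>Q'. Q' \<in> fsupp J \<Longrightarrow> F Q \<le> F Q'"
proof -
  let ?K = "{Q \<in> fsupp J. \<forall>j. norm (Q j) \<le> C}"
  have "Q0 \<in> ?K" using Q0 coercive by auto
  then obtain Q where Q: "Q \<in> ?K" "\<And>Q'. Q' \<in> ?K \<Longrightarrow> F Q \<le> F Q'"
    using continuous_attains_inf[OF compact_fsupp_box[of J C], of F]
      continuous_on_subset[OF cont, of ?K] by blast
  show thesis
  proof
    show "Q \<in> fsupp J" using Q by simp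
    fix Q' assume "Q' \<in> fsupp J"
    show "F Q \<le> F Q'"
    proof (cases "F Q' \<le> F Q0")
      case True
      then show ?thesis using Q coercive \<open>Q' \<in> fsupp J\<close> by simp
    next
      case False
      then show ?thesis using Q(2)[OF \<open>Q0 \<in> ?K\<close>] by simp
    qed
  qed
qed

lemma continuous_map_metricI:
  assumes "\<And>x e. x \<in> topspace S \<Longrightarrow> e > 0 \<Longrightarrow> \<exists>U. openin S U \<and> x \<in> U \<and> (\<forall>y\<in>U. dist (f x) (f y) < e)"
  shows "continuous_map S euclidean f"
  using assms by (simp add: Met_TC.continuous_map_to_metric flip: mtopology_is_euclidean)

text \<open>The last term is the exact convexity defect of the squared norm; strictness in
  \<open>F_strictly_quasiconvex\<close> comes from it.\<close>

lemma norm_sq_convex_combination: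
  fixes u v :: complex
  shows "(norm (of_real a * u + of_real (1 - a) * v))\<^sup>2
       = a * (norm u)\<^sup>2 + (1 - a) * (norm v)\<^sup>2 - a * (1 - a) * (norm (u - v))\<^sup>2"
  unfolding cmod_power2 by (simp add: power2_eq_square algebra_simps)

text \<open>If the \<open>r k w Q h\<close> are the coordinates of \<open>Q\<close> minus a point
  depending on \<open>h\<close>, this is the squared radius of the smallest ball about
  \<open>Q\<close> containing all these points, and its minimiser is their Chebyshev centre. The
  parameter is \<open>w\<close>, and \<open>k\<close> numbers the coordinates.\<close>

definition Chebyshev_cost ::
  "'t topology \<Rightarrow> 'k set \<Rightarrow> ('k \<Rightarrow> 'w \<Rightarrow> 'q \<Rightarrow> 't \<Rightarrow> complex) \<Rightarrow> 'w \<Rightarrow> 'q \<Rightarrow> real" where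
  "Chebyshev_cost T K r w Q = (SUP h\<in>topspace T. \<Sum>k\<in>K. (norm (r k w Q h))\<^sup>2)"

text \<open>Affinity and injectivity of the residuals give strict convexity. Coercivity is asked at
  one \<open>h\<close> for each \<open>w\<close>, since the supremum dominates its value at every
  \<open>h\<close>.\<close>

locale Chebyshev =
  fixes W :: "'w topology" and T :: "'t topology" and J :: "'j set" and K :: "'k set"
    and r :: "'k \<Rightarrow> 'w \<Rightarrow> ('j \<Rightarrow> complex) \<Rightarrow> 't \<Rightarrow> complex"
  assumes T: "compact_space T" "topspace T \<noteq> {}" and J: "finite J" and K: "finite K"
    and r_cont: "\<And>k. k \<in> K \<Longrightarrow>
      continuous_map (prod_topology (prod_topology W (top_of_set (fsupp J))) T) euclidean
        (\<lambda>((w, Q), h). r k w Q h)"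
    and r_affine: "\<And>k w h Q Q' a. \<lbrakk>k \<in> K; w \<in> topspace W; h \<in> topspace T;
      Q \<in> fsupp J; Q' \<in> fsupp J\<rbrakk> \<Longrightarrow>
      r k w (\<lambda>j. of_real a * Q j + of_real (1 - a) * Q' j) h
        = of_real a * r k w Q h + of_real (1 - a) * r k w Q' h"
    and r_inj: "\<And>w h Q Q'. \<lbrakk>w \<in> topspace W; h \<in> topspace T; Q \<in> fsupp J; Q' \<in> fsupp J;
      \<And>k. k \<in> K \<Longrightarrow> r k w Q h = r k w Q' h\<rbrakk> \<Longrightarrow> Q = Q'"
    and r_coercive: "\<And>w. w \<in> topspace W \<Longrightarrow> \<exists>h\<in>topspace T. \<exists>C. \<forall>Q\<in>fsupp J. \<forall>j.
      norm (Q j) \<le> C + (\<Sum>k\<in>K. norm (r k w Q h))"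
begin

abbreviation "q \<equiv> \<lambda>w Q h. \<Sum>k\<in>K. (norm (r k w Q h))\<^sup>2"
abbreviation "F \<equiv> Chebyshev_cost T K r"

lemma q_cont:
  "continuous_map (prod_topology (prod_topology W (top_of_set (fsupp J))) T) euclideanreal
     (\<lambda>((w, Q), h). q w Q h)"
  unfolding case_prod_unfold
  by (intro continuous_intros K)
    (use r_cont in \<open>simp_all add: case_prod_unfold\<close>)

lemma q_cont_h:
  assumes "w \<in> topspace W" "Q \<in> fsupp J"
  shows "continuous_map T euclideanreal (q w Q)"
proof -
  have "continuous_map T (prod_topology (prod_topology W (top_of_set (fsupp J))) T) (\<lambda>h. ((w, Q), h))"
    using assms by (auto intro!: continuous_map_pairedI)
  from continuous_map_compose[OF this q_cont] show ?thesis by (simp add: o_def)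
qed

lemma F_attained:
  assumes "w \<in> topspace W" "Q \<in> fsupp J"
  obtains h where "h \<in> topspace T" "F w Q = q w Q h"
    "\<And>h'. h' \<in> topspace T \<Longrightarrow> q w Q h' \<le> F w Q"
proof -
  have "compact (q w Q ` topspace T)"
    using image_compactin[OF _ q_cont_h[OF assms]] T by (simp add: compact_space_def)
  then obtain h where h: "h \<in> topspace T" "\<And>h'. h' \<in> topspace T \<Longrightarrow> q w Q h' \<le> q w Q h"
    using compact_attains_sup[of "q w Q ` topspace T"] T by auto
  have "F w Q = q w Q h"
    unfolding Chebyshev_cost_def using h by (intro cSup_eq_maximum) auto
  with h show thesis by (intro that) auto
qed

lemma q_le_F:
  assumes "w \<in> topspace W" "Q \<in> fsupp J" "h \<in> topspace T"
  shows "q w Q h \<le> F w Q"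
  using F_attained[OF assms(1,2)] assms(3) by metis

text \<open>\<open>{F > a}\<close> is the projection of an open set. Since the supremum is attained,
  \<open>{F \<ge> a}\<close> is the projection of a closed set along the compact space
  \<open>T\<close>, hence closed.\<close>

lemma F_cont:
  "continuous_map (prod_topology W (top_of_set (fsupp J))) euclideanreal (\<lambda>(w, Q). F w Q)"
proof -
  let ?X = "prod_topology W (top_of_set (fsupp J))"
  have "openin ?X {x \<in> topspace ?X. (\<lambda>(w, Q). F w Q) x > a}" for a
  proof -
    have "openin (prod_topology ?X T)
        {x \<in> topspace (prod_topology ?X T). (\<lambda>((w, Q), h). q w Q h) x \<in> {a<..}}"
      by (rule openin_continuous_map_preimage[OF q_cont]) simp
    then have "openin ?X (fst ` {x \<in> topspace (prod_topology ?X T). (\<lambda>((w, Q), h). q w Q h) x \<in> {a<..}})"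
      using open_map_fst unfolding open_map_def by blast
    also have "fst ` {x \<in> topspace (prod_topology ?X T). (\<lambda>((w, Q), h). q w Q h) x \<in> {a<..}}
        = {x \<in> topspace ?X. (\<lambda>(w, Q). F w Q) x > a}" (is "?L = ?R")
    proof
      show "?L \<subseteq> ?R"
        using q_le_F by (auto intro: less_le_trans)
      show "?R \<subseteq> ?L"
      proof
        fix x assume "x \<in> ?R"
        then obtain w Q where x: "x = (w, Q)" "w \<in> topspace W" "Q \<in> fsupp J" "F w Q > a" by auto
        from F_attained[OF x(2,3)] obtain h where "h \<in> topspace T" "F w Q = q w Q h" by metis
        with x show "x \<in> ?L" by (intro image_eqI[of _ _ "((w, Q), h)"]) auto
      qed
    qed
    finally show ?thesis .
  qed
  moreover have "openin ?X {x \<in> topspace ?X. (\<lambda>(w, Q). F w Q) x < a}" for a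
  proof -
    have "closedin (prod_topology ?X T)
        {x \<in> topspace (prod_topology ?X T). (\<lambda>((w, Q), h). q w Q h) x \<in> {a..}}"
      by (rule closedin_continuous_map_preimage[OF q_cont]) simp
    then have "closedin ?X (fst ` {x \<in> topspace (prod_topology ?X T). (\<lambda>((w, Q), h). q w Q h) x \<in> {a..}})"
      using closed_map_fst[OF T(1)] unfolding closed_map_def by blast
    also have "fst ` {x \<in> topspace (prod_topology ?X T). (\<lambda>((w, Q), h). q w Q h) x \<in> {a..}}
        = topspace ?X - {x \<in> topspace ?X. (\<lambda>(w, Q). F w Q) x < a}" (is "?L = ?R")
    proof
      show "?L \<subseteq> ?R"
      proof
        fix x assume "x \<in> ?L"
        then obtain w Q h where "x = (w, Q)" "w \<in> topspace W" "Q \<in> fsupp J" "h \<in> topspace T" "a \<le> q w Q h"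
          by auto
        moreover from this have "q w Q h \<le> F w Q" by (intro q_le_F)
        ultimately show "x \<in> ?R" by auto
      qed
      show "?R \<subseteq> ?L"
      proof
        fix x assume "x \<in> ?R"
        then obtain w Q where x: "x = (w, Q)" "w \<in> topspace W" "Q \<in> fsupp J" "F w Q \<ge> a" by auto
        from F_attained[OF x(2,3)] obtain h where "h \<in> topspace T" "F w Q = q w Q h" by metis
        with x show "x \<in> ?L" by (intro image_eqI[of _ _ "((w, Q), h)"]) auto
      qed
    qed
    finally have "closedin ?X (topspace ?X - {x \<in> topspace ?X. (\<lambda>(w, Q). F w Q) x < a})" .
    then show ?thesis
      by (metis (no_types, lifting) openin_closedin mem_Collect_eq subsetI)
  qed
  ultimately show ?thesis
    unfolding continuous_map_upper_lower_semicontinuous_lt by blast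
qed

lemma fsupp_mix:
  assumes "Q \<in> fsupp J" "Q' \<in> fsupp J"
  shows "(\<lambda>j. of_real a * Q j + of_real b * Q' j) \<in> fsupp J"
  using assms by (auto simp: fsupp_def)

text \<open>Strictness survives the supremum because it is attained: all costs are compared at the
  point \<open>h\<close> where the mixture attains its own, and there injectivity forces the
  residuals of \<open>Q\<close> and \<open>Q'\<close> to differ.\<close>

lemma F_strictly_quasiconvex:
  assumes w: "w \<in> topspace W" and Q: "Q \<in> fsupp J" "Q' \<in> fsupp J" and "Q \<noteq> Q'"
    and a: "0 < a" "a < 1"
  shows "F w (\<lambda>j. of_real a * Q j + of_real (1 - a) * Q' j) < max (F w Q) (F w Q')"
proof -
  let ?R = "\<lambda>j. of_real a * Q j + of_real (1 - a) * Q' j"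
  obtain h where h: "h \<in> topspace T" "F w ?R = q w ?R h"
    using F_attained[OF w fsupp_mix[OF Q]] by blast
  have "Q = Q'" if "\<forall>k\<in>K. r k w Q h = r k w Q' h"
    by (rule r_inj[OF w h(1) Q]) (use that in blast)
  with \<open>Q \<noteq> Q'\<close> have "\<not> (\<forall>k\<in>K. r k w Q h = r k w Q' h)" by blast
  then obtain k0 where "k0 \<in> K" "r k0 w Q h \<noteq> r k0 w Q' h" by auto
  then have pos: "(\<Sum>k\<in>K. (norm (r k w Q h - r k w Q' h))\<^sup>2) > 0"
    by (intro sum_pos2[OF K, of k0]) auto
  have "q w ?R h = (\<Sum>k\<in>K. a * (norm (r k w Q h))\<^sup>2 + (1 - a) * (norm (r k w Q' h))\<^sup>2
      - a * (1 - a) * (norm (r k w Q h - r k w Q' h))\<^sup>2)"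
    using r_affine[OF _ w h(1) Q, of _ a]
    by (intro sum.cong) (simp_all only: norm_sq_convex_combination)
  also have "\<dots> = a * q w Q h + (1 - a) * q w Q' h
      - a * (1 - a) * (\<Sum>k\<in>K. (norm (r k w Q h - r k w Q' h))\<^sup>2)"
    by (simp add: sum.distrib sum_subtractf sum_distrib_left)
  also have "\<dots> < a * q w Q h + (1 - a) * q w Q' h"
    using pos a by simp
  also have "\<dots> \<le> a * max (F w Q) (F w Q') + (1 - a) * max (F w Q) (F w Q')"
    using q_le_F[OF w Q(1) h(1)] q_le_F[OF w Q(2) h(1)] a
    by (intro add_mono mult_left_mono) auto
  finally show ?thesis using h by (simp add: algebra_simps)
qed

lemma F_cont_Q:
  assumes "w \<in> topspace W"
  shows "continuous_on (fsupp J) (F w)"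
proof -
  have "continuous_map (top_of_set (fsupp J)) (prod_topology W (top_of_set (fsupp J))) (\<lambda>Q. (w, Q))"
    using assms by (auto intro!: continuous_map_pairedI)
  from continuous_map_compose[OF this F_cont] show ?thesis by (simp add: o_def)
qed

section \<open>Existence, uniqueness and continuity of the minimiser\<close>

lemma minimiser_exists:
  assumes w: "w \<in> topspace W"
  obtains Q where "Q \<in> fsupp J" "\<And>Q'. Q' \<in> fsupp J \<Longrightarrow> F w Q \<le> F w Q'"
proof -
  obtain h C where h: "h \<in> topspace T" and
    C: "\<And>Q j. Q \<in> fsupp J \<Longrightarrow> norm (Q j) \<le> C + (\<Sum>k\<in>K. norm (r k w Q h))"
    using r_coercive[OF w] by blast
  have zero: "(\<lambda>_. 0) \<in> fsupp J" by (simp add: fsupp_def)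
  show thesis
  proof (rule coercive_attains_min[OF F_cont_Q[OF w] zero])
    fix Q j assume Q: "Q \<in> fsupp J" "F w Q \<le> F w (\<lambda>_. 0)"
    have "norm (r k w Q h) \<le> 1 + F w (\<lambda>_. 0)" if "k \<in> K" for k
    proof -
      have "(norm (r k w Q h))\<^sup>2 \<le> q w Q h"
        using that K by (intro member_le_sum) auto
      then have "(norm (r k w Q h))\<^sup>2 \<le> F w (\<lambda>_. 0)"
        using q_le_F[OF w Q(1) h] Q(2) by linarith
      \<comment> \<open>Coercivity is linear in the residuals while the cost is quadratic;
        \<open>(x - 1)\<^sup>2 \<ge> 0\<close> passes from one to the other.\<close>
      moreover have "norm (r k w Q h) \<le> 1 + (norm (r k w Q h))\<^sup>2"
        using zero_le_power2[of "norm (r k w Q h) - 1"] zero_le_power2[of "norm (r k w Q h)"]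
        norm_ge_zero[of "r k w Q h"]
        unfolding power2_diff by (simp del: norm_ge_zero)
      ultimately show ?thesis by linarith
    qed
    then have "(\<Sum>k\<in>K. norm (r k w Q h)) \<le> (\<Sum>k\<in>K. 1 + F w (\<lambda>_. 0))"
      by (rule sum_mono)
    with C[OF Q(1)] show "norm (Q j) \<le> C + (\<Sum>k\<in>K. 1 + F w (\<lambda>_. 0))"
      by (meson add_left_mono order_trans)
  qed (use that in blast)
qed

definition minimiser :: "'w \<Rightarrow> 'j \<Rightarrow> complex" where
  "minimiser w = (THE Q. Q \<in> fsupp J \<and> (\<forall>Q'\<in>fsupp J. F w Q \<le> F w Q'))"

lemma minimiser_unique:
  assumes w: "w \<in> topspace W" and Q: "Q \<in> fsupp J" "\<And>Q''. Q'' \<in> fsupp J \<Longrightarrow> F w Q \<le> F w Q''"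
    and Q': "Q' \<in> fsupp J" "\<And>Q''. Q'' \<in> fsupp J \<Longrightarrow> F w Q' \<le> F w Q''"
  shows "Q = Q'"
proof (rule ccontr)
  assume "Q \<noteq> Q'"
  then have "F w (\<lambda>j. of_real (1/2) * Q j + of_real (1 - 1/2) * Q' j) < max (F w Q) (F w Q')"
    by (intro F_strictly_quasiconvex[OF w Q(1) Q'(1)]) auto
  moreover have "max (F w Q) (F w Q') \<le> F w (\<lambda>j. of_real (1/2) * Q j + of_real (1 - 1/2) * Q' j)"
    using Q(2)[OF fsupp_mix[OF Q(1) Q'(1)]] Q'(2)[OF fsupp_mix[OF Q(1) Q'(1)]]
    by (intro max.boundedI)
  ultimately show False by linarith
qed

lemma minimiser_ex1:
  assumes w: "w \<in> topspace W"
  shows "\<exists>!Q. Q \<in> fsupp J \<and> (\<forall>Q'\<in>fsupp J. F w Q \<le> F w Q')"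
  using minimiser_exists[OF w] minimiser_unique[OF w] by metis

lemma minimiser:
  assumes w: "w \<in> topspace W"
  shows "minimiser w \<in> fsupp J" "\<And>Q'. Q' \<in> fsupp J \<Longrightarrow> F w (minimiser w) \<le> F w Q'"
  using theI'[OF minimiser_ex1[OF w]] unfolding minimiser_def by blast+

text \<open>On the sphere of radius \<open>\<epsilon>\<close> about the minimiser \<open>Q0\<close>
  at \<open>w0\<close>, the cost at \<open>w0\<close> is larger than at \<open>Q0\<close>. The
  sphere is compact, so this persists for \<open>w\<close> near \<open>w0\<close>. A minimiser for
  such a \<open>w\<close> outside the ball would be joined to \<open>Q0\<close> by a segment
  crossing the sphere, where quasiconvexity bounds the cost by that of \<open>Q0\<close>.\<close>

lemma minimiser_locally_close:
  assumes w0: "w0 \<in> topspace W" and \<epsilon>: "\<epsilon> > 0"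
  obtains U where "openin W U" "w0 \<in> U"
    "\<And>w j. w \<in> U \<Longrightarrow> norm (minimiser w j - minimiser w0 j) < \<epsilon>"
proof -
  define Q0 where "Q0 = minimiser w0"
  have Q0: "Q0 \<in> fsupp J" unfolding Q0_def using minimiser[OF w0] by simp
  define dist0 where "dist0 = (\<lambda>Q. \<Sum>j\<in>J. norm (Q j - Q0 j))"
  define S where "S = {Q \<in> fsupp J. dist0 Q = \<epsilon>}"
  have coord_le: "norm (Q j - Q0 j) \<le> dist0 Q" if "Q \<in> fsupp J" for Q j
  proof (cases "j \<in> J")
    case True
    then show ?thesis unfolding dist0_def using J by (intro member_le_sum) auto
  next
    case False
    then show ?thesis using that Q0 unfolding dist0_def by (auto simp: fsupp_def intro: sum_nonneg)
  qed
  have dist0_cont: "continuous_on UNIV dist0"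
    unfolding dist0_def by (intro continuous_intros continuous_on_product_coordinates)
  have "S = {Q \<in> fsupp J. \<forall>j. norm (Q j) \<le> \<epsilon> + (\<Sum>j\<in>J. norm (Q0 j))} \<inter> (dist0 -` {\<epsilon>})"
  proof -
    have "norm (Q j) \<le> \<epsilon> + (\<Sum>j\<in>J. norm (Q0 j))" if "Q \<in> fsupp J" "dist0 Q = \<epsilon>" for Q j
    proof -
      have "norm (Q0 j) \<le> (\<Sum>j\<in>J. norm (Q0 j))"
      proof (cases "j \<in> J")
        case True
        then show ?thesis using J by (intro member_le_sum) auto
      next
        case False
        then show ?thesis using Q0 by (auto simp: fsupp_def intro: sum_nonneg)
      qed
      moreover have "norm (Q j) \<le> norm (Q j - Q0 j) + norm (Q0 j)"
        by (metis add.commute diff_add_cancel norm_triangle_ineq)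
      ultimately show ?thesis using coord_le[OF that(1), of j] that(2) by linarith
    qed
    then show ?thesis by (auto simp: S_def)
  qed
  moreover have "closed (dist0 -` {\<epsilon>})"
    by (intro closed_vimage dist0_cont) auto
  ultimately have "compact S"
    using compact_Int_closed[OF compact_fsupp_box] by simp
  then have cS: "compact_space (top_of_set S)"
    by (simp add: compact_space_subtopology)
  \<comment> \<open>The pairs at which the sphere fails to separate. This set is closed, its
    projection along the compact sphere is closed too, and the wanted neighbourhood is the
    complement.\<close>
  define N where "N = {x \<in> topspace (prod_topology W (top_of_set S)). F (fst x) (snd x) - F (fst x) Q0 \<in> {..0}}"
  have "closedin (prod_topology W (top_of_set S)) N"
    unfolding N_def
  proof (rule closedin_continuous_map_preimage)
    have "continuous_map (prod_topology W (top_of_set S)) (prod_topology W (top_of_set (fsupp J))) (\<lambda>x. (fst x, snd x))"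
      by (intro continuous_map_pairedI continuous_map_fst)
        (auto simp: S_def continuous_map_in_subtopology intro: continuous_map_into_fulltopology continuous_map_snd)
    from continuous_map_compose[OF this F_cont]
    have 1: "continuous_map (prod_topology W (top_of_set S)) euclideanreal (\<lambda>x. F (fst x) (snd x))"
      by (simp add: o_def case_prod_unfold)
    have "continuous_map (prod_topology W (top_of_set S)) (prod_topology W (top_of_set (fsupp J))) (\<lambda>x. (fst x, Q0))"
      using Q0 by (intro continuous_map_pairedI continuous_map_fst) auto
    from continuous_map_compose[OF this F_cont]
    have "continuous_map (prod_topology W (top_of_set S)) euclideanreal (\<lambda>x. F (fst x) Q0)"
      by (simp add: o_def)
    with 1 show "continuous_map (prod_topology W (top_of_set S)) euclideanreal (\<lambda>x. F (fst x) (snd x) - F (fst x) Q0)"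
      by (intro continuous_intros)
  qed simp
  then have closed: "closedin W (fst ` N)"
    using closed_map_fst[OF cS] unfolding closed_map_def by blast
  show thesis
  proof
    show "openin W (topspace W - fst ` N)" using closed by blast
    have "F w0 Q > F w0 Q0" if "Q \<in> S" for Q
    proof (rule ccontr)
      assume "\<not> F w0 Q > F w0 Q0"
      then have "F w0 Q \<le> F w0 Q'" if "Q' \<in> fsupp J" for Q'
        using minimiser(2)[OF w0 that] unfolding Q0_def by linarith
      moreover have "Q \<in> fsupp J" using that by (simp add: S_def)
      ultimately have "Q = Q0"
        unfolding Q0_def using minimiser_unique[OF w0 _ _ minimiser[OF w0]] by blast
      then show False using that \<epsilon> by (simp add: S_def dist0_def)
    qed
    then show "w0 \<in> topspace W - fst ` N"
      using w0 by (force simp: N_def)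
    fix w j assume w: "w \<in> topspace W - fst ` N"
    then have w': "w \<in> topspace W" by simp
    have gt: "F w Q > F w Q0" if "Q \<in> S" for Q
    proof (rule ccontr)
      assume "\<not> ?thesis"
      then have "(w, Q) \<in> N" using w' that by (simp add: N_def)
      then show False using w by (metis DiffD2 fst_conv image_eqI)
    qed
    let ?M = "minimiser w"
    note M = minimiser[OF w']
    have "dist0 ?M < \<epsilon>"
    proof (rule ccontr)
      assume "\<not> ?thesis"
      then have d: "dist0 ?M \<ge> \<epsilon>" by simp
      \<comment> \<open>The parameter at which the segment from \<open>Q0\<close> to the minimiser
        for \<open>w\<close> crosses the sphere.\<close>
      define a where "a = \<epsilon> / dist0 ?M"
      have a: "0 < a" "a \<le> 1" using d \<epsilon> by (auto simp: a_def)
      define R where "R = (\<lambda>j. of_real a * ?M j + of_real (1 - a) * Q0 j)"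
      have "dist0 R = (\<Sum>j\<in>J. a * norm (?M j - Q0 j))"
        unfolding dist0_def
      proof (rule sum.cong)
        fix j
        have "R j - Q0 j = of_real a * (?M j - Q0 j)" by (simp add: R_def algebra_simps)
        then show "norm (R j - Q0 j) = a * norm (?M j - Q0 j)" using a by (simp add: norm_mult)
      qed simp
      also have "\<dots> = a * dist0 ?M" by (simp add: dist0_def sum_distrib_left)
      also have "\<dots> = \<epsilon>" using d \<epsilon> by (simp add: a_def)
      finally have "R \<in> S" using fsupp_mix[OF M(1) Q0, of a "1 - a"] by (simp add: S_def R_def)
      have "F w R \<le> max (F w ?M) (F w Q0)"
      proof (cases "a = 1 \<or> ?M = Q0")
        case True
        then show ?thesis by (auto simp: R_def algebra_simps)
      next
        case False
        then have "F w R < max (F w ?M) (F w Q0)"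
          unfolding R_def using F_strictly_quasiconvex[OF w' M(1) Q0, of a] a by auto
        then show ?thesis by simp
      qed
      also have "\<dots> = F w Q0" using M(2)[OF Q0] by simp
      finally show False using gt[OF \<open>R \<in> S\<close>] by simp
    qed
    then show "norm (?M j - minimiser w0 j) < \<epsilon>"
      using coord_le[OF M(1), of j] unfolding Q0_def by linarith
  qed
qed

lemma minimiser_cont: "continuous_map W euclidean (\<lambda>w. minimiser w j)"
proof (rule continuous_map_metricI)
  fix w and e :: real assume "w \<in> topspace W" "e > 0"
  then obtain U where "openin W U" "w \<in> U" "\<And>v. v \<in> U \<Longrightarrow> norm (minimiser v j - minimiser w j) < e"
    using minimiser_locally_close by metis
  then show "\<exists>U. openin W U \<and> w \<in> U \<and> (\<forall>v\<in>U. dist (minimiser w j) (minimiser v j) < e)"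
    by (auto simp: dist_norm norm_minus_commute)
qed

end

section \<open>Matrices over a finite index set\<close>

text \<open>Matrices are functions of an index pair, so that they are elements of
  \<open>fsupp (I \<times> I)\<close> and the results on Chebyshev centres apply to them.
  Associativity holds for arbitrary functions, the unit laws only on \<open>fsupp\<close>.\<close>

definition mmul :: "'i set \<Rightarrow> ('i \<times> 'i \<Rightarrow> complex) \<Rightarrow> ('i \<times> 'i \<Rightarrow> complex) \<Rightarrow> 'i \<times> 'i \<Rightarrow> complex" where
  "mmul I A B = (\<lambda>(i, j). \<Sum>k\<in>I. A (i, k) * B (k, j))"

definition mvec :: "'i set \<Rightarrow> ('i \<times> 'i \<Rightarrow> complex) \<Rightarrow> ('i \<Rightarrow> complex) \<Rightarrow> 'i \<Rightarrow> complex" where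
  "mvec I A v = (\<lambda>i. \<Sum>j\<in>I. A (i, j) * v j)"

definition mone :: "'i set \<Rightarrow> 'i \<times> 'i \<Rightarrow> complex" where
  "mone I = (\<lambda>(i, j). if i = j \<and> i \<in> I then 1 else 0)"

lemma mmul_assoc: "mmul I (mmul I A B) C = mmul I A (mmul I B C)"
proof -
  have "(\<Sum>k\<in>I. \<Sum>l\<in>I. A (i, l) * B (l, k) * C (k, j)) = (\<Sum>l\<in>I. \<Sum>k\<in>I. A (i, l) * (B (l, k) * C (k, j)))" for i j
    by (subst sum.swap) (simp add: mult.assoc)
  then show ?thesis
    by (simp add: mmul_def sum_distrib_left sum_distrib_right)
qed

lemma mvec_mmul: "mvec I (mmul I A B) v = mvec I A (mvec I B v)"
proof -
  have "(\<Sum>k\<in>I. \<Sum>l\<in>I. A (i, l) * B (l, k) * v k) = (\<Sum>l\<in>I. \<Sum>k\<in>I. A (i, l) * (B (l, k) * v k))" for i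
    by (subst sum.swap) (simp add: mult.assoc)
  then show ?thesis
    by (simp add: mmul_def mvec_def sum_distrib_left sum_distrib_right)
qed

lemma fsuppD: "Q \<in> fsupp J \<Longrightarrow> j \<notin> J \<Longrightarrow> Q j = 0"
  by (simp add: fsupp_def)

lemma mmul_fsupp: "A \<in> fsupp (I \<times> I) \<Longrightarrow> B \<in> fsupp (I \<times> I) \<Longrightarrow> mmul I A B \<in> fsupp (I \<times> I)"
  by (fastforce simp: fsupp_def mmul_def intro!: sum.neutral)

lemma mvec_fsupp: "A \<in> fsupp (I \<times> I) \<Longrightarrow> mvec I A v \<in> fsupp I"
  by (auto simp: fsupp_def mvec_def intro!: sum.neutral)

lemma mone_fsupp: "mone I \<in> fsupp (I \<times> I)"
  by (auto simp: fsupp_def mone_def)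

lemma add_fsupp: "u \<in> fsupp J \<Longrightarrow> v \<in> fsupp J \<Longrightarrow> u + v \<in> fsupp J"
  and diff_fsupp: "u \<in> fsupp J \<Longrightarrow> v \<in> fsupp J \<Longrightarrow> u - v \<in> fsupp J"
  and zero_fsupp: "0 \<in> fsupp J"
  by (auto simp: fsupp_def)

lemma sum_delta_conj:
  "finite I \<Longrightarrow> (\<Sum>k\<in>I. if i = k \<and> i \<in> I then c k else 0) = (if i \<in> I then c i else (0 :: complex))"
  by (cases "i \<in> I") simp_all

lemma mmul_mone_left: "finite I \<Longrightarrow> A \<in> fsupp (I \<times> I) \<Longrightarrow> mmul I (mone I) A = A"
  by (rule ext) (auto simp: mmul_def mone_def fsupp_def if_distrib[of "\<lambda>x. x * _"] sum_delta_conj cong: if_cong)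

lemma mmul_mone_right: "finite I \<Longrightarrow> A \<in> fsupp (I \<times> I) \<Longrightarrow> mmul I A (mone I) = A"
  by (rule ext) (auto simp: mmul_def mone_def fsupp_def if_distrib[of "\<lambda>x. _ * x"] sum.delta' cong: if_cong)

lemma mvec_mone: "finite I \<Longrightarrow> v \<in> fsupp I \<Longrightarrow> mvec I (mone I) v = v"
  by (rule ext) (auto simp: mvec_def mone_def fsupp_def if_distrib[of "\<lambda>x. x * _"] sum_delta_conj cong: if_cong)

lemma mmul_add_left: "mmul I (A + B) C = mmul I A C + mmul I B C"
  and mmul_add_right: "mmul I A (B + C) = mmul I A B + mmul I A C"
  and mmul_diff_left: "mmul I (A - B) C = mmul I A C - mmul I B C"
  and mmul_diff_right: "mmul I A (B - C) = mmul I A B - mmul I A C"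
  by (auto simp: mmul_def fun_eq_iff distrib_left distrib_right left_diff_distrib right_diff_distrib
      sum.distrib sum_subtractf)

lemma mvec_add_right: "mvec I A (u + v) = mvec I A u + mvec I A v"
  and mvec_diff_left: "mvec I (A - B) v = mvec I A v - mvec I B v"
  and mvec_diff_right: "mvec I A (u - v) = mvec I A u - mvec I A v"
  by (auto simp: mvec_def fun_eq_iff distrib_left distrib_right left_diff_distrib right_diff_distrib
      sum.distrib sum_subtractf)

lemma mvec_smult: "mvec I A (\<lambda>i. c * v i) = (\<lambda>i. c * mvec I A v i)"
  by (simp add: mvec_def sum_distrib_left mult.left_commute)

lemma mvec_zero_right: "mvec I A 0 = 0"
  by (auto simp: mvec_def fun_eq_iff)

lemma continuous_map_complex_mult [continuous_intros]:
  fixes f g :: "'a \<Rightarrow> complex"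
  assumes "continuous_map S euclidean f" "continuous_map S euclidean g"
  shows "continuous_map S euclidean (\<lambda>x. f x * g x)"
  using assms by (simp add: continuous_map_atin tendsto_mult)

lemma continuous_map_mmul:
  assumes "finite I" "\<And>p. continuous_map S euclidean (\<lambda>x. A x p)" "\<And>p. continuous_map S euclidean (\<lambda>x. B x p)"
  shows "continuous_map S euclidean (\<lambda>x. mmul I (A x) (B x) p)"
  unfolding mmul_def case_prod_unfold by (intro continuous_intros assms)

lemma continuous_map_mvec:
  assumes "finite I" "\<And>p. continuous_map S euclidean (\<lambda>x. A x p)" "\<And>j. continuous_map S euclidean (\<lambda>x. v x j)"
  shows "continuous_map S euclidean (\<lambda>x. mvec I (A x) (v x) i)"
  unfolding mvec_def by (intro continuous_intros assms)

section \<open>Inverses of matrices near the identity\<close>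

definition l1norm :: "'i set \<Rightarrow> ('i \<Rightarrow> complex) \<Rightarrow> real" where
  "l1norm I v = (\<Sum>i\<in>I. norm (v i))"

text \<open>Applied to a matrix, \<open>l1norm\<close> is the entrywise sum, which dominates the
  operator norm for the l1 norm on vectors.\<close>

lemma l1norm_mvec_le:
  assumes "finite I"
  shows "l1norm I (mvec I A v) \<le> l1norm (I \<times> I) A * l1norm I v"
proof -
  have "norm (\<Sum>j\<in>I. A (i, j) * v j) \<le> (\<Sum>j\<in>I. norm (A (i, j)) * l1norm I v)" for i
  proof -
    have "norm (A (i, j) * v j) \<le> norm (A (i, j)) * l1norm I v" if "j \<in> I" for j
      using that assms unfolding l1norm_def norm_mult
      by (intro mult_left_mono member_le_sum) auto
    then show ?thesis
      by (intro order_trans[OF norm_sum] sum_mono)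
  qed
  then have "l1norm I (mvec I A v) \<le> (\<Sum>i\<in>I. \<Sum>j\<in>I. norm (A (i, j)) * l1norm I v)"
    by (subst l1norm_def) (auto simp: mvec_def intro!: sum_mono)
  then show ?thesis
    by (simp add: l1norm_def[of "I \<times> I"] sum.cartesian_product sum_distrib_right case_prod_unfold)
qed

lemma l1norm_eq_0: "finite I \<Longrightarrow> v \<in> fsupp I \<Longrightarrow> l1norm I v = 0 \<Longrightarrow> v = 0"
  unfolding l1norm_def by (rule ext) (auto simp: sum_nonneg_eq_0_iff fsupp_def)

lemma l1norm_nonneg: "l1norm I v \<ge> 0"
  by (simp add: l1norm_def sum_nonneg)

lemma l1norm_triangle: "l1norm I (u + v) \<le> l1norm I u + l1norm I v"
  unfolding l1norm_def by (simp flip: sum.distrib) (intro sum_mono norm_triangle_ineq)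

lemma l1norm_coord_le: "finite I \<Longrightarrow> v \<in> fsupp I \<Longrightarrow> norm (v i) \<le> l1norm I v"
proof (cases "i \<in> I")
  case True
  assume "finite I"
  with True show ?thesis unfolding l1norm_def by (intro member_le_sum) auto
next
  case False
  assume "v \<in> fsupp I"
  with False show ?thesis by (simp add: fsuppD l1norm_nonneg)
qed

text \<open>The bound 1/2 makes \<open>v - A v\<close> at most half as large as \<open>v\<close>.
  This yields the factor 2 in \<open>bounded_below\<close>, common to all such matrices, and the
  contraction in \<open>surjective\<close>.\<close>

locale near_one =
  fixes I :: "'i set" and A :: "'i \<times> 'i \<Rightarrow> complex"
  assumes I: "finite I" and A: "A \<in> fsupp (I \<times> I)"
    and near: "l1norm (I \<times> I) (mone I - A) < 1/2"
begin

lemma diff_mvec_le: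
  assumes "v \<in> fsupp I"
  shows "l1norm I (v - mvec I A v) \<le> l1norm I v / 2"
proof -
  have "v - mvec I A v = mvec I (mone I - A) v"
    using mvec_mone[OF I assms] by (simp add: mvec_diff_left)
  then have "l1norm I (v - mvec I A v) \<le> l1norm (I \<times> I) (mone I - A) * l1norm I v"
    using l1norm_mvec_le[OF I] by metis
  also have "\<dots> \<le> 1/2 * l1norm I v"
    using near by (intro mult_right_mono l1norm_nonneg) simp
  finally show ?thesis by simp
qed

lemma bounded_below:
  assumes "v \<in> fsupp I"
  shows "l1norm I v \<le> 2 * l1norm I (mvec I A v)"
  using diff_mvec_le[OF assms] l1norm_triangle[of I "v - mvec I A v" "mvec I A v"] by simp

text \<open>Minimise the distance from \<open>A v\<close> to \<open>u\<close>. Correcting a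
  minimiser \<open>v\<close> by its own defect \<open>w = u - A v\<close> leaves the defect
  \<open>w - A w\<close>, at most half as large, so \<open>w = 0\<close>.\<close>

lemma surjective:
  assumes u: "u \<in> fsupp I"
  shows "\<exists>v\<in>fsupp I. mvec I A v = u"
proof -
  define F where "F = (\<lambda>v. l1norm I (u - mvec I A v))"
  have F_cont: "continuous_on (fsupp I) F"
    unfolding F_def l1norm_def mvec_def fun_diff_def
    by (intro continuous_intros continuous_on_subset[OF continuous_on_product_coordinates]) auto
  obtain v where v: "v \<in> fsupp I" "\<And>v'. v' \<in> fsupp I \<Longrightarrow> F v \<le> F v'"
  proof (rule coercive_attains_min[OF F_cont zero_fsupp])
    fix v j assume v: "v \<in> fsupp I" and "F v \<le> F 0"
    then have "l1norm I (u - mvec I A v) \<le> l1norm I u"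
      by (simp add: F_def mvec_zero_right)
    moreover have "l1norm I (mvec I A v) \<le> l1norm I (u - mvec I A v) + l1norm I u"
      using l1norm_triangle[of I "mvec I A v - u" u]
      by (simp add: l1norm_def norm_minus_commute)
    \<comment> \<open>In the l1 norm,
      \<open>|v| \<le> 2 |A v| \<le> 2 (|u - A v| + |u|) \<le> 4 |u|\<close>.\<close>
    ultimately show "norm (v j) \<le> 4 * l1norm I u"
      using bounded_below[OF v] l1norm_coord_le[OF I v, of j] by linarith
  qed (use that in blast)
  define w where "w = u - mvec I A v"
  have w: "w \<in> fsupp I"
    unfolding w_def using u mvec_fsupp[OF A] by (intro diff_fsupp)
  have "F v \<le> F (v + w)" using v w by (intro v(2) add_fsupp)
  also have "u - mvec I A (v + w) = w - mvec I A w"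
    unfolding mvec_add_right by (simp add: w_def)
  then have "F (v + w) \<le> l1norm I w / 2"
    unfolding F_def using diff_mvec_le[OF w] by simp
  finally have "l1norm I w \<le> 0" by (simp add: F_def w_def)
  then have "w = 0" using l1norm_eq_0[OF I w] l1norm_nonneg[of I w] by simp
  then show ?thesis using v by (auto simp: w_def)
qed

definition "inverse_column j = (SOME v. v \<in> fsupp I \<and> mvec I A v = (\<lambda>i. mone I (i, j)))"

definition "inverse_matrix = (\<lambda>(i, j). if j \<in> I then inverse_column j i else 0)"

lemma inverse_column:
  shows "inverse_column j \<in> fsupp I" "mvec I A (inverse_column j) = (\<lambda>i. mone I (i, j))"
proof -
  have "(\<lambda>i. mone I (i, j)) \<in> fsupp I" by (auto simp: mone_def fsupp_def)
  from someI_ex[OF surjective[OF this, unfolded Bex_def]]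
  show "inverse_column j \<in> fsupp I" "mvec I A (inverse_column j) = (\<lambda>i. mone I (i, j))"
    unfolding inverse_column_def by auto
qed

lemma inverse_matrix_fsupp: "inverse_matrix \<in> fsupp (I \<times> I)"
  using inverse_column(1) by (auto simp: inverse_matrix_def fsupp_def)

lemma right_inverse: "mmul I A inverse_matrix = mone I"
proof (rule ext, clarify)
  fix i j
  show "mmul I A inverse_matrix (i, j) = mone I (i, j)"
  proof (cases "j \<in> I")
    case True
    then have "mmul I A inverse_matrix (i, j) = mvec I A (inverse_column j) i"
      by (simp add: mmul_def mvec_def inverse_matrix_def)
    then show ?thesis using inverse_column(2) by simp
  next
    case False
    then show ?thesis by (auto simp: mmul_def mone_def inverse_matrix_def)
  qed
qed

lemma mvec_column: "mvec I A (\<lambda>i. B (i, j)) = (\<lambda>i. mmul I A B (i, j))"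
  by (simp add: mvec_def mmul_def)

text \<open>If \<open>B\<close> is the right inverse, then \<open>A (B A - 1) = 0\<close>, and
  \<open>A\<close> is injective on columns by \<open>bounded_below\<close>.\<close>

lemma left_inverse: "mmul I inverse_matrix A = mone I"
proof -
  define D where "D = mmul I inverse_matrix A - mone I"
  have D: "D \<in> fsupp (I \<times> I)"
    unfolding D_def by (intro diff_fsupp mmul_fsupp inverse_matrix_fsupp A mone_fsupp)
  have "mmul I A D = 0"
    unfolding D_def mmul_diff_right
    by (simp flip: mmul_assoc add: right_inverse mmul_mone_left mmul_mone_right I A)
  then have "mvec I A (\<lambda>i. D (i, j)) = 0" for j
    unfolding mvec_column by (simp add: zero_fun_def)
  moreover have col: "(\<lambda>i. D (i, j)) \<in> fsupp I" for j using D by (auto simp: fsupp_def)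
  ultimately have "l1norm I (\<lambda>i. D (i, j)) = 0" for j
    using bounded_below[OF col, of j] l1norm_nonneg[of I "\<lambda>i. D (i, j)"] by (simp add: l1norm_def)
  then have "(\<lambda>i. D (i, j)) = 0" for j using l1norm_eq_0[OF I col] by blast
  then have "D = 0" by (auto simp: fun_eq_iff)
  then show ?thesis by (simp add: D_def)
qed

end

text \<open>Let \<open>c_x\<close> be the column of the inverse at \<open>x\<close>. Then
  \<open>A y\<close> maps \<open>c_y - c_x\<close> to the unit column minus \<open>A y c_x\<close>,
  which is continuous in \<open>y\<close> and vanishes at \<open>y = x\<close>; the lower bound with
  factor 2 is the same for all \<open>y\<close>.\<close>

lemma continuous_inverse_matrix:
  assumes near_one: "\<And>x. x \<in> topspace S \<Longrightarrow> near_one I (A x)"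
    and A_cont: "\<And>p. continuous_map S euclidean (\<lambda>x. A x p)"
  shows "continuous_map S euclidean (\<lambda>x. near_one.inverse_matrix I (A x) p)"
proof -
  obtain i j where p: "p = (i, j)" by force
  let ?c = "\<lambda>x. near_one.inverse_column I (A x) j"
  have "continuous_map S euclidean (\<lambda>x. ?c x i)"
  proof (rule continuous_map_metricI)
    fix x and e :: real assume x: "x \<in> topspace S" and "e > 0"
    interpret x: near_one I "A x" using near_one[OF x] .
    define \<phi> where "\<phi> = (\<lambda>y. 2 * l1norm I ((\<lambda>i. mone I (i, j)) - mvec I (A y) (?c x)))"
    have "continuous_map S euclidean \<phi>"
      unfolding \<phi>_def l1norm_def fun_diff_def
      by (intro continuous_map_real_mult_left continuous_intros continuous_map_mvec A_cont x.I) auto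
    then have "openin S {y \<in> topspace S. \<phi> y \<in> {..<e}}"
      by (rule openin_continuous_map_preimage) simp
    moreover have "\<phi> x = 0" by (simp add: \<phi>_def x.inverse_column l1norm_def)
    moreover have "dist (?c x i) (?c y i) < e" if y: "y \<in> topspace S" "\<phi> y < e" for y
    proof -
      interpret y: near_one I "A y" using near_one[OF y(1)] .
      have c: "?c y - ?c x \<in> fsupp I" by (intro diff_fsupp x.inverse_column y.inverse_column)
      have "norm (?c y i - ?c x i) \<le> l1norm I (?c y - ?c x)"
        using l1norm_coord_le[OF x.I c, of i] by simp
      also have "\<dots> \<le> \<phi> y"
        using y.bounded_below[OF c] by (simp add: mvec_diff_right y.inverse_column \<phi>_def)
      finally show ?thesis using y(2) by (simp add: dist_norm norm_minus_commute)
    qed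
    ultimately show "\<exists>U. openin S U \<and> x \<in> U \<and> (\<forall>y\<in>U. dist (?c x i) (?c y i) < e)"
      using x \<open>e > 0\<close> by (intro exI[of _ "{y \<in> topspace S. \<phi> y \<in> {..<e}}"]) auto
  qed
  then have "continuous_map S euclidean (\<lambda>x. if j \<in> I then ?c x i else 0)"
    by (cases "j \<in> I") simp_all
  then show ?thesis
    by (rule continuous_map_eq) (simp add: near_one.inverse_matrix_def[OF near_one] p)
qed

text \<open>Meant for maps defined on all functions of the index type, such as the projection of a
  frame: \<open>supp\<close> says that only the coordinates in \<open>I\<close> count, so finitely
  many unit vectors suffice.\<close>

lemma linear_functional_eq_sum:
  fixes L :: "('i \<Rightarrow> complex) \<Rightarrow> complex"
  assumes I: "finite I" and add: "\<And>u v. L (u + v) = L u + L v"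
    and smult: "\<And>c v. L (\<lambda>i. c * v i) = c * L v"
    and supp: "\<And>v v'. (\<And>i. i \<in> I \<Longrightarrow> v i = v' i) \<Longrightarrow> L v = L v'"
  shows "L v = (\<Sum>j\<in>I. L (\<lambda>i. if i = j then 1 else 0) * v j)"
proof -
  have "L (\<lambda>i. if i \<in> A then v i else 0) = (\<Sum>j\<in>A. L (\<lambda>i. if i = j then 1 else 0) * v j)"
    if "finite A" for A
    using that
  proof (induction A rule: finite_induct)
    case empty
    have "L (\<lambda>i. 0 * v i) = 0" unfolding smult by simp
    then show ?case by simp
  next
    case (insert a A)
    have "(\<lambda>i. if i \<in> insert a A then v i else 0)
        = (\<lambda>i. v a * (if i = a then 1 else 0)) + (\<lambda>i. if i \<in> A then v i else 0)"
      using insert.hyps by (auto simp: fun_eq_iff)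
    then have "L (\<lambda>i. if i \<in> insert a A then v i else 0)
        = L (\<lambda>i. v a * (if i = a then 1 else 0)) + L (\<lambda>i. if i \<in> A then v i else 0)"
      by (simp only: add)
    then show ?case using insert by (simp add: smult[of "v a"] mult.commute)
  qed
  from this[OF I] show ?thesis using supp[of v "\<lambda>i. if i \<in> I then v i else 0"] by simp
qed

section \<open>Frames of vector bundles\<close>

lemma continuous_map_locallyI:
  assumes "\<And>x. x \<in> topspace S \<Longrightarrow> \<exists>N. openin S N \<and> x \<in> N \<and> continuous_map (subtopology S N) T f"
  shows "continuous_map S T f"
  unfolding continuous_map
proof safe
  fix x assume "x \<in> topspace S"
  from assms[OF this] obtain N where "openin S N" "x \<in> N" "continuous_map (subtopology S N) T f" by blast
  then show "f x \<in> topspace T"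
    using \<open>x \<in> topspace S\<close> unfolding continuous_map_def by auto
next
  fix V assume V: "openin T V"
  show "openin S {x \<in> topspace S. f x \<in> V}"
  proof (subst openin_subopen, safe)
    fix x assume x: "x \<in> topspace S" "f x \<in> V"
    from assms[OF this(1)] obtain N where N: "openin S N" "x \<in> N" "continuous_map (subtopology S N) T f" by blast
    have "openin (subtopology S N) {y \<in> topspace (subtopology S N). f y \<in> V}"
      using openin_continuous_map_preimage[OF N(3) V] .
    then have "openin S {y \<in> topspace (subtopology S N). f y \<in> V}"
      using openin_trans_full N(1) by blast
    then show "\<exists>T. openin S T \<and> x \<in> T \<and> T \<subseteq> {x \<in> topspace S. f x \<in> V}"
      using x N(2) by (intro exI[of _ "{y \<in> topspace (subtopology S N). f y \<in> V}"]) auto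
  qed
qed

lemma continuous_map_complex_of_real:
  "continuous_map S euclideanreal f \<Longrightarrow> continuous_map S euclidean (\<lambda>x. complex_of_real (f x))"
  by (simp add: continuous_map_atin tendsto_of_real)

lemma continuous_map_fun_iff:
  "continuous_map S euclidean f \<longleftrightarrow> (\<forall>i. continuous_map S euclidean (\<lambda>x. f x i))"
  by (metis euclidean_product_topology continuous_map_componentwise_UNIV)

text \<open>Here \<open>c\<close> is the fibre component of the inverse chart; the base component is
  just \<open>bproj E\<close>.\<close>

lemma local_trivialization_coordinates:
  assumes "local_trivialization T M E U \<phi>" "continuous_map (tspace E) M (bproj E)"
  obtains c where
    "continuous_map (prod_topology (subtopology M U) T) (tspace E) \<phi>"
    "continuous_map (subtopology (tspace E) {e. bproj E e \<in> U}) T c"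
    "\<And>x v. x \<in> U \<Longrightarrow> v \<in> topspace T \<Longrightarrow> \<phi> (x, v) \<in> fiber E x \<and> c (\<phi> (x, v)) = v"
    "\<And>e. e \<in> topspace (tspace E) \<Longrightarrow> bproj E e \<in> U \<Longrightarrow> c e \<in> topspace T \<and> \<phi> (bproj E e, c e) = e"
proof -
  have U: "openin M U"
    and \<phi>: "homeomorphic_map (prod_topology (subtopology M U) T)
       (subtopology (tspace E) {e \<in> topspace (tspace E). bproj E e \<in> U}) \<phi>"
    and proj: "\<And>b x. b \<in> U \<Longrightarrow> x \<in> topspace T \<Longrightarrow> bproj E (\<phi> (b, x)) = b"
    using assms unfolding local_trivialization_def by blast+
  have U_top: "topspace (subtopology M U) = U"
    using openin_subset[OF U] by auto
  obtain \<psi> where \<psi>: "homeomorphic_maps (prod_topology (subtopology M U) T)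
       (subtopology (tspace E) {e \<in> topspace (tspace E). bproj E e \<in> U}) \<phi> \<psi>"
    using \<phi> homeomorphic_map_maps by blast
  have eq: "subtopology (tspace E) {e \<in> topspace (tspace E). bproj E e \<in> U}
      = subtopology (tspace E) {e. bproj E e \<in> U}"
    by (simp only: Collect_conj_eq Collect_mem_eq subtopology_restrict)
  show thesis
  proof
    show "continuous_map (prod_topology (subtopology M U) T) (tspace E) \<phi>"
      using \<psi> unfolding homeomorphic_maps_def by (meson continuous_map_in_subtopology)
    have "continuous_map (subtopology (tspace E) {e. bproj E e \<in> U}) (prod_topology (subtopology M U) T) \<psi>"
      using \<psi> unfolding homeomorphic_maps_def eq by blast
    from continuous_map_compose[OF this continuous_map_snd]
    show "continuous_map (subtopology (tspace E) {e. bproj E e \<in> U}) T (snd \<circ> \<psi>)" .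
    fix x v assume xv: "x \<in> U" "v \<in> topspace T"
    have "\<phi> (x, v) \<in> topspace (tspace E)" "\<psi> (\<phi> (x, v)) = (x, v)"
      using \<psi> xv U_top unfolding homeomorphic_maps_def continuous_map_def by (auto simp: Pi_iff)
    then show "\<phi> (x, v) \<in> fiber E x \<and> (snd \<circ> \<psi>) (\<phi> (x, v)) = v"
      using proj[OF xv] by (simp add: fiber_def)
  next
    fix e assume e: "e \<in> topspace (tspace E)" "bproj E e \<in> U"
    obtain x v where xv: "\<psi> e = (x, v)" by force
    let ?E = "subtopology (tspace E) {e \<in> topspace (tspace E). bproj E e \<in> U}"
    have "e \<in> topspace ?E" using e by simp
    then have "\<psi> e \<in> topspace (prod_topology (subtopology M U) T)" "\<phi> (\<psi> e) = e"
      using \<psi> unfolding homeomorphic_maps_def continuous_map_def by blast+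
    then have *: "x \<in> U" "v \<in> topspace T" "\<phi> (x, v) = e"
      using xv U_top by (simp_all only: topspace_prod_topology mem_Times_iff fst_conv snd_conv)
    then have "bproj E e = x" using proj by blast
    with * xv show "(snd \<circ> \<psi>) e \<in> topspace T \<and> \<phi> (bproj E e, (snd \<circ> \<psi>) e) = e" by simp
  qed
qed

lemma complex_space_eq: "complex_space n = top_of_set (fsupp {..<n})"
  unfolding complex_space_def euclidean_product_topology fsupp_def
  by (simp add: not_less)

lemma carrier_complex_module: "carrier (complex_module n) = fsupp {..<n}"
  by (simp add: complex_module_def fsupp_def not_less)

lemma add_complex_module: "u \<oplus>\<^bsub>complex_module n\<^esub> v = u + v"
  and smult_complex_module: "c \<odot>\<^bsub>complex_module n\<^esub> v = (\<lambda>i. c * v i)"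
  by (simp_all add: complex_module_def fun_eq_iff)

text \<open>\<open>J\<close> embeds the pullback of \<open>E\<close> along \<open>F\<close> into the
  trivial bundle with fibre C^I, and \<open>P\<close> is a linear retraction, so the pullback is a
  direct summand. With \<open>Z\<close> the product of \<open>Y\<close> and the interval, one index
  set serves all times, and matrices belonging to different times can be multiplied and
  compared.\<close>

locale vb_frame =
  fixes Z :: "'z topology" and F :: "'z \<Rightarrow> 'x" and E :: "('e, 'x, 'g) equivariant_vb"
    and I :: "'i set" and J :: "'z \<Rightarrow> 'e \<Rightarrow> 'i \<Rightarrow> complex" and P :: "'z \<Rightarrow> ('i \<Rightarrow> complex) \<Rightarrow> 'e"
  assumes finite_I: "finite I"
    and J_cont: "\<And>i. continuous_map
        (subtopology (prod_topology Z (tspace E)) {p. F (fst p) = bproj E (snd p)}) euclidean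
        (\<lambda>p. J (fst p) (snd p) i)"
    and P_cont: "continuous_map (prod_topology Z euclidean) (tspace E) (\<lambda>p. P (fst p) (snd p))"
    and P_fiber: "\<And>z v. z \<in> topspace Z \<Longrightarrow> P z v \<in> fiber E (F z)"
    and P_add: "\<And>z u v. z \<in> topspace Z \<Longrightarrow> P z (u + v) = P z u \<oplus>\<^bsub>vfiber E (F z)\<^esub> P z v"
    and P_smult: "\<And>z a v. z \<in> topspace Z \<Longrightarrow> P z (\<lambda>i. a * v i) = a \<odot>\<^bsub>vfiber E (F z)\<^esub> P z v"
    and P_supp: "\<And>z u v. z \<in> topspace Z \<Longrightarrow> (\<And>i. i \<in> I \<Longrightarrow> u i = v i) \<Longrightarrow> P z u = P z v"
    and J_fsupp: "\<And>z e. J z e \<in> fsupp I"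
    and J_add: "\<And>z e e'. \<lbrakk>z \<in> topspace Z; e \<in> fiber E (F z); e' \<in> fiber E (F z)\<rbrakk>
        \<Longrightarrow> J z (e \<oplus>\<^bsub>vfiber E (F z)\<^esub> e') = J z e + J z e'"
    and J_smult: "\<And>z a e. \<lbrakk>z \<in> topspace Z; e \<in> fiber E (F z)\<rbrakk>
        \<Longrightarrow> J z (a \<odot>\<^bsub>vfiber E (F z)\<^esub> e) = (\<lambda>i. a * J z e i)"
    and P_J: "\<And>z e. \<lbrakk>z \<in> topspace Z; e \<in> fiber E (F z)\<rbrakk> \<Longrightarrow> P z (J z e) = e"

text \<open>Charts are indexed by all points of \<open>Z\<close>, so that one is available around
  each point for checking identities and continuity; only those of the finite set \<open>K\<close>
  enter the frame. The closed set \<open>C k\<close> lies between the points where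
  \<open>\<beta> k\<close> is nonzero and the preimage of the chart domain, which makes extension by
  zero continuous.\<close>

locale vb_cover =
  fixes Z :: "'z topology" and M :: "'x topology" and F :: "'z \<Rightarrow> 'x"
    and E :: "('e, 'x, 'g) equivariant_vb"
    and U :: "'z \<Rightarrow> 'x set" and n :: "'z \<Rightarrow> nat" and \<phi> :: "'z \<Rightarrow> 'x \<times> (nat \<Rightarrow> complex) \<Rightarrow> 'e"
    and c :: "'z \<Rightarrow> 'e \<Rightarrow> nat \<Rightarrow> complex" and \<beta> :: "'z \<Rightarrow> 'z \<Rightarrow> real" and C :: "'z \<Rightarrow> 'z set"
    and K :: "'z set"
  assumes F_cont: "continuous_map Z M F"
    and E_proj: "continuous_map (tspace E) M (bproj E)"
    and module: "\<And>x. x \<in> topspace M \<Longrightarrow> module complex_ring (vfiber E x)"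
    and carrier: "\<And>x. x \<in> topspace M \<Longrightarrow> carrier (vfiber E x) = fiber E x"
    and U_open: "\<And>k. k \<in> topspace Z \<Longrightarrow> openin M (U k)"
    and U_mem: "\<And>k. k \<in> topspace Z \<Longrightarrow> F k \<in> U k"
    and linear: "\<And>k u. k \<in> topspace Z \<Longrightarrow> u \<in> U k \<Longrightarrow>
        linear_map (complex_module (n k)) (vfiber E u) (\<lambda>v. \<phi> k (u, v))"
    and \<phi>_cont: "\<And>k. k \<in> topspace Z \<Longrightarrow>
        continuous_map (prod_topology (subtopology M (U k)) (top_of_set (fsupp {..<n k}))) (tspace E) (\<phi> k)"
    and c_cont: "\<And>k. k \<in> topspace Z \<Longrightarrow> continuous_map (subtopology (tspace E) {e. bproj E e \<in> U k})
        (top_of_set (fsupp {..<n k})) (c k)"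
    and \<phi>_props: "\<And>k x v. k \<in> topspace Z \<Longrightarrow> x \<in> U k \<Longrightarrow> v \<in> fsupp {..<n k} \<Longrightarrow>
        \<phi> k (x, v) \<in> fiber E x \<and> c k (\<phi> k (x, v)) = v"
    and c_props: "\<And>k e. k \<in> topspace Z \<Longrightarrow> e \<in> topspace (tspace E) \<Longrightarrow> bproj E e \<in> U k \<Longrightarrow>
        c k e \<in> fsupp {..<n k} \<and> \<phi> k (bproj E e, c k e) = e"
    and K: "finite K" "K \<subseteq> topspace Z"
    and \<beta>_cont: "\<And>k. k \<in> K \<Longrightarrow> continuous_map Z euclideanreal (\<beta> k)"
    and C_closed: "\<And>k. k \<in> K \<Longrightarrow> closedin Z (C k)"
    and C_sub: "\<And>k z. k \<in> K \<Longrightarrow> z \<in> C k \<Longrightarrow> F z \<in> U k"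
    and \<beta>_zero: "\<And>k z. k \<in> K \<Longrightarrow> z \<in> topspace Z \<Longrightarrow> z \<notin> C k \<Longrightarrow> \<beta> k z = 0"
    and \<beta>_pos: "\<And>z. z \<in> topspace Z \<Longrightarrow> \<exists>k\<in>K. \<beta> k z \<noteq> 0"
begin

section \<open>Fibre coordinates in a chart\<close>

lemma F_in: "z \<in> topspace Z \<Longrightarrow> F z \<in> topspace M"
  using F_cont by (auto simp: continuous_map_def)

lemma \<phi>_add:
  assumes "k \<in> topspace Z" "x \<in> U k" "u \<in> fsupp {..<n k}" "v \<in> fsupp {..<n k}"
  shows "\<phi> k (x, u + v) = \<phi> k (x, u) \<oplus>\<^bsub>vfiber E x\<^esub> \<phi> k (x, v)"
  using linear[OF assms(1,2)] assms(3,4)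
  unfolding linear_map_def carrier_complex_module add_complex_module by blast

lemma \<phi>_smult:
  assumes "k \<in> topspace Z" "x \<in> U k" "u \<in> fsupp {..<n k}"
  shows "\<phi> k (x, \<lambda>i. a * u i) = a \<odot>\<^bsub>vfiber E x\<^esub> \<phi> k (x, u)"
  using linear[OF assms(1,2)] assms(3)
  unfolding linear_map_def carrier_complex_module smult_complex_module by blast

lemma c_fsupp:
  assumes "k \<in> topspace Z" "x \<in> U k" "e \<in> fiber E x"
  shows "c k e \<in> fsupp {..<n k}" "\<phi> k (x, c k e) = e"
  using c_props[OF assms(1), of e] assms(2,3) by (auto simp: fiber_def)

lemma c_add:
  assumes "k \<in> topspace Z" "x \<in> U k" "e \<in> fiber E x" "e' \<in> fiber E x"
  shows "c k (e \<oplus>\<^bsub>vfiber E x\<^esub> e') = c k e + c k e'"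
proof -
  note e = c_fsupp[OF assms(1-3)] and e' = c_fsupp[OF assms(1,2,4)]
  have "\<phi> k (x, c k e + c k e') = e \<oplus>\<^bsub>vfiber E x\<^esub> e'"
    using \<phi>_add[OF assms(1,2) e(1) e'(1)] e e' by simp
  then show ?thesis
    using \<phi>_props[OF assms(1,2) add_fsupp[OF e(1) e'(1)]] by simp
qed

lemma c_smult:
  assumes "k \<in> topspace Z" "x \<in> U k" "e \<in> fiber E x"
  shows "c k (a \<odot>\<^bsub>vfiber E x\<^esub> e) = (\<lambda>i. a * c k e i)"
proof -
  note e = c_fsupp[OF assms(1-3)]
  have "\<phi> k (x, \<lambda>i. a * c k e i) = a \<odot>\<^bsub>vfiber E x\<^esub> e"
    using \<phi>_smult[OF assms(1,2) e(1)] e by simp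
  moreover have "(\<lambda>i. a * c k e i) \<in> fsupp {..<n k}" using e(1) by (simp add: fsupp_def)
  ultimately show ?thesis
    using \<phi>_props[OF assms(1,2)] by metis
qed

lemma c_inj:
  assumes "k \<in> topspace Z" "x \<in> U k" "e \<in> fiber E x" "e' \<in> fiber E x" "c k e = c k e'"
  shows "e = e'"
  by (metis c_fsupp(2)[OF assms(1-3)] c_fsupp(2)[OF assms(1,2,4)] assms(5))

lemma fiber_closed:
  assumes "x \<in> topspace M"
  shows "e \<in> fiber E x \<Longrightarrow> e' \<in> fiber E x \<Longrightarrow> e \<oplus>\<^bsub>vfiber E x\<^esub> e' \<in> fiber E x"
    and "e \<in> fiber E x \<Longrightarrow> a \<odot>\<^bsub>vfiber E x\<^esub> e \<in> fiber E x"
    and "\<zero>\<^bsub>vfiber E x\<^esub> \<in> fiber E x"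
proof -
  interpret m: module complex_ring "vfiber E x" using module[OF assms] .
  show "e \<in> fiber E x \<Longrightarrow> e' \<in> fiber E x \<Longrightarrow> e \<oplus>\<^bsub>vfiber E x\<^esub> e' \<in> fiber E x"
    "e \<in> fiber E x \<Longrightarrow> a \<odot>\<^bsub>vfiber E x\<^esub> e \<in> fiber E x"
    "\<zero>\<^bsub>vfiber E x\<^esub> \<in> fiber E x"
    using m.a_closed m.smult_closed m.M.zero_closed
    unfolding carrier[OF assms] by (auto simp: ring_of_type_algebra_def)
qed

lemma c_zero:
  assumes "k \<in> topspace Z" "x \<in> U k" "x \<in> topspace M"
  shows "c k \<zero>\<^bsub>vfiber E x\<^esub> = 0"
proof -
  interpret m: module complex_ring "vfiber E x" using module[OF assms(3)] .
  have "c k \<zero>\<^bsub>vfiber E x\<^esub> = c k \<zero>\<^bsub>vfiber E x\<^esub> + c k \<zero>\<^bsub>vfiber E x\<^esub>"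
    using c_add[OF assms(1,2) fiber_closed(3)[OF assms(3)] fiber_closed(3)[OF assms(3)]] m.M.zero_closed by simp
  then show ?thesis by simp
qed

text \<open>Carries the module sum to a sum in C^n. Together with \<open>c_inj\<close> it lets
  identities between vectors of one fibre be checked in the coordinates of a single chart.\<close>

lemma c_finsum:
  assumes k: "k \<in> topspace Z" "x \<in> U k" "x \<in> topspace M" and "finite A"
    and g: "\<And>l. l \<in> A \<Longrightarrow> g l \<in> fiber E x"
  shows "finsum (vfiber E x) g A \<in> fiber E x \<and> c k (finsum (vfiber E x) g A) = (\<Sum>l\<in>A. c k (g l))"
  using \<open>finite A\<close> g
proof (induction A rule: finite_induct)
  case empty
  interpret m: module complex_ring "vfiber E x" using module[OF k(3)] .
  show ?case using c_zero[OF k] fiber_closed(3)[OF k(3)] by (simp add: m.finsum_empty)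
next
  case (insert l A)
  interpret m: module complex_ring "vfiber E x" using module[OF k(3)] .
  have "finsum (vfiber E x) g (insert l A) = g l \<oplus>\<^bsub>vfiber E x\<^esub> finsum (vfiber E x) g A"
    using insert by (intro m.finsum_insert) (auto simp: carrier[OF k(3)])
  then show ?case
    using insert c_add[OF k(1,2)] fiber_closed(1)[OF k(3)] by simp
qed

text \<open>\<open>J\<close> weights a chart by \<open>\<beta> k\<close> and \<open>P\<close> by
  \<open>\<beta> k / sqsum\<close>, so \<open>P\<close> after \<open>J\<close> multiplies by the sum
  of \<open>(\<beta> k)\<^sup>2 / sqsum\<close>, which is 1. This replaces a normalised partition of
  unity.\<close>

definition "sqsum z = (\<Sum>k\<in>K. (\<beta> k z)\<^sup>2)"

definition scaled :: "'z \<Rightarrow> 'z \<Rightarrow> ('z \<times> nat \<Rightarrow> complex) \<Rightarrow> nat \<Rightarrow> complex" where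
  "scaled k z v = (\<lambda>i. if i < n k then complex_of_real (\<beta> k z / sqsum z) * v (k, i) else 0)"

text \<open>The default outside the chart domain matches the formula inside it: the factor
  \<open>\<beta> k\<close> already vanishes off \<open>C k\<close>, so both branches give the zero
  vector near the boundary of the domain.\<close>

definition "piece k z v = (if F z \<in> U k then \<phi> k (F z, scaled k z v) else \<zero>\<^bsub>vfiber E (F z)\<^esub>)"

definition "P z v = finsum (vfiber E (F z)) (\<lambda>k. piece k z v) K"

definition J :: "'z \<Rightarrow> 'e \<Rightarrow> 'z \<times> nat \<Rightarrow> complex" where
  "J z e = (\<lambda>(k, i). if k \<in> K \<and> i < n k \<and> F z \<in> U k then complex_of_real (\<beta> k z) * c k e i else 0)"

definition "I = (SIGMA k:K. {..<n k})"

section \<open>Algebraic properties of the frame\<close>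

lemma sqsum_pos:
  assumes "z \<in> topspace Z" shows "sqsum z > 0"
proof -
  obtain k where "k \<in> K" "\<beta> k z \<noteq> 0" using \<beta>_pos[OF assms] by blast
  then show ?thesis unfolding sqsum_def using K(1) by (intro sum_pos2[of _ k]) auto
qed

lemma scaled_fsupp: "scaled k z v \<in> fsupp {..<n k}"
  by (simp add: scaled_def fsupp_def)

lemma K_in: "k \<in> K \<Longrightarrow> k \<in> topspace Z" using K by blast

lemma piece_fiber:
  assumes "z \<in> topspace Z" "k \<in> K"
  shows "piece k z v \<in> fiber E (F z)"
  using \<phi>_props[OF K_in[OF assms(2)] _ scaled_fsupp] fiber_closed(3)[OF F_in[OF assms(1)]]
  by (simp add: piece_def)

lemma P_fiber_c_P:
  assumes "k0 \<in> topspace Z" "z \<in> topspace Z" "F z \<in> U k0"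
  shows "P z v \<in> fiber E (F z) \<and> c k0 (P z v) = (\<Sum>k\<in>K. c k0 (piece k z v))"
  unfolding P_def by (rule c_finsum[OF assms(1,3) F_in[OF assms(2)] K(1)]) (rule piece_fiber[OF assms(2)])

lemma P_fiber: "z \<in> topspace Z \<Longrightarrow> P z v \<in> fiber E (F z)"
  using P_fiber_c_P U_mem by blast

lemma c_P: "\<lbrakk>k0 \<in> topspace Z; z \<in> topspace Z; F z \<in> U k0\<rbrakk> \<Longrightarrow> c k0 (P z v) = (\<Sum>k\<in>K. c k0 (piece k z v))"
  using P_fiber_c_P by blast

lemma scaled_add: "scaled k z (u + v) = scaled k z u + scaled k z v"
  by (auto simp: scaled_def fun_eq_iff distrib_left add_divide_distrib)

lemma scaled_smult: "scaled k z (\<lambda>i. a * v i) = (\<lambda>i. a * scaled k z v i)"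
  by (auto simp: scaled_def fun_eq_iff)

lemma c_piece_add:
  assumes z: "k0 \<in> topspace Z" "z \<in> topspace Z" "F z \<in> U k0" "k \<in> K"
  shows "c k0 (piece k z (u + v)) = c k0 (piece k z u) + c k0 (piece k z v)"
proof (cases "F z \<in> U k")
  case True
  have "piece k z (u + v) = piece k z u \<oplus>\<^bsub>vfiber E (F z)\<^esub> piece k z v"
    using True \<phi>_add[OF K_in[OF z(4)] True scaled_fsupp scaled_fsupp] by (simp add: piece_def scaled_add)
  then show ?thesis using c_add[OF z(1,3) piece_fiber piece_fiber] z by simp
next
  case False
  then show ?thesis using c_zero[OF z(1,3) F_in[OF z(2)]] by (simp add: piece_def)
qed

lemma c_piece_smult:
  assumes z: "k0 \<in> topspace Z" "z \<in> topspace Z" "F z \<in> U k0" "k \<in> K"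
  shows "c k0 (piece k z (\<lambda>i. a * v i)) = (\<lambda>i. a * c k0 (piece k z v) i)"
proof (cases "F z \<in> U k")
  case True
  have "piece k z (\<lambda>i. a * v i) = a \<odot>\<^bsub>vfiber E (F z)\<^esub> piece k z v"
    using True \<phi>_smult[OF K_in[OF z(4)] True scaled_fsupp] by (simp add: piece_def scaled_smult)
  then show ?thesis using c_smult[OF z(1,3) piece_fiber] z by simp
next
  case False
  then show ?thesis using c_zero[OF z(1,3) F_in[OF z(2)]] by (simp add: piece_def fun_eq_iff)
qed

lemma sum_fun_apply: "(\<Sum>k\<in>A. g k) i = (\<Sum>k\<in>A. g k i :: complex)"
  by (induction A rule: infinite_finite_induct) auto

lemma P_add:
  assumes z: "z \<in> topspace Z"
  shows "P z (u + v) = P z u \<oplus>\<^bsub>vfiber E (F z)\<^esub> P z v"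
proof (rule c_inj[OF z U_mem[OF z]])
  show "c z (P z (u + v)) = c z (P z u \<oplus>\<^bsub>vfiber E (F z)\<^esub> P z v)"
    using c_add[OF z U_mem[OF z] P_fiber P_fiber] z U_mem[OF z]
    by (simp add: c_P c_piece_add sum.distrib)
qed (simp_all add: P_fiber z fiber_closed F_in)

lemma P_smult:
  assumes z: "z \<in> topspace Z"
  shows "P z (\<lambda>i. a * v i) = a \<odot>\<^bsub>vfiber E (F z)\<^esub> P z v"
proof (rule c_inj[OF z U_mem[OF z]])
  show "c z (P z (\<lambda>i. a * v i)) = c z (a \<odot>\<^bsub>vfiber E (F z)\<^esub> P z v)"
    using c_smult[OF z U_mem[OF z] P_fiber] z U_mem[OF z]
    by (simp add: c_P c_piece_smult sum_fun_apply fun_eq_iff sum_distrib_left)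
qed (simp_all add: P_fiber z fiber_closed F_in)

lemma P_supp:
  assumes z: "z \<in> topspace Z" and "\<And>i. i \<in> I \<Longrightarrow> u i = v i"
  shows "P z u = P z v"
proof (rule c_inj[OF z U_mem[OF z] P_fiber[OF z] P_fiber[OF z]])
  have "scaled k z u = scaled k z v" if "k \<in> K" for k
    using that assms by (auto simp: scaled_def I_def)
  then have "piece k z u = piece k z v" if "k \<in> K" for k
    using that by (simp add: piece_def)
  then show "c z (P z u) = c z (P z v)"
    using z U_mem[OF z] by (auto simp: c_P intro!: sum.cong)
qed

lemma P_J:
  assumes z: "z \<in> topspace Z" and e: "e \<in> fiber E (F z)"
  shows "P z (J z e) = e"
proof (rule c_inj[OF z U_mem[OF z] P_fiber[OF z] e])
  have "c z (piece k z (J z e)) = (\<lambda>i. of_real ((\<beta> k z)\<^sup>2 / sqsum z) * c z e i)" if k: "k \<in> K" for k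
  proof (cases "F z \<in> U k")
    case True
    define a where "a = complex_of_real ((\<beta> k z)\<^sup>2 / sqsum z)"
    have "scaled k z (J z e) = (\<lambda>i. a * c k e i)"
      using c_fsupp(1)[OF K_in[OF k] True e] k True
      by (auto simp: scaled_def J_def fsupp_def fun_eq_iff power2_eq_square a_def)
    then have "piece k z (J z e) = a \<odot>\<^bsub>vfiber E (F z)\<^esub> e"
      using True \<phi>_smult[OF K_in[OF k] True c_fsupp(1)[OF K_in[OF k] True e]]
        c_fsupp(2)[OF K_in[OF k] True e] by (simp add: piece_def)
    then show ?thesis unfolding a_def using c_smult[OF z U_mem[OF z] e] by simp
  next
    case False
    then have "\<beta> k z = 0" using C_sub[OF k] \<beta>_zero[OF k z] by blast
    then show ?thesis using False c_zero[OF z U_mem[OF z] F_in[OF z]] by (simp add: piece_def fun_eq_iff)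
  qed
  then have "c z (P z (J z e)) = (\<lambda>i. (\<Sum>k\<in>K. of_real ((\<beta> k z)\<^sup>2 / sqsum z) * c z e i))"
    using z U_mem[OF z] by (simp add: c_P sum_fun_apply fun_eq_iff)
  also have "\<dots> = (\<lambda>i. of_real (sqsum z / sqsum z) * c z e i)"
    by (simp only: sqsum_def flip: sum_distrib_right sum_divide_distrib of_real_sum)
  finally show "c z (P z (J z e)) = c z e" using sqsum_pos[OF z] by simp
qed

lemma J_fsupp: "J z e \<in> fsupp I"
  by (auto simp: J_def I_def fsupp_def)

lemma J_add:
  assumes "z \<in> topspace Z" "e \<in> fiber E (F z)" "e' \<in> fiber E (F z)"
  shows "J z (e \<oplus>\<^bsub>vfiber E (F z)\<^esub> e') = J z e + J z e'"
  using c_add[OF K_in _ assms(2,3)] by (auto simp: J_def fun_eq_iff algebra_simps)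

lemma J_smult:
  assumes "z \<in> topspace Z" "e \<in> fiber E (F z)"
  shows "J z (a \<odot>\<^bsub>vfiber E (F z)\<^esub> e) = (\<lambda>i. a * J z e i)"
  using c_smult[OF K_in _ assms(2)] by (auto simp: J_def fun_eq_iff)

section \<open>Continuity of the frame\<close>

lemma U_preimage_open:
  assumes "k \<in> topspace Z" shows "openin Z {z \<in> topspace Z. F z \<in> U k}"
  using openin_continuous_map_preimage[OF F_cont U_open[OF assms]] .

lemma J_cont:
  "continuous_map (subtopology (prod_topology Z (tspace E)) {p. F (fst p) = bproj E (snd p)}) euclidean
     (\<lambda>p. J (fst p) (snd p) ki)" (is "continuous_map ?D _ _")
proof -
  obtain k i where ki: "ki = (k, i)" by force
  show ?thesis
  proof (cases "k \<in> K \<and> i < n k")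
    case False
    then show ?thesis by (auto simp: ki J_def)
  next
    case True
    then have k: "k \<in> K" "k \<in> topspace Z" and i: "i < n k" using K_in by auto
    have fst: "continuous_map ?D Z fst"
      by (intro continuous_map_from_subtopology continuous_map_fst)
    have snd: "continuous_map ?D (tspace E) snd"
      by (intro continuous_map_from_subtopology continuous_map_snd)
    show ?thesis
    proof (rule continuous_map_locallyI)
      fix p assume p: "p \<in> topspace ?D"
      show "\<exists>N. openin ?D N \<and> p \<in> N \<and> continuous_map (subtopology ?D N) euclidean (\<lambda>p. J (fst p) (snd p) ki)"
      proof (cases "F (fst p) \<in> U k")
        case True
        let ?N = "{p \<in> topspace ?D. fst p \<in> {z \<in> topspace Z. F z \<in> U k}}"
        have "continuous_map (subtopology ?D ?N) (subtopology (tspace E) {e. bproj E e \<in> U k}) snd"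
          by (rule continuous_map_into_subtopology)
            (use continuous_map_from_subtopology[OF snd] in auto)
        from continuous_map_compose[OF this c_cont[OF k(2)]]
        have "continuous_map (subtopology ?D ?N) euclidean (\<lambda>p. c k (snd p))"
          by (simp add: o_def continuous_map_in_subtopology)
        then have 1: "continuous_map (subtopology ?D ?N) euclidean (\<lambda>p. c k (snd p) i)"
          unfolding continuous_map_fun_iff by blast
        have "continuous_map (subtopology ?D ?N) euclideanreal (\<lambda>p. \<beta> k (fst p))"
          using continuous_map_compose[OF continuous_map_from_subtopology[OF fst] \<beta>_cont[OF k(1)]] by (simp add: o_def)
        then have 2: "continuous_map (subtopology ?D ?N) euclidean (\<lambda>p. complex_of_real (\<beta> k (fst p)))"
          by (rule continuous_map_complex_of_real)
        have "continuous_map (subtopology ?D ?N) euclidean (\<lambda>p. J (fst p) (snd p) ki)"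
          by (rule continuous_map_eq[OF continuous_map_complex_mult[OF 2 1]])
            (use k i in \<open>auto simp: J_def ki\<close>)
        moreover have "openin ?D ?N"
          by (rule openin_continuous_map_preimage[OF fst U_preimage_open[OF k(2)]])
        moreover have "p \<in> ?N" using p True by auto
      ultimately show ?thesis by blast
      next
        case False
        \<comment> \<open>The complement of \<open>C k\<close> is open and contains all points
          outside the chart domain, and \<open>\<beta> k\<close> vanishes on it.\<close>
        let ?N = "{p \<in> topspace ?D. fst p \<in> topspace Z - C k}"
        have "continuous_map (subtopology ?D ?N) euclidean (\<lambda>p. J (fst p) (snd p) ki)"
          by (rule continuous_map_eq[of _ _ "\<lambda>_. 0"])
            (use k \<beta>_zero in \<open>auto simp: J_def ki\<close>)
        moreover have "openin ?D ?N"
          by (rule openin_continuous_map_preimage[OF fst]) (use C_closed[OF k(1)] in blast)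
        moreover have "p \<in> ?N" using p False C_sub[OF k(1), of "fst p"] by auto
      ultimately show ?thesis by blast
      qed
    qed
  qed
qed

lemma sqsum_cont: "continuous_map Z euclideanreal sqsum"
  unfolding sqsum_def by (intro continuous_intros K \<beta>_cont)

lemma scaled_cont:
  assumes k: "k \<in> K"
  shows "continuous_map (prod_topology Z euclidean) (top_of_set (fsupp {..<n k})) (\<lambda>p. scaled k (fst p) (snd p))"
proof -
  have "continuous_map Z euclideanreal (\<lambda>z. \<beta> k z / sqsum z)"
    using sqsum_pos by (intro continuous_intros \<beta>_cont k sqsum_cont) force
  from continuous_map_compose[OF continuous_map_fst this]
  have 1: "continuous_map (prod_topology Z euclidean) euclidean (\<lambda>p. complex_of_real (\<beta> k (fst p) / sqsum (fst p)))"
    unfolding o_def by (rule continuous_map_complex_of_real)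
  have "continuous_map (prod_topology Z euclidean) euclidean (\<lambda>p. snd p (k, i))" for i
    using continuous_map_compose[OF continuous_map_snd, of euclidean euclidean "\<lambda>v. v (k, i)" Z]
    by (simp add: o_def)
  from continuous_map_complex_mult[OF 1 this]
  have "continuous_map (prod_topology Z euclidean) euclidean (\<lambda>p. scaled k (fst p) (snd p) i)" for i
    by (cases "i < n k") (simp_all add: scaled_def)
  then have "continuous_map (prod_topology Z euclidean) euclidean (\<lambda>p. scaled k (fst p) (snd p))"
    unfolding continuous_map_fun_iff[where 'b=nat] by simp
  then show ?thesis
    using scaled_fsupp by (auto simp: continuous_map_in_subtopology)
qed

text \<open>The module sum carries no continuity of its own. Near a point \<open>k0\<close> of
  \<open>Z\<close> the fibre coordinates of \<open>P\<close> in the chart of \<open>k0\<close> are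
  finite sums of continuous functions, and \<open>\<phi> k0\<close> transports them back to the
  total space.\<close>

lemma P_cont: "continuous_map (prod_topology Z euclidean) (tspace E) (\<lambda>p. P (fst p) (snd p))"
proof (rule continuous_map_locallyI)
  let ?D = "prod_topology Z (euclidean :: ('z \<times> nat \<Rightarrow> complex) topology)"
  fix p0 assume p0: "p0 \<in> topspace ?D"
  define k0 where "k0 = fst p0"
  have k0: "k0 \<in> topspace Z" using p0 by (auto simp: k0_def)
  define N where "N = {p \<in> topspace ?D. fst p \<in> {z \<in> topspace Z. F z \<in> U k0}}"
  have N_open: "openin ?D N"
    unfolding N_def by (rule openin_continuous_map_preimage[OF continuous_map_fst U_preimage_open[OF k0]])
  have N_top: "topspace (subtopology ?D N) = N" using N_def by auto
  have fst_N: "continuous_map (subtopology ?D N) Z fst"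
    by (intro continuous_map_from_subtopology continuous_map_fst)
  have N: "fst p \<in> topspace Z" "F (fst p) \<in> U k0" if "p \<in> N" for p
    using that by (auto simp: N_def)
  have piece_cont: "continuous_map (subtopology ?D N) euclidean (\<lambda>p. c k0 (piece k (fst p) (snd p)) i)"
    if k: "k \<in> K" for k i
  proof (rule continuous_map_locallyI)
    fix p assume p: "p \<in> topspace (subtopology ?D N)"
    let ?S = "subtopology ?D N"
    show "\<exists>N'. openin ?S N' \<and> p \<in> N' \<and>
      continuous_map (subtopology ?S N') euclidean (\<lambda>p. c k0 (piece k (fst p) (snd p)) i)"
    proof (cases "F (fst p) \<in> U k")
      case True
      let ?N = "{p \<in> topspace ?S. fst p \<in> {z \<in> topspace Z. F z \<in> U k}}"
      have F': "continuous_map (subtopology ?S ?N) (subtopology M (U k)) (\<lambda>p. F (fst p))"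
        using continuous_map_compose[OF continuous_map_from_subtopology[OF fst_N] F_cont]
        by (intro continuous_map_into_subtopology) (auto simp: o_def)
      have "continuous_map (subtopology ?S ?N) (top_of_set (fsupp {..<n k})) (\<lambda>p. scaled k (fst p) (snd p))"
        by (intro continuous_map_from_subtopology scaled_cont k)
      from continuous_map_compose[OF continuous_map_pairedI[OF F' this] \<phi>_cont[OF K_in[OF k]]]
      have \<phi>': "continuous_map (subtopology ?S ?N) (tspace E) (\<lambda>p. \<phi> k (F (fst p), scaled k (fst p) (snd p)))"
        by (simp add: o_def)
      have "continuous_map (subtopology ?S ?N) (subtopology (tspace E) {e. bproj E e \<in> U k0})
          (\<lambda>p. \<phi> k (F (fst p), scaled k (fst p) (snd p)))"
        using \<phi>_props[OF K_in[OF k] _ scaled_fsupp] N N_top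
        by (intro continuous_map_into_subtopology \<phi>') (auto simp: fiber_def)
      from continuous_map_compose[OF this c_cont[OF k0]]
      have "continuous_map (subtopology ?S ?N) euclidean (\<lambda>p. c k0 (\<phi> k (F (fst p), scaled k (fst p) (snd p))))"
        by (simp add: o_def continuous_map_in_subtopology)
      then have "continuous_map (subtopology ?S ?N) euclidean (\<lambda>p. c k0 (\<phi> k (F (fst p), scaled k (fst p) (snd p))) i)"
        unfolding continuous_map_fun_iff[where 'b=nat] by blast
      then have "continuous_map (subtopology ?S ?N) euclidean (\<lambda>p. c k0 (piece k (fst p) (snd p)) i)"
        by (rule continuous_map_eq) (auto simp: piece_def)
      moreover have "openin ?S ?N"
        by (rule openin_continuous_map_preimage[OF fst_N U_preimage_open[OF K_in[OF k]]])
      moreover have "p \<in> ?N" using p True N N_top by auto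
      ultimately show ?thesis by blast
    next
      case False
      let ?N = "{p \<in> topspace ?S. fst p \<in> topspace Z - C k}"
      \<comment> \<open>When \<open>\<beta> k z = 0\<close>, replacing \<open>v\<close> by
        \<open>0 * v\<close> does not change the piece, and homogeneity then makes its coordinates
        zero.\<close>
      have zero: "c k0 (piece k z v) i = 0" if "z \<in> topspace Z" "z \<notin> C k" "F z \<in> U k0" for z v
      proof -
        have "\<beta> k z = 0" using \<beta>_zero[OF k that(1,2)] .
        then have "scaled k z v = scaled k z (\<lambda>j. 0 * v j)" by (simp add: scaled_def fun_eq_iff)
        then have "piece k z v = piece k z (\<lambda>j. 0 * v j)" by (simp add: piece_def)
        then show ?thesis using c_piece_smult[OF k0 that(1,3) k, of 0 v] by simp
      qed
      have "continuous_map (subtopology ?S ?N) euclidean (\<lambda>p. c k0 (piece k (fst p) (snd p)) i)"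
        by (rule continuous_map_eq[of _ _ "\<lambda>_. 0"]) (use zero N N_top in auto)
      moreover have "openin ?S ?N"
        by (rule openin_continuous_map_preimage[OF fst_N]) (use C_closed[OF k] in blast)
      moreover have "p \<in> ?N" using p False C_sub[OF k, of "fst p"] N N_top by auto
      ultimately show ?thesis by blast
    qed
  qed
  have "continuous_map (subtopology ?D N) euclidean (\<lambda>p. \<Sum>k\<in>K. c k0 (piece k (fst p) (snd p)) i)" for i
    by (intro continuous_intros K piece_cont)
  then have "continuous_map (subtopology ?D N) euclidean (\<lambda>p. c k0 (P (fst p) (snd p)) i)" for i
    by (rule continuous_map_eq) (use N N_top in \<open>simp add: c_P[OF k0] sum_fun_apply\<close>)
  then have "continuous_map (subtopology ?D N) euclidean (\<lambda>p. c k0 (P (fst p) (snd p)))"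
    unfolding continuous_map_fun_iff[where 'b=nat] by simp
  then have 1: "continuous_map (subtopology ?D N) (top_of_set (fsupp {..<n k0})) (\<lambda>p. c k0 (P (fst p) (snd p)))"
    using c_fsupp(1)[OF k0 N(2) P_fiber[OF N(1)]] N_top by (intro continuous_map_into_subtopology) auto
  have 2: "continuous_map (subtopology ?D N) (subtopology M (U k0)) (\<lambda>p. F (fst p))"
    using continuous_map_compose[OF fst_N F_cont] N N_top
    by (intro continuous_map_into_subtopology) (auto simp: o_def)
  from continuous_map_compose[OF continuous_map_pairedI[OF 2 1] \<phi>_cont[OF k0]]
  have "continuous_map (subtopology ?D N) (tspace E) (\<lambda>p. \<phi> k0 (F (fst p), c k0 (P (fst p) (snd p))))"
    by (simp add: o_def)
  then have "continuous_map (subtopology ?D N) (tspace E) (\<lambda>p. P (fst p) (snd p))"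
    by (rule continuous_map_eq) (use N_top c_fsupp(2)[OF k0 N(2) P_fiber[OF N(1)]] in auto)
  moreover have "p0 \<in> N" using p0 U_mem[OF k0] by (auto simp: N_def k0_def)
  ultimately show "\<exists>N. openin ?D N \<and> p0 \<in> N \<and> continuous_map (subtopology ?D N) (tspace E) (\<lambda>p. P (fst p) (snd p))"
    using N_open by blast
qed

lemma finite_I: "finite I"
  unfolding I_def using K by auto

lemma frame: "vb_frame Z F E I J P"
  by (rule vb_frame.intro)
    (fact finite_I J_cont P_cont P_fiber P_add P_smult P_supp J_fsupp J_add J_smult P_J)+

end

text \<open>Complete regularity of the compact Hausdorff space \<open>Z\<close> provides bump
  functions inside the chart preimages, and compactness selects finitely many of them that
  cover.\<close>

lemma vector_bundle_frame:
  fixes Z :: "'z topology" and E :: "('e, 'x, 'g) equivariant_vb"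
  assumes Z: "compact_space Z" "Hausdorff_space Z" and F: "continuous_map Z M F" and E: "vector_bundle M E"
  obtains I :: "('z \<times> nat) set" and J P where "vb_frame Z F E I J P"
proof -
  have E_proj: "continuous_map (tspace E) M (bproj E)"
    and module: "\<And>x. x \<in> topspace M \<Longrightarrow> module complex_ring (vfiber E x) \<and> carrier (vfiber E x) = fiber E x"
    and triv: "\<And>x. x \<in> topspace M \<Longrightarrow> \<exists>U n \<phi>. x \<in> U \<and> local_trivialization (complex_space n) M E U \<phi> \<and>
        (\<forall>u\<in>U. linear_map (complex_module n) (vfiber E u) (\<lambda>v. \<phi> (u, v)))"
    using E unfolding vector_bundle_def by blast+
  have F_in: "F z \<in> topspace M" if "z \<in> topspace Z" for z using F that by (auto simp: continuous_map_def)
  have "\<forall>z\<in>topspace Z. \<exists>U n \<phi>. F z \<in> U \<and> local_trivialization (complex_space n) M E U \<phi> \<and>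
        (\<forall>u\<in>U. linear_map (complex_module n) (vfiber E u) (\<lambda>v. \<phi> (u, v)))"
    using triv F_in by blast
  then obtain U n \<phi> where chart: "\<And>z. z \<in> topspace Z \<Longrightarrow> F z \<in> U z"
      "\<And>z. z \<in> topspace Z \<Longrightarrow> local_trivialization (complex_space (n z)) M E (U z) (\<phi> z)"
      "\<And>z u. z \<in> topspace Z \<Longrightarrow> u \<in> U z \<Longrightarrow>
         linear_map (complex_module (n z)) (vfiber E u) (\<lambda>v. \<phi> z (u, v))"
    unfolding bchoice_iff by metis
  have "\<forall>z\<in>topspace Z. \<exists>c.
    continuous_map (prod_topology (subtopology M (U z)) (top_of_set (fsupp {..<n z}))) (tspace E) (\<phi> z) \<and>
    continuous_map (subtopology (tspace E) {e. bproj E e \<in> U z}) (top_of_set (fsupp {..<n z})) c \<and>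
    (\<forall>x v. x \<in> U z \<longrightarrow> v \<in> fsupp {..<n z} \<longrightarrow> \<phi> z (x, v) \<in> fiber E x \<and> c (\<phi> z (x, v)) = v) \<and>
    (\<forall>e. e \<in> topspace (tspace E) \<longrightarrow> bproj E e \<in> U z \<longrightarrow> c e \<in> fsupp {..<n z} \<and> \<phi> z (bproj E e, c e) = e)"
  proof
    fix z assume "z \<in> topspace Z"
    from local_trivialization_coordinates[OF chart(2)[OF this] E_proj, unfolded complex_space_eq topspace_euclidean_subtopology]
    show "\<exists>c. continuous_map (prod_topology (subtopology M (U z)) (top_of_set (fsupp {..<n z}))) (tspace E) (\<phi> z) \<and>
    continuous_map (subtopology (tspace E) {e. bproj E e \<in> U z}) (top_of_set (fsupp {..<n z})) c \<and>
    (\<forall>x v. x \<in> U z \<longrightarrow> v \<in> fsupp {..<n z} \<longrightarrow> \<phi> z (x, v) \<in> fiber E x \<and> c (\<phi> z (x, v)) = v) \<and>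
    (\<forall>e. e \<in> topspace (tspace E) \<longrightarrow> bproj E e \<in> U z \<longrightarrow> c e \<in> fsupp {..<n z} \<and> \<phi> z (bproj E e, c e) = e)"
      by metis
  qed
  then obtain c where c:
    "\<And>z. z \<in> topspace Z \<Longrightarrow> continuous_map (prod_topology (subtopology M (U z)) (top_of_set (fsupp {..<n z}))) (tspace E) (\<phi> z)"
    "\<And>z. z \<in> topspace Z \<Longrightarrow> continuous_map (subtopology (tspace E) {e. bproj E e \<in> U z}) (top_of_set (fsupp {..<n z})) (c z)"
    "\<And>z x v. z \<in> topspace Z \<Longrightarrow> x \<in> U z \<Longrightarrow> v \<in> fsupp {..<n z} \<Longrightarrow> \<phi> z (x, v) \<in> fiber E x \<and> c z (\<phi> z (x, v)) = v"
    "\<And>z e. z \<in> topspace Z \<Longrightarrow> e \<in> topspace (tspace E) \<Longrightarrow> bproj E e \<in> U z \<Longrightarrow> c z e \<in> fsupp {..<n z} \<and> \<phi> z (bproj E e, c z e) = e"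
    unfolding bchoice_iff by blast
  have U_open: "openin M (U z)" if "z \<in> topspace Z" for z
    using chart(2)[OF that] by (simp add: local_trivialization_def)
  define O' where "O' = (\<lambda>k. {z \<in> topspace Z. F z \<in> U k})"
  have O'_open: "openin Z (O' k)" if "k \<in> topspace Z" for k
    unfolding O'_def using openin_continuous_map_preimage[OF F U_open[OF that]] .
  have "completely_regular_space Z"
    using Z compact_Hausdorff_or_regular_imp_normal_space Hausdorff_imp_t1_space
      normal_imp_completely_regular_space by blast
  moreover have "closedin Z (topspace Z - O' k)" "k \<in> topspace Z - (topspace Z - O' k)"
    if "k \<in> topspace Z" for k
    using O'_open[OF that] that chart(1)[OF that] by (auto simp: O'_def)
  ultimately have "\<forall>k\<in>topspace Z. \<exists>h::'z\<Rightarrow>real. continuous_map Z (top_of_set {0..1}) h \<and> h k = 0 \<and> h ` (topspace Z - O' k) \<subseteq> {1}"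
    unfolding completely_regular_space_def by blast
  then obtain h :: "'z \<Rightarrow> 'z \<Rightarrow> real" where h:
      "\<And>k. k \<in> topspace Z \<Longrightarrow> continuous_map Z (top_of_set {0..1}) (h k)"
      "\<And>k. k \<in> topspace Z \<Longrightarrow> h k k = 0"
      "\<And>k z. k \<in> topspace Z \<Longrightarrow> z \<in> topspace Z \<Longrightarrow> z \<notin> O' k \<Longrightarrow> h k z = 1"
    unfolding bchoice_iff by (auto simp: image_subset_iff)
  have h_cont: "continuous_map Z euclideanreal (h k)" if "k \<in> topspace Z" for k
    using h(1)[OF that] by (simp add: continuous_map_in_subtopology)
  \<comment> \<open>Since \<open>h k\<close> is 0 at \<open>k\<close> and 1 off the chart preimage,
    cutting at the intermediate level 1/2 leaves room for the closed set \<open>C k\<close>: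
    \<open>\<beta> k\<close> is positive exactly on the open set \<open>N k\<close>, and
    \<open>C k\<close> stays inside the preimage.\<close>
  define \<beta> where "\<beta> = (\<lambda>k z. max 0 (1/2 - h k z))"
  define C where "C = (\<lambda>k. {z \<in> topspace Z. h k z \<in> {..1/2}})"
  define N where "N = (\<lambda>k. {z \<in> topspace Z. h k z \<in> {..<1/2}})"
  have N_open: "openin Z (N k)" if "k \<in> topspace Z" for k
    unfolding N_def by (rule openin_continuous_map_preimage[OF h_cont[OF that]]) simp
  have "topspace Z \<subseteq> \<Union>(N ` topspace Z)" using h(2) by (auto simp: N_def)
  then obtain \<F> where "finite \<F>" "\<F> \<subseteq> N ` topspace Z" "topspace Z \<subseteq> \<Union>\<F>"
    using Z(1) N_open unfolding compact_space_alt by (metis (no_types, lifting) imageE)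
  then obtain K where K: "finite K" "K \<subseteq> topspace Z" "topspace Z \<subseteq> \<Union>(N ` K)"
    by (metis finite_subset_image)
  have "vb_cover Z M F E U n \<phi> c \<beta> C K"
  proof (rule vb_cover.intro)
    fix k assume "k \<in> K"
    then have k: "k \<in> topspace Z" using K by blast
    show "continuous_map Z euclideanreal (\<beta> k)"
      unfolding \<beta>_def by (intro continuous_map_real_max continuous_intros h_cont k)
    show "closedin Z (C k)"
      unfolding C_def by (rule closedin_continuous_map_preimage[OF h_cont[OF k]]) simp
    show "F z \<in> U k" if "z \<in> C k" for z
      using that h(3)[OF k, of z] by (force simp: C_def O'_def)
    show "\<beta> k z = 0" if "z \<in> topspace Z" "z \<notin> C k" for z
      using that by (simp add: \<beta>_def C_def)
  next
    fix z assume z: "z \<in> topspace Z"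
    then obtain k where "k \<in> K" "z \<in> N k" using K(3) by blast
    then show "\<exists>k\<in>K. \<beta> k z \<noteq> 0" by (intro bexI[of _ k]) (auto simp: \<beta>_def N_def)
  qed (fact F E_proj U_open chart c K | use module in blast)+
  then show thesis using that vb_cover.frame by blast
qed

section \<open>Equivariant homotopies in frame coordinates\<close>

text \<open>Removes the restriction to a single fibre that the use of \<open>group_action\<close>
  forces on the action maps.\<close>

lemma fiberwise_action_props:
  assumes a: "fiberwise_action B \<G> S q a" and b: "b \<in> topspace B" and z: "z \<in> topspace S" "q z = b"
  shows "g \<in> carrier (fgroup \<G> b) \<Longrightarrow> a g z \<in> topspace S \<and> q (a g z) = b"
    and "\<lbrakk>g \<in> carrier (fgroup \<G> b); h \<in> carrier (fgroup \<G> b)\<rbrakk>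
      \<Longrightarrow> a (h \<otimes>\<^bsub>fgroup \<G> b\<^esub> g) z = a h (a g z)"
    and "a \<one>\<^bsub>fgroup \<G> b\<^esub> z = z"
proof -
  let ?S = "{z \<in> topspace S. q z = b}" and ?a = "\<lambda>g. \<lambda>z\<in>{z \<in> topspace S. q z = b}. a g z"
  interpret group_action "fgroup \<G> b" ?S ?a
    using a b unfolding fiberwise_action_def by blast
  have z': "z \<in> ?S" using z by simp
  have closed: "a g z \<in> ?S" if "g \<in> carrier (fgroup \<G> b)" for g
    using element_image[OF that z' refl] z' by simp
  then show "g \<in> carrier (fgroup \<G> b) \<Longrightarrow> a g z \<in> topspace S \<and> q (a g z) = b" by blast
  show "a (h \<otimes>\<^bsub>fgroup \<G> b\<^esub> g) z = a h (a g z)"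
    if "g \<in> carrier (fgroup \<G> b)" "h \<in> carrier (fgroup \<G> b)"
    using composition_rule[OF z' that(2,1)] z' closed[OF that(1)] by simp
  show "a \<one>\<^bsub>fgroup \<G> b\<^esub> z = z"
    using fun_cong[OF id_eq_one, of z] z' by simp
qed

locale equivariant_homotopy =
  fixes B :: "'b topology" and G :: "'h monoid" and T :: "'h topology" and \<G> :: "('g, 'b) group_bundle"
    and Yb :: "('y, 'b, 'g) G_space" and Xb :: "('x, 'b, 'g) G_space"
    and f :: "real \<Rightarrow> 'y \<Rightarrow> 'x" and E :: "('e, 'x, 'g) equivariant_vb"
    and I :: "'i set" and J :: "'y \<times> real \<Rightarrow> 'e \<Rightarrow> 'i \<Rightarrow> complex" and P :: "'y \<times> real \<Rightarrow> ('i \<Rightarrow> complex) \<Rightarrow> 'e"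
  assumes group_bundle: "lie_group_bundle G T B \<G>"
    and Y_proj: "continuous_map (tspace Yb) B (bproj Yb)"
    and Y_act: "fiberwise_action B \<G> (tspace Yb) (bproj Yb) (act Yb)"
    and Y_compact: "compact_space (tspace Yb)"
    and f_G_map: "\<And>t. t \<in> {0..1} \<Longrightarrow> G_map \<G> Yb Xb (f t)"
    and E_equivariant: "equivariant_vector_bundle B \<G> Xb E"
    and frame: "vb_frame (prod_topology (tspace Yb) (top_of_set {0..1})) (\<lambda>(y, t). f t y) E I J P"
begin

abbreviation "Y \<equiv> topspace (tspace Yb)"
abbreviation "\<pi> \<equiv> bproj Yb"
abbreviation "Z \<equiv> prod_topology (tspace Yb) (top_of_set {0..1::real})"
abbreviation "Gr y \<equiv> fgroup \<G> (\<pi> y)"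
abbreviation "V y s \<equiv> fiber E (f s y)"

sublocale vb_frame Z "\<lambda>(y, t). f t y" E I J P by (fact frame)

lemma Z_in: "y \<in> Y \<Longrightarrow> s \<in> {0..1} \<Longrightarrow> (y, s) \<in> topspace Z" by simp

lemma pi_in: "y \<in> Y \<Longrightarrow> \<pi> y \<in> topspace B"
  using Y_proj by (auto simp: continuous_map_def)

lemma Gr_group: "y \<in> Y \<Longrightarrow> group (Gr y)"
  and Gr_carrier: "y \<in> Y \<Longrightarrow> carrier (Gr y) = {g \<in> topspace (tspace \<G>). bproj \<G> g = \<pi> y}"
  using group_bundle pi_in by (simp_all add: lie_group_bundle_def fiber_def)

lemma act_Y:
  assumes "y \<in> Y" "g \<in> carrier (Gr y)"
  shows "act Yb g y \<in> Y" "\<pi> (act Yb g y) = \<pi> y"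
  using fiberwise_action_props(1)[OF Y_act pi_in[OF assms(1)] assms(1) refl assms(2)] by auto

lemma act_Y_mult:
  assumes "y \<in> Y" "g \<in> carrier (Gr y)" "h \<in> carrier (Gr y)"
  shows "act Yb (h \<otimes>\<^bsub>Gr y\<^esub> g) y = act Yb h (act Yb g y)"
  using fiberwise_action_props(2)[OF Y_act pi_in[OF assms(1)] assms(1) refl assms(2,3)] .

lemma act_Y_one: "y \<in> Y \<Longrightarrow> act Yb \<one>\<^bsub>Gr y\<^esub> y = y"
  using fiberwise_action_props(3)[OF Y_act pi_in _ refl] by blast

lemma act_Y_inv:
  assumes "y \<in> Y" "g \<in> carrier (Gr y)"
  shows "act Yb (inv\<^bsub>Gr y\<^esub> g) (act Yb g y) = y"
proof -
  interpret group "Gr y" using Gr_group assms by blast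
  show ?thesis
    using act_Y_mult[OF assms(1,2) inv_closed[OF assms(2)]] act_Y_one[OF assms(1)] assms(2) by simp
qed

lemma f_props:
  assumes "y \<in> Y" "s \<in> {0..1}"
  shows "f s y \<in> topspace (tspace Xb)" "bproj Xb (f s y) = \<pi> y"
    and "g \<in> carrier (Gr y) \<Longrightarrow> f s (act Yb g y) = act Xb g (f s y)"
  using f_G_map[OF assms(2)] assms(1) unfolding G_map_def
  by (auto simp: continuous_map_def Gr_carrier)

lemma E_bundle: "vector_bundle (tspace Xb) E"
  and E_act: "fiberwise_action B \<G> (tspace E) (bproj Xb \<circ> bproj E) (act E)"
  using E_equivariant unfolding equivariant_vector_bundle_def by blast+

lemma carrier_vfiber:
  assumes "y \<in> Y" "s \<in> {0..1}"
  shows "carrier (vfiber E (f s y)) = V y s"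
  using E_bundle f_props(1)[OF assms] unfolding vector_bundle_def by blast

lemma V_D:
  assumes "y \<in> Y" "s \<in> {0..1}" "e \<in> V y s"
  shows "e \<in> topspace (tspace E)" "bproj E e = f s y" "(bproj Xb \<circ> bproj E) e = \<pi> y"
  using assms f_props by (auto simp: fiber_def)

lemma act_E:
  assumes "y \<in> Y" "s \<in> {0..1}" "e \<in> V y s" "g \<in> carrier (Gr y)"
  shows "act E g e \<in> V (act Yb g y) s"
proof -
  note e = V_D[OF assms(1-3)]
  have g: "g \<in> topspace (tspace \<G>)" "bproj \<G> g = \<pi> y" using assms(4) Gr_carrier[OF assms(1)] by auto
  have "act E g e \<in> topspace (tspace E)"
    using fiberwise_action_props(1)[OF E_act pi_in[OF assms(1)] e(1) e(3) assms(4)] by simp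
  moreover have "bproj E (act E g e) = act Xb g (bproj E e)"
    using E_equivariant g e unfolding equivariant_vector_bundle_def by auto
  ultimately show ?thesis
    using f_props(3)[OF assms(1,2,4)] e by (simp add: fiber_def)
qed

lemma act_E_mult:
  assumes "y \<in> Y" "s \<in> {0..1}" "e \<in> V y s" "g \<in> carrier (Gr y)" "h \<in> carrier (Gr y)"
  shows "act E (h \<otimes>\<^bsub>Gr y\<^esub> g) e = act E h (act E g e)"
  using fiberwise_action_props(2)[OF E_act pi_in[OF assms(1)] V_D(1,3)[OF assms(1-3)] assms(4,5)] .

lemma act_E_one:
  assumes "y \<in> Y" "s \<in> {0..1}" "e \<in> V y s"
  shows "act E \<one>\<^bsub>Gr y\<^esub> e = e"
  using fiberwise_action_props(3)[OF E_act pi_in[OF assms(1)] V_D(1,3)[OF assms(1-3)]] .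

lemma act_E_linear:
  assumes "y \<in> Y" "s \<in> {0..1}" "g \<in> carrier (Gr y)"
  shows "e \<in> V y s \<Longrightarrow> e' \<in> V y s \<Longrightarrow> act E g (e \<oplus>\<^bsub>vfiber E (f s y)\<^esub> e')
      = act E g e \<oplus>\<^bsub>vfiber E (f s (act Yb g y))\<^esub> act E g e'"
    and "e \<in> V y s \<Longrightarrow> act E g (a \<odot>\<^bsub>vfiber E (f s y)\<^esub> e) = a \<odot>\<^bsub>vfiber E (f s (act Yb g y))\<^esub> act E g e"
proof -
  have "g \<in> topspace (tspace \<G>)" "bproj \<G> g = \<pi> y" using assms(3) Gr_carrier[OF assms(1)] by auto
  then have "linear_map (vfiber E (f s y)) (vfiber E (f s (act Yb g y))) (act E g)"
    using E_equivariant f_props[OF assms(1,2)] assms(3)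
    unfolding equivariant_vector_bundle_def by auto
  then show "e \<in> V y s \<Longrightarrow> e' \<in> V y s \<Longrightarrow> act E g (e \<oplus>\<^bsub>vfiber E (f s y)\<^esub> e')
      = act E g e \<oplus>\<^bsub>vfiber E (f s (act Yb g y))\<^esub> act E g e'"
    "e \<in> V y s \<Longrightarrow> act E g (a \<odot>\<^bsub>vfiber E (f s y)\<^esub> e) = a \<odot>\<^bsub>vfiber E (f s (act Yb g y))\<^esub> act E g e"
    unfolding linear_map_def carrier_vfiber[OF assms(1,2)] by blast+
qed

lemma P_V: "y \<in> Y \<Longrightarrow> s \<in> {0..1} \<Longrightarrow> P (y, s) v \<in> V y s"
  using P_fiber[OF Z_in] by simp

abbreviation (input) unit_vec :: "'i \<Rightarrow> 'i \<Rightarrow> complex" where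
  "unit_vec j \<equiv> \<lambda>i. if i = j then 1 else 0"

text \<open>The action of \<open>g\<close> in frame coordinates: since \<open>P\<close> splits \<open>J\<close>, this is a groupoid representation
  by non-invertible matrices, with \<open>R \<one>\<close> the idempotent that cuts out the bundle.\<close>

definition R :: "'g \<Rightarrow> 'y \<Rightarrow> real \<Rightarrow> 'i \<times> 'i \<Rightarrow> complex" where
  "R g y s = (\<lambda>(i, j). if i \<in> I \<and> j \<in> I then J (act Yb g y, s) (act E g (P (y, s) (unit_vec j))) i else 0)"

definition idem :: "'y \<Rightarrow> real \<Rightarrow> 'i \<times> 'i \<Rightarrow> complex" where
  "idem y s = (\<lambda>(i, j). if i \<in> I \<and> j \<in> I then J (y, s) (P (y, s) (unit_vec j)) i else 0)"

lemma R_fsupp: "R g y s \<in> fsupp (I \<times> I)"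
  and idem_fsupp: "idem y s \<in> fsupp (I \<times> I)"
  by (auto simp: R_def idem_def fsupp_def)

lemma R_one: "y \<in> Y \<Longrightarrow> s \<in> {0..1} \<Longrightarrow> R \<one>\<^bsub>Gr y\<^esub> y s = idem y s"
  using act_E_one[OF _ _ P_V] act_Y_one by (simp add: R_def idem_def fun_eq_iff)

lemma J_Z_add:
  assumes "y \<in> Y" "s \<in> {0..1}" "e \<in> V y s" "e' \<in> V y s"
  shows "J (y, s) (e \<oplus>\<^bsub>vfiber E (f s y)\<^esub> e') = J (y, s) e + J (y, s) e'"
  using J_add[OF Z_in[OF assms(1,2)]] assms by simp

lemma J_Z_smult:
  assumes "y \<in> Y" "s \<in> {0..1}" "e \<in> V y s"
  shows "J (y, s) (a \<odot>\<^bsub>vfiber E (f s y)\<^esub> e) = (\<lambda>i. a * J (y, s) e i)"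
  using J_smult[OF Z_in[OF assms(1,2)]] assms by simp

lemma P_Z_add:
  assumes "y \<in> Y" "s \<in> {0..1}"
  shows "P (y, s) (u + v) = P (y, s) u \<oplus>\<^bsub>vfiber E (f s y)\<^esub> P (y, s) v"
  using P_add[OF Z_in[OF assms]] by simp

lemma P_Z_smult:
  assumes "y \<in> Y" "s \<in> {0..1}"
  shows "P (y, s) (\<lambda>i. a * v i) = a \<odot>\<^bsub>vfiber E (f s y)\<^esub> P (y, s) v"
  using P_smult[OF Z_in[OF assms]] by simp

lemma P_J_Z:
  assumes "y \<in> Y" "s \<in> {0..1}" "e \<in> V y s"
  shows "P (y, s) (J (y, s) e) = e"
  using P_J[OF Z_in[OF assms(1,2)]] assms by simp

text \<open>The entries of \<open>R\<close> are the values on unit vectors; linearity of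
  \<open>P\<close>, of the action and of \<open>J\<close> extends this to all
  \<open>v\<close>.\<close>

lemma J_act_P:
  assumes y: "y \<in> Y" "s \<in> {0..1}" and g: "g \<in> carrier (Gr y)"
  shows "J (act Yb g y, s) (act E g (P (y, s) v)) = mvec I (R g y s) v"
proof
  fix i
  let ?y = "act Yb g y"
  have y': "?y \<in> Y" using act_Y[OF y(1) g] by blast
  let ?L = "\<lambda>v. J (?y, s) (act E g (P (y, s) v)) i"
  show "?L v = mvec I (R g y s) v i"
  proof (cases "i \<in> I")
    case True
    have "?L v = (\<Sum>j\<in>I. ?L (unit_vec j) * v j)"
    proof (rule linear_functional_eq_sum[OF finite_I])
      show "?L (u + v) = ?L u + ?L v" for u v
        using J_Z_add[OF y' y(2) act_E[OF y P_V[OF y] g] act_E[OF y P_V[OF y] g]]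
        by (simp add: P_Z_add[OF y] act_E_linear(1)[OF y g P_V[OF y] P_V[OF y]])
      show "?L (\<lambda>i. c * v i) = c * ?L v" for c v
        using J_Z_smult[OF y' y(2) act_E[OF y P_V[OF y] g]]
        by (simp add: P_Z_smult[OF y] act_E_linear(2)[OF y g P_V[OF y]])
      show "?L u = ?L v" if "\<And>i. i \<in> I \<Longrightarrow> u i = v i" for u v
        using P_supp[OF Z_in[OF y] that] by simp
    qed
    then show ?thesis using True by (simp add: mvec_def R_def)
  next
    case False
    then show ?thesis using fsuppD[OF J_fsupp False] by (simp add: mvec_def R_def)
  qed
qed

lemma J_act:
  assumes y: "y \<in> Y" "s \<in> {0..1}" and g: "g \<in> carrier (Gr y)" and e: "e \<in> V y s"
  shows "J (act Yb g y, s) (act E g e) = mvec I (R g y s) (J (y, s) e)"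
  using J_act_P[OF y g, of "J (y, s) e"] P_J_Z[OF y e] by simp

lemma one_in: "y \<in> Y \<Longrightarrow> \<one>\<^bsub>Gr y\<^esub> \<in> carrier (Gr y)"
  by (rule monoid.one_closed[OF group.is_monoid[OF Gr_group]])

lemma inv_in: "y \<in> Y \<Longrightarrow> g \<in> carrier (Gr y) \<Longrightarrow> inv\<^bsub>Gr y\<^esub> g \<in> carrier (Gr y)"
  by (rule group.inv_closed[OF Gr_group])

lemma J_P:
  assumes y: "y \<in> Y" "s \<in> {0..1}"
  shows "J (y, s) (P (y, s) v) = mvec I (idem y s) v"
  using J_act_P[OF y one_in[OF y(1)], of v] act_E_one[OF y P_V[OF y]] act_Y_one[OF y(1)] R_one[OF y] by simp

lemma idem_J:
  assumes y: "y \<in> Y" "s \<in> {0..1}" "e \<in> V y s"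
  shows "mvec I (idem y s) (J (y, s) e) = J (y, s) e"
  using J_P[OF y(1,2), of "J (y, s) e"] P_J_Z[OF y] by simp

text \<open>\<open>P\<close> after \<open>J\<close> is the identity on the intermediate fibre, so
  passing to frame coordinates between the two actions loses nothing.\<close>

lemma R_mult:
  assumes y: "y \<in> Y" "s \<in> {0..1}" and g: "g \<in> carrier (Gr y)" and h: "h \<in> carrier (Gr y)"
  shows "mmul I (R h (act Yb g y) s) (R g y s) = R (h \<otimes>\<^bsub>Gr y\<^esub> g) y s"
proof (rule ext, clarify)
  fix i j
  let ?y = "act Yb g y" and ?v = "P (y, s) (unit_vec j)"
  note y' = act_Y[OF y(1) g]
  have h': "h \<in> carrier (Gr ?y)" using h y' by simp
  show "mmul I (R h ?y s) (R g y s) (i, j) = R (h \<otimes>\<^bsub>Gr y\<^esub> g) y s (i, j)"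
  proof (cases "i \<in> I \<and> j \<in> I")
    case True
    have "R (h \<otimes>\<^bsub>Gr y\<^esub> g) y s (i, j) = J (act Yb h ?y, s) (act E h (act E g ?v)) i"
      using True by (simp add: R_def act_Y_mult[OF y(1) g h] act_E_mult[OF y P_V[OF y] g h])
    also have "\<dots> = mvec I (R h ?y s) (J (?y, s) (act E g ?v)) i"
      using J_act[OF y'(1) y(2) h' act_E[OF y P_V[OF y] g]] by simp
    also have "\<dots> = mmul I (R h ?y s) (R g y s) (i, j)"
      using True by (simp add: mvec_def mmul_def R_def)
    finally show ?thesis by simp
  next
    case False
    then show ?thesis
      using fsuppD[OF R_fsupp] fsuppD[OF mmul_fsupp[OF R_fsupp R_fsupp]] by simp
  qed
qed

lemma R_idem:
  assumes y: "y \<in> Y" "s \<in> {0..1}" and g: "g \<in> carrier (Gr y)"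
  shows "mmul I (R g y s) (idem y s) = R g y s" "mmul I (idem (act Yb g y) s) (R g y s) = R g y s"
    and "mmul I (R (inv\<^bsub>Gr y\<^esub> g) (act Yb g y) s) (R g y s) = idem y s"
    and "mmul I (R g y s) (R (inv\<^bsub>Gr y\<^esub> g) (act Yb g y) s) = idem (act Yb g y) s"
proof -
  interpret group "Gr y" using Gr_group y by blast
  note y' = act_Y[OF y(1) g]
  have i: "inv\<^bsub>Gr y\<^esub> g \<in> carrier (Gr y)" "inv\<^bsub>Gr y\<^esub> g \<in> carrier (Gr (act Yb g y))" "g \<in> carrier (Gr (act Yb g y))"
    using g y' by auto
  show "mmul I (R g y s) (idem y s) = R g y s"
    using R_mult[OF y one_closed g] g by (simp add: R_one[OF y] act_Y_one[OF y(1)])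
  show "mmul I (idem (act Yb g y) s) (R g y s) = R g y s"
    using R_mult[OF y g one_closed] R_one[OF y'(1) y(2)] g y' by simp
  show "mmul I (R (inv\<^bsub>Gr y\<^esub> g) (act Yb g y) s) (R g y s) = idem y s"
    using R_mult[OF y g i(1)] g by (simp add: R_one[OF y])
  show "mmul I (R g y s) (R (inv\<^bsub>Gr y\<^esub> g) (act Yb g y) s) = idem (act Yb g y) s"
    using R_mult[OF y'(1) y(2) i(2) i(3)] g R_one[OF y'(1) y(2)] y' act_Y_inv[OF y(1) g] by simp
qed

lemma idem_idem:
  assumes y: "y \<in> Y" "s \<in> {0..1}"
  shows "mmul I (idem y s) (idem y s) = idem y s"
  using R_idem(1)[OF y one_in[OF y(1)]] R_one[OF y] by simp

section \<open>Continuity of the matrices along continuous families of points and group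
  elements\<close>

lemma J_comp_cont:
  assumes "continuous_map S Z z" "continuous_map S (tspace E) e"
    and "\<And>x. x \<in> topspace S \<Longrightarrow> bproj E (e x) = (\<lambda>(y, t). f t y) (z x)"
  shows "continuous_map S euclidean (\<lambda>x. J (z x) (e x) i)"
proof -
  have "continuous_map S (subtopology (prod_topology Z (tspace E))
      {p. (\<lambda>(y, t). f t y) (fst p) = bproj E (snd p)}) (\<lambda>x. (z x, e x))"
    by (rule continuous_map_into_subtopology) (use assms in \<open>auto intro: continuous_map_pairedI\<close>)
  from continuous_map_compose[OF this J_cont] show ?thesis by (simp add: o_def)
qed

lemma P_comp_cont:
  assumes "continuous_map S Z z" "\<And>i. continuous_map S euclidean (\<lambda>x. v x i)"
  shows "continuous_map S (tspace E) (\<lambda>x. P (z x) (v x))"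
proof -
  have "continuous_map S euclidean v" using assms(2) continuous_map_fun_iff by blast
  from continuous_map_compose[OF continuous_map_pairedI[OF assms(1) this] P_cont]
  show ?thesis by (simp add: o_def)
qed

lemma act_comp_cont:
  assumes a: "fiberwise_action B \<G> S' q a" and "continuous_map S (tspace \<G>) g" "continuous_map S S' z"
    and "\<And>x. x \<in> topspace S \<Longrightarrow> bproj \<G> (g x) = q (z x)"
  shows "continuous_map S S' (\<lambda>x. a (g x) (z x))"
proof -
  have "continuous_map S (subtopology (prod_topology (tspace \<G>) S') {(g, z). bproj \<G> g = q z}) (\<lambda>x. (g x, z x))"
    by (rule continuous_map_into_subtopology) (use assms in \<open>auto intro: continuous_map_pairedI\<close>)
  moreover have "continuous_map (subtopology (prod_topology (tspace \<G>) S') {(g, z). bproj \<G> g = q z}) S' (\<lambda>(g, z). a g z)"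
    using a unfolding fiberwise_action_def by blast
  ultimately have "continuous_map S S' ((\<lambda>(g, z). a g z) \<circ> (\<lambda>x. (g x, z x)))"
    by (rule continuous_map_compose)
  then show ?thesis by (simp add: o_def)
qed

lemma Z_comp:
  assumes "continuous_map S Z z" "x \<in> topspace S"
  shows "fst (z x) \<in> Y" "snd (z x) \<in> {0..1}"
proof -
  have "z x \<in> topspace Z"
    using assms unfolding continuous_map_def by blast
  then show "fst (z x) \<in> Y" "snd (z x) \<in> {0..1}"
    unfolding topspace_prod_topology mem_Times_iff by simp_all
qed

lemma idem_cont:
  assumes z: "continuous_map S Z z"
  shows "continuous_map S euclidean (\<lambda>x. idem (fst (z x)) (snd (z x)) p)"
proof -
  obtain i j where p: "p = (i, j)" by force
  have "continuous_map S euclidean (\<lambda>x. J (z x) (P (z x) (unit_vec j)) i)"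
  proof (rule J_comp_cont[OF z P_comp_cont[OF z]])
    fix x assume "x \<in> topspace S"
    from Z_comp[OF z this] show "bproj E (P (z x) (unit_vec j)) = (\<lambda>(y, t). f t y) (z x)"
      using V_D(2)[OF _ _ P_V] by (cases "z x") simp
  qed simp
  then show ?thesis
    by (cases "i \<in> I \<and> j \<in> I") (auto simp: idem_def p)
qed

lemma act_Y_cont:
  assumes z: "continuous_map S Z z" and g: "continuous_map S (tspace \<G>) g"
    and gz: "\<And>x. x \<in> topspace S \<Longrightarrow> bproj \<G> (g x) = \<pi> (fst (z x))"
  shows "continuous_map S Z (\<lambda>x. (act Yb (g x) (fst (z x)), snd (z x)))"
  using continuous_map_compose[OF z continuous_map_fst] continuous_map_compose[OF z continuous_map_snd]
  by (intro continuous_map_pairedI act_comp_cont[OF Y_act g]) (auto simp: o_def gz)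

lemma R_cont:
  assumes z: "continuous_map S Z z" and g: "continuous_map S (tspace \<G>) g"
    and gz: "\<And>x. x \<in> topspace S \<Longrightarrow> bproj \<G> (g x) = \<pi> (fst (z x))"
  shows "continuous_map S euclidean (\<lambda>x. R (g x) (fst (z x)) (snd (z x)) p)"
proof -
  obtain i j where p: "p = (i, j)" by force
  let ?v = "\<lambda>x. P (z x) (unit_vec j)"
  have v: "?v x \<in> V (fst (z x)) (snd (z x))" if "x \<in> topspace S" for x
    using P_V[OF Z_comp[OF z that]] by simp
  have gx: "g x \<in> carrier (Gr (fst (z x)))" if "x \<in> topspace S" for x
    using Gr_carrier[OF Z_comp(1)[OF z that]] gz[OF that] g that by (auto simp: continuous_map_def)
  have ae: "continuous_map S (tspace E) (\<lambda>x. act E (g x) (?v x))"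
    by (rule act_comp_cont[OF E_act g P_comp_cont[OF z]])
      (use V_D(3)[OF Z_comp[OF z] v] gz in auto)
  have az: "continuous_map S Z (\<lambda>x. (act Yb (g x) (fst (z x)), snd (z x)))"
    by (rule act_Y_cont[OF z g]) (rule gz)
  have "continuous_map S euclidean
      (\<lambda>x. J (act Yb (g x) (fst (z x)), snd (z x)) (act E (g x) (?v x)) i)"
  proof (rule J_comp_cont[OF az ae])
    fix x assume x: "x \<in> topspace S"
    have "act E (g x) (?v x) \<in> V (act Yb (g x) (fst (z x))) (snd (z x))"
      using act_E[OF Z_comp[OF z x] v[OF x] gx[OF x]] .
    then show "bproj E (act E (g x) (?v x)) = (\<lambda>(y, t). f t y) (act Yb (g x) (fst (z x)), snd (z x))"
      by (simp add: fiber_def)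
  qed
  then show ?thesis
    by (cases "i \<in> I \<and> j \<in> I") (auto simp: R_def p)
qed

end

section \<open>The averaged intertwiner\<close>

lemma mmul_lincomb_right:
    "mmul I A (\<lambda>p. a * Q p + b * Q' p) = (\<lambda>p. a * mmul I A Q p + b * mmul I A Q' p)"
  and mmul_lincomb_left:
    "mmul I (\<lambda>p. a * Q p + b * Q' p) A = (\<lambda>p. a * mmul I Q A p + b * mmul I Q' A p)"
  by (auto simp: mmul_def fun_eq_iff sum.distrib sum_distrib_left algebra_simps)

locale equivariant_homotopy_at = equivariant_homotopy B G T \<G> Yb Xb f E I J P
  for B :: "'b topology" and G :: "'h monoid" and T :: "'h topology" and \<G> :: "('g, 'b) group_bundle"
    and Yb :: "('y, 'b, 'g) G_space" and Xb :: "('x, 'b, 'g) G_space"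
    and f :: "real \<Rightarrow> 'y \<Rightarrow> 'x" and E :: "('e, 'x, 'g) equivariant_vb"
    and I :: "'i set" and J :: "'y \<times> real \<Rightarrow> 'e \<Rightarrow> 'i \<Rightarrow> complex" and P :: "'y \<times> real \<Rightarrow> ('i \<Rightarrow> complex) \<Rightarrow> 'e" +
  fixes t :: real
  assumes t: "t \<in> {0..1}"
begin

text \<open>\<open>R\<close> of the inverse element at the moved point stands for the inverse of
  \<open>R g y t\<close>, which exists only relative to the idempotents. The first product is thus
  \<open>Q\<close> transported to the point \<open>g y\<close>.\<close>

definition res1 :: "'y \<Rightarrow> real \<Rightarrow> ('i \<times> 'i \<Rightarrow> complex) \<Rightarrow> 'g \<Rightarrow> 'i \<times> 'i \<Rightarrow> complex" where
  "res1 y s Q g = mmul I (mmul I (R g y s) Q) (R (inv\<^bsub>Gr y\<^esub> g) (act Yb g y) t)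
     - mmul I (idem (act Yb g y) s) (idem (act Yb g y) t)"

text \<open>The part of \<open>Q\<close> to which \<open>res1\<close> is blind.\<close>

definition res2 :: "'y \<Rightarrow> real \<Rightarrow> ('i \<times> 'i \<Rightarrow> complex) \<Rightarrow> 'i \<times> 'i \<Rightarrow> complex" where
  "res2 y s Q = Q - mmul I (mmul I (idem y s) Q) (idem y t)"

definition residual :: "bool \<times> 'i \<times> 'i \<Rightarrow> 'y \<times> real \<Rightarrow> ('i \<times> 'i \<Rightarrow> complex) \<Rightarrow> 'g \<Rightarrow> complex" where
  "residual k z Q g = (if fst k then res1 (fst z) (snd z) Q g else res2 (fst z) (snd z) Q) (snd k)"

abbreviation "K \<equiv> (UNIV :: bool set) \<times> (I \<times> I)"

definition sumsq :: "'y \<times> real \<Rightarrow> ('i \<times> 'i \<Rightarrow> complex) \<Rightarrow> 'g \<Rightarrow> real" where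
  "sumsq z Q g = (\<Sum>k\<in>K. (norm (residual k z Q g))\<^sup>2)"

definition cost :: "'y \<times> real \<Rightarrow> ('i \<times> 'i \<Rightarrow> complex) \<Rightarrow> real" where
  "cost z Q = (SUP g\<in>carrier (Gr (fst z)). sumsq z Q g)"

text \<open>Defined through the chart-free \<open>cost\<close>, so that the minimisers found in
  different charts of \<open>\<G>\<close> are values of one global function.\<close>

definition Min :: "'y \<times> real \<Rightarrow> 'i \<times> 'i \<Rightarrow> complex" where
  "Min z = (THE Q. Q \<in> fsupp (I \<times> I) \<and> (\<forall>Q'\<in>fsupp (I \<times> I). cost z Q \<le> cost z Q'))"

lemma finite_K: "finite K"
  using finite_I by simp

lemma res1_fsupp: "Q \<in> fsupp (I \<times> I) \<Longrightarrow> res1 y s Q g \<in> fsupp (I \<times> I)"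
  unfolding res1_def by (intro diff_fsupp mmul_fsupp R_fsupp idem_fsupp)

lemma res2_fsupp: "Q \<in> fsupp (I \<times> I) \<Longrightarrow> res2 y s Q \<in> fsupp (I \<times> I)"
  unfolding res2_def by (intro diff_fsupp mmul_fsupp R_fsupp idem_fsupp)

lemma residual_affine:
  "residual k z (\<lambda>p. complex_of_real a * Q p + complex_of_real (1 - a) * Q' p) g
   = complex_of_real a * residual k z Q g + complex_of_real (1 - a) * residual k z Q' g"
  unfolding residual_def res1_def res2_def mmul_lincomb_right mmul_lincomb_left
  by (simp add: algebra_simps)

text \<open>Transporting back shows that the translate of \<open>Q\<close> under any single
  \<open>g\<close> determines \<open>idem y s\<close> times \<open>Q\<close> times
  \<open>idem y t\<close>.\<close>

lemma sandwich:
  assumes y: "y \<in> Y" "s \<in> {0..1}" and g: "g \<in> carrier (Gr y)"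
  shows "mmul I (mmul I (R (inv\<^bsub>Gr y\<^esub> g) (act Yb g y) s)
      (mmul I (mmul I (R g y s) Q) (R (inv\<^bsub>Gr y\<^esub> g) (act Yb g y) t))) (R g y t)
    = mmul I (mmul I (idem y s) Q) (idem y t)"
  unfolding R_idem(3)[OF y g, symmetric] R_idem(3)[OF y(1) t g, symmetric]
  by (simp only: mmul_assoc)

text \<open>\<open>res1\<close> determines the compression of \<open>Q\<close> by the idempotents,
  via \<open>sandwich\<close>, and \<open>res2\<close> determines \<open>Q\<close> minus that
  compression.\<close>

lemma residual_inj:
  assumes y: "y \<in> Y" "s \<in> {0..1}" and g: "g \<in> carrier (Gr y)"
    and Q: "Q \<in> fsupp (I \<times> I)" "Q' \<in> fsupp (I \<times> I)"
    and eq: "\<And>k. k \<in> K \<Longrightarrow> residual k (y, s) Q g = residual k (y, s) Q' g"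
  shows "Q = Q'"
proof -
  have "res1 y s Q g p = res1 y s Q' g p" "res2 y s Q p = res2 y s Q' p" if "p \<in> I \<times> I" for p
    using eq[of "(True, p)"] eq[of "(False, p)"] that by (auto simp: residual_def)
  moreover have "res1 y s Q g p = res1 y s Q' g p" "res2 y s Q p = res2 y s Q' p" if "p \<notin> I \<times> I" for p
    using fsuppD[OF res1_fsupp that] fsuppD[OF res2_fsupp that] Q by simp_all
  ultimately have eq': "res1 y s Q g = res1 y s Q' g" "res2 y s Q = res2 y s Q'" by blast+
  then have "mmul I (mmul I (R g y s) Q) (R (inv\<^bsub>Gr y\<^esub> g) (act Yb g y) t)
      = mmul I (mmul I (R g y s) Q') (R (inv\<^bsub>Gr y\<^esub> g) (act Yb g y) t)"
    by (simp add: res1_def)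
  with sandwich[OF y g, of Q] sandwich[OF y g, of Q']
  have "mmul I (mmul I (idem y s) Q) (idem y t) = mmul I (mmul I (idem y s) Q') (idem y t)"
    by simp
  with eq'(2) show ?thesis by (simp add: res2_def)
qed

text \<open>At the unit element, \<open>Q\<close> is the sum of \<open>res1\<close>,
  \<open>res2\<close> and the constant matrix \<open>?c\<close>.\<close>

lemma residual_coercive:
  assumes y: "y \<in> Y" "s \<in> {0..1}"
  shows "\<exists>C. \<forall>Q\<in>fsupp (I \<times> I). \<forall>p. norm (Q p) \<le> C + (\<Sum>k\<in>K. norm (residual k (y, s) Q \<one>\<^bsub>Gr y\<^esub>))"
proof (intro exI ballI allI)
  fix Q p assume Q: "Q \<in> fsupp (I \<times> I)"
  let ?g = "\<one>\<^bsub>Gr y\<^esub>" and ?c = "mmul I (idem y s) (idem y t)"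
  let ?C = "\<Sum>p\<in>I \<times> I. norm (?c p)" and ?S = "\<Sum>k\<in>K. norm (residual k (y, s) Q ?g)"
  interpret group "Gr y" using Gr_group y by blast
  have nonneg: "?C \<ge> 0" "?S \<ge> 0" by (auto intro: sum_nonneg)
  show "norm (Q p) \<le> ?C + ?S"
  proof (cases "p \<in> I \<times> I")
    case True
    have "res1 y s Q ?g = mmul I (mmul I (idem y s) Q) (idem y t) - ?c"
      by (simp add: res1_def act_Y_one[OF y(1)] R_one[OF y] R_one[OF y(1) t])
    then have Qp: "Q p = residual (True, p) (y, s) Q ?g + residual (False, p) (y, s) Q ?g + ?c p"
      by (simp add: residual_def res2_def)
    have "norm (residual (True, p) (y, s) Q ?g) + norm (residual (False, p) (y, s) Q ?g)
        = (\<Sum>k\<in>{(True, p), (False, p)}. norm (residual k (y, s) Q ?g))" by simp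
    also have "\<dots> \<le> ?S" using True finite_K by (intro sum_mono2) auto
    finally have "norm (residual (True, p) (y, s) Q ?g) + norm (residual (False, p) (y, s) Q ?g) \<le> ?S" .
    moreover have "norm (?c p) \<le> ?C" using True finite_I by (intro member_le_sum) auto
    moreover have "norm (Q p) \<le> norm (residual (True, p) (y, s) Q ?g) + norm (residual (False, p) (y, s) Q ?g) + norm (?c p)"
      unfolding Qp using norm_triangle_ineq by (meson add_mono_thms_linordered_semiring(3) order_trans)
    ultimately show ?thesis by linarith
  next
    case False
    then show ?thesis using fsuppD[OF Q False] nonneg by simp
  qed
qed

text \<open>The inverse element enters as a separate continuous family \<open>g'\<close>; in a chart
  it is supplied by inversion in the model group.\<close>

lemma residual_cont:
  assumes z: "continuous_map S Z z" and g: "continuous_map S (tspace \<G>) g"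
    and g': "continuous_map S (tspace \<G>) g'"
    and Q: "\<And>p. continuous_map S euclidean (\<lambda>x. Q x p)"
    and gz: "\<And>x. x \<in> topspace S \<Longrightarrow> bproj \<G> (g x) = \<pi> (fst (z x))"
    and inv: "\<And>x. x \<in> topspace S \<Longrightarrow> g' x = inv\<^bsub>Gr (fst (z x))\<^esub> g x"
  shows "continuous_map S euclidean (\<lambda>x. residual k (z x) (Q x) (g x))"
proof -
  have g_in: "g x \<in> carrier (Gr (fst (z x)))" if "x \<in> topspace S" for x
    using Gr_carrier[OF Z_comp(1)[OF z that]] gz[OF that] g that by (auto simp: continuous_map_def)
  have g'_in: "g' x \<in> carrier (Gr (fst (z x)))" if "x \<in> topspace S" for x
    using inv_in[OF Z_comp(1)[OF z that] g_in[OF that]] inv[OF that] by simp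
  have gz': "bproj \<G> (g' x) = \<pi> (fst (z x))" if "x \<in> topspace S" for x
    using g'_in[OF that] Gr_carrier[OF Z_comp(1)[OF z that]] by simp
  have z_fst: "continuous_map S (tspace Yb) (\<lambda>x. fst (z x))"
    using continuous_map_compose[OF z continuous_map_fst] by (simp add: o_def)
  have zt: "continuous_map S Z (\<lambda>x. (fst (z x), t))"
    using t by (intro continuous_map_pairedI z_fst) simp
  have gzc: "continuous_map S Z (\<lambda>x. (act Yb (g x) (fst (z x)), snd (z x)))"
    by (rule act_Y_cont[OF z g]) (rule gz)
  have gzt: "continuous_map S Z (\<lambda>x. (act Yb (g x) (fst (z x)), t))"
    using act_Y_cont[OF zt g] gz by simp
  have "continuous_map S euclidean (\<lambda>x. R (g x) (fst (z x)) (snd (z x)) p)" for p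
    by (rule R_cont[OF z g]) (rule gz)
  moreover have "continuous_map S euclidean (\<lambda>x. R (g' x) (act Yb (g x) (fst (z x))) t p)" for p
    using R_cont[OF gzt g', of p] gz' act_Y(2)[OF Z_comp(1)[OF z] g_in] by simp
  moreover have "continuous_map S euclidean (\<lambda>x. idem (act Yb (g x) (fst (z x))) (snd (z x)) p)" for p
    using idem_cont[OF gzc] by simp
  moreover have "continuous_map S euclidean (\<lambda>x. idem (act Yb (g x) (fst (z x))) t p)" for p
    using idem_cont[OF gzt] by simp
  moreover have "continuous_map S euclidean (\<lambda>x. idem (fst (z x)) (snd (z x)) p)" for p
    using idem_cont[OF z] .
  moreover have "continuous_map S euclidean (\<lambda>x. idem (fst (z x)) t p)" for p
    using idem_cont[OF zt] by simp
  ultimately have "continuous_map S euclidean (\<lambda>x.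
      (if fst k then mmul I (mmul I (R (g x) (fst (z x)) (snd (z x))) (Q x)) (R (g' x) (act Yb (g x) (fst (z x))) t) (snd k)
       - mmul I (idem (act Yb (g x) (fst (z x))) (snd (z x))) (idem (act Yb (g x) (fst (z x))) t) (snd k)
     else Q x (snd k) - mmul I (mmul I (idem (fst (z x)) (snd (z x))) (Q x)) (idem (fst (z x)) t) (snd k)))"
    by (cases "fst k") (simp_all add: continuous_map_diff continuous_map_mmul finite_I Q)
  then show ?thesis
    by (rule continuous_map_eq) (simp add: residual_def res1_def res2_def inv)
qed

text \<open>A chart of \<open>\<G>\<close> parametrises the varying fibre groups by the fixed
  compact space \<open>T\<close>, which brings the cost into the form required by the locale
  \<open>Chebyshev\<close>.\<close>

lemma local_Chebyshev:
  assumes b0: "b0 \<in> topspace B"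
  obtains U \<phi> where "b0 \<in> U" "openin B U"
    "Chebyshev (subtopology Z {z. \<pi> (fst z) \<in> U}) T (I \<times> I) K
       (\<lambda>k z Q h. residual k z Q (\<phi> (\<pi> (fst z), h)))"
    "\<And>y. y \<in> Y \<Longrightarrow> \<pi> y \<in> U \<Longrightarrow> carrier (Gr y) = (\<lambda>h. \<phi> (\<pi> y, h)) ` topspace T"
proof -
  obtain \<A> where \<A>: "(\<Union>(U, \<phi>)\<in>\<A>. U) = topspace B"
      "\<forall>(U, \<phi>)\<in>\<A>. local_trivialization T B \<G> U \<phi> \<and> (\<forall>b\<in>U. (\<lambda>h. \<phi> (b, h)) \<in> iso G (fgroup \<G> b))"
    using group_bundle unfolding lie_group_bundle_def by (elim conjE exE) (rule that, assumption+)
  have G: "compact_lie_group G T" and G_proj: "continuous_map (tspace \<G>) B (bproj \<G>)"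
    using group_bundle unfolding lie_group_bundle_def by - (elim conjE, assumption)+
  have "b0 \<in> (\<Union>(U, \<phi>)\<in>\<A>. U)" using b0 \<A>(1) by simp
  then obtain U \<phi> where U: "b0 \<in> U" and mem: "(U, \<phi>) \<in> \<A>" by auto
  have triv: "local_trivialization T B \<G> U \<phi>"
    and iso: "\<And>b. b \<in> U \<Longrightarrow> (\<lambda>h. \<phi> (b, h)) \<in> iso G (fgroup \<G> b)"
    using bspec[OF \<A>(2) mem] by simp_all
  have U_open: "openin B U" using triv by (simp add: local_trivialization_def)
  have T: "compact_space T" "group G" "topspace T = carrier G" "continuous_map T T (\<lambda>g. inv\<^bsub>G\<^esub> g)"
    using G unfolding compact_lie_group_def lie_group_def by - (elim conjE exE, assumption)+
  have \<phi>_cont: "continuous_map (prod_topology (subtopology B U) T) (tspace \<G>) \<phi>"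
    using local_trivialization_coordinates[OF triv G_proj] by blast
  have \<phi>_proj: "bproj \<G> (\<phi> (b, h)) = b" if "b \<in> U" "h \<in> topspace T" for b h
    using triv that by (simp add: local_trivialization_def)
  have img: "carrier (Gr y) = (\<lambda>h. \<phi> (\<pi> y, h)) ` topspace T" if "y \<in> Y" "\<pi> y \<in> U" for y
    using iso[OF that(2)] T(3) by (simp add: iso_def bij_betw_def)
  \<comment> \<open>Charts are fibrewise group isomorphisms, so inversion in the fibres inherits
    continuity from inversion in \<open>G\<close>.\<close>
  have inv: "\<phi> (\<pi> y, inv\<^bsub>G\<^esub> h) = inv\<^bsub>Gr y\<^esub> \<phi> (\<pi> y, h)" if "y \<in> Y" "\<pi> y \<in> U" "h \<in> topspace T" for y h
  proof -
    interpret group_hom G "Gr y" "\<lambda>h. \<phi> (\<pi> y, h)"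
      using iso[OF that(2)] T(2) Gr_group[OF that(1)]
      by (simp add: group_hom_def group_hom_axioms_def iso_def)
    show ?thesis using hom_inv that(3) T(3) by simp
  qed
  let ?W = "subtopology Z {z. \<pi> (fst z) \<in> U}"
  have W: "fst z \<in> Y" "snd z \<in> {0..1}" "\<pi> (fst z) \<in> U" if "z \<in> topspace ?W" for z
    using that by auto
  have in_Gr: "\<phi> (\<pi> (fst z), h) \<in> carrier (Gr (fst z))" if "z \<in> topspace ?W" "h \<in> topspace T" for z h
    using img[OF W(1,3)[OF that(1)]] that(2) by blast
  have "Chebyshev ?W T (I \<times> I) K (\<lambda>k z Q h. residual k z Q (\<phi> (\<pi> (fst z), h)))"
  proof (rule Chebyshev.intro)
    show "compact_space T" by fact
    show "topspace T \<noteq> {}" using T(2,3) group.is_monoid monoid.one_closed by blast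
    show "finite (I \<times> I)" "finite K" using finite_I by auto
  next
    fix k :: "bool \<times> 'i \<times> 'i"
    let ?S = "prod_topology (prod_topology ?W (top_of_set (fsupp (I \<times> I)))) T"
    have WQ: "continuous_map ?S (prod_topology ?W (top_of_set (fsupp (I \<times> I)))) fst"
      by (rule continuous_map_fst)
    have "continuous_map ?S ?W (\<lambda>x. fst (fst x))"
      using continuous_map_compose[OF WQ continuous_map_fst] by (simp add: o_def)
    then have z: "continuous_map ?S Z (\<lambda>x. fst (fst x))"
      by (rule continuous_map_into_fulltopology)
    have "continuous_map ?S (top_of_set (fsupp (I \<times> I))) (\<lambda>x. snd (fst x))"
      using continuous_map_compose[OF WQ continuous_map_snd] by (simp add: o_def)
    then have "continuous_map ?S euclidean (\<lambda>x. snd (fst x))"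
      by (rule continuous_map_into_fulltopology)
    then have Q: "continuous_map ?S euclidean (\<lambda>x. snd (fst x) p)" for p
      by (rule continuous_map_fun_iff[THEN iffD1, rule_format])
    have h: "continuous_map ?S T snd" by (rule continuous_map_snd)
    have h': "continuous_map ?S T (\<lambda>x. inv\<^bsub>G\<^esub> (snd x))"
      using continuous_map_compose[OF h T(4)] by (simp add: o_def)
    have "continuous_map ?S B (\<lambda>x. \<pi> (fst (fst (fst x))))"
      using continuous_map_compose[OF continuous_map_compose[OF z continuous_map_fst] Y_proj]
      by (simp add: o_def)
    then have b: "continuous_map ?S (subtopology B U) (\<lambda>x. \<pi> (fst (fst (fst x))))"
      by (rule continuous_map_into_subtopology) auto
    have g: "continuous_map ?S (tspace \<G>) (\<lambda>x. \<phi> (\<pi> (fst (fst (fst x))), snd x))"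
      using continuous_map_compose[OF continuous_map_pairedI[OF b h] \<phi>_cont] by (simp add: o_def)
    have g': "continuous_map ?S (tspace \<G>) (\<lambda>x. \<phi> (\<pi> (fst (fst (fst x))), inv\<^bsub>G\<^esub> (snd x)))"
      using continuous_map_compose[OF continuous_map_pairedI[OF b h'] \<phi>_cont] by (simp add: o_def)
    show "continuous_map ?S euclidean (\<lambda>((z, Q), h). residual k z Q (\<phi> (\<pi> (fst z), h)))"
      unfolding case_prod_unfold
    proof (rule residual_cont[OF z g g' Q])
      fix x assume x: "x \<in> topspace ?S"
      then have w: "fst (fst x) \<in> topspace ?W" and h: "snd x \<in> topspace T"
        unfolding topspace_prod_topology mem_Times_iff by blast+
      show "bproj \<G> (\<phi> (\<pi> (fst (fst (fst x))), snd x)) = \<pi> (fst (fst (fst x)))"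
        "\<phi> (\<pi> (fst (fst (fst x))), inv\<^bsub>G\<^esub> (snd x))
          = inv\<^bsub>Gr (fst (fst (fst x)))\<^esub> \<phi> (\<pi> (fst (fst (fst x))), snd x)"
        by (rule \<phi>_proj[OF W(3)[OF w] h], rule inv[OF W(1,3)[OF w] h])
    qed
  next
    fix k :: "bool \<times> 'i \<times> 'i" and w h and Q Q' :: "'i \<times> 'i \<Rightarrow> complex" and a
    show "residual k w (\<lambda>j. complex_of_real a * Q j + complex_of_real (1 - a) * Q' j) (\<phi> (\<pi> (fst w), h))
      = complex_of_real a * residual k w Q (\<phi> (\<pi> (fst w), h))
        + complex_of_real (1 - a) * residual k w Q' (\<phi> (\<pi> (fst w), h))"
      by (rule residual_affine)
  next
    fix w h and Q Q' :: "'i \<times> 'i \<Rightarrow> complex"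
    assume w: "w \<in> topspace ?W" and h: "h \<in> topspace T"
      and Q: "Q \<in> fsupp (I \<times> I)" "Q' \<in> fsupp (I \<times> I)"
      and eq: "\<And>k. k \<in> K \<Longrightarrow> residual k w Q (\<phi> (\<pi> (fst w), h)) = residual k w Q' (\<phi> (\<pi> (fst w), h))"
    show "Q = Q'"
      by (rule residual_inj[OF W(1,2)[OF w] in_Gr[OF w h] Q]) (use eq in simp)
  next
    fix w assume w: "w \<in> topspace ?W"
    have "\<one>\<^bsub>Gr (fst w)\<^esub> \<in> (\<lambda>h. \<phi> (\<pi> (fst w), h)) ` topspace T"
      using one_in[OF W(1)[OF w]] img[OF W(1,3)[OF w]] by simp
    then obtain h where h: "h \<in> topspace T" "\<phi> (\<pi> (fst w), h) = \<one>\<^bsub>Gr (fst w)\<^esub>" by auto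
    show "\<exists>h\<in>topspace T. \<exists>C. \<forall>Q\<in>fsupp (I \<times> I). \<forall>j.
        norm (Q j) \<le> C + (\<Sum>k\<in>K. norm (residual k w Q (\<phi> (\<pi> (fst w), h))))"
      using residual_coercive[OF W(1,2)[OF w]] h by (intro bexI[of _ h]) simp_all
  qed
  with that[OF U U_open _ img] show thesis by blast
qed

lemma cost_eq:
  assumes "carrier (Gr (fst z)) = (\<lambda>h. \<phi> (\<pi> (fst z), h)) ` topspace T"
  shows "cost z = Chebyshev_cost T K (\<lambda>k z Q h. residual k z Q (\<phi> (\<pi> (fst z), h))) z"
  by (rule ext) (simp add: cost_def Chebyshev_cost_def sumsq_def assms image_image)

lemma local_Min:
  assumes "Chebyshev W T (I \<times> I) K (\<lambda>k z Q h. residual k z Q (\<phi> (\<pi> (fst z), h)))"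
    and "carrier (Gr (fst z)) = (\<lambda>h. \<phi> (\<pi> (fst z), h)) ` topspace T"
  shows "Min z = Chebyshev.minimiser T (I \<times> I) K (\<lambda>k z Q h. residual k z Q (\<phi> (\<pi> (fst z), h))) z"
  unfolding Min_def Chebyshev.minimiser_def[OF assms(1)] cost_eq[OF assms(2)] ..

lemma
  assumes z: "z \<in> topspace Z"
  shows sumsq_le_cost: "\<lbrakk>Q \<in> fsupp (I \<times> I); g \<in> carrier (Gr (fst z))\<rbrakk> \<Longrightarrow> sumsq z Q g \<le> cost z Q"
    and Min_fsupp: "Min z \<in> fsupp (I \<times> I)"
    and Min_le: "Q \<in> fsupp (I \<times> I) \<Longrightarrow> cost z (Min z) \<le> cost z Q"
    and Min_unique: "\<lbrakk>Q \<in> fsupp (I \<times> I); \<And>Q'. Q' \<in> fsupp (I \<times> I) \<Longrightarrow> cost z Q \<le> cost z Q'\<rbrakk> \<Longrightarrow> Q = Min z"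
proof -
  have y: "fst z \<in> Y" using z by auto
  obtain U \<phi> where U: "\<pi> (fst z) \<in> U" "openin B U"
    and C: "Chebyshev (subtopology Z {z. \<pi> (fst z) \<in> U}) T (I \<times> I) K
       (\<lambda>k z Q h. residual k z Q (\<phi> (\<pi> (fst z), h)))"
    and img: "\<And>y. y \<in> Y \<Longrightarrow> \<pi> y \<in> U \<Longrightarrow> carrier (Gr y) = (\<lambda>h. \<phi> (\<pi> y, h)) ` topspace T"
    by (rule local_Chebyshev[OF pi_in[OF y]]) (rule that)
  note img_z = img[OF y U(1)]
  have zW: "z \<in> topspace (subtopology Z {z. \<pi> (fst z) \<in> U})" using z U by simp
  note C_eq = cost_eq[OF img_z] and M_eq = local_Min[OF C img_z]
  show "sumsq z Q g \<le> cost z Q" if Q: "Q \<in> fsupp (I \<times> I)" and g: "g \<in> carrier (Gr (fst z))"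
  proof -
    obtain h where "h \<in> topspace T" "g = \<phi> (\<pi> (fst z), h)" using g img_z by auto
    then show ?thesis
      using Chebyshev.q_le_F[OF C zW Q] unfolding C_eq sumsq_def by simp
  qed
  show fsupp: "Min z \<in> fsupp (I \<times> I)"
    unfolding M_eq by (rule Chebyshev.minimiser(1)[OF C zW])
  show le: "cost z (Min z) \<le> cost z Q" if "Q \<in> fsupp (I \<times> I)" for Q
    using Chebyshev.minimiser(2)[OF C zW that] unfolding M_eq C_eq .
  show "Q = Min z" if "Q \<in> fsupp (I \<times> I)" "\<And>Q'. Q' \<in> fsupp (I \<times> I) \<Longrightarrow> cost z Q \<le> cost z Q'"
    by (rule Chebyshev.minimiser_unique[OF C zW that(1) _ fsupp])
      (use that(2) le in \<open>simp_all flip: C_eq\<close>)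
qed

section \<open>Continuity and equivariance of the minimiser\<close>

lemma cost_leI:
  assumes "z \<in> topspace Z" "\<And>g. g \<in> carrier (Gr (fst z)) \<Longrightarrow> sumsq z Q g \<le> c"
  shows "cost z Q \<le> c"
  unfolding cost_def using assms one_in[of "fst z"] by (intro cSUP_least) auto

lemma Min_cont: "continuous_map Z euclidean (\<lambda>z. Min z p)"
proof (rule continuous_map_locallyI)
  fix z assume z: "z \<in> topspace Z"
  have y: "fst z \<in> Y" using z by auto
  obtain U \<phi> where U: "\<pi> (fst z) \<in> U" "openin B U"
    and C: "Chebyshev (subtopology Z {z. \<pi> (fst z) \<in> U}) T (I \<times> I) K
       (\<lambda>k z Q h. residual k z Q (\<phi> (\<pi> (fst z), h)))"
    and img: "\<And>y. y \<in> Y \<Longrightarrow> \<pi> y \<in> U \<Longrightarrow> carrier (Gr y) = (\<lambda>h. \<phi> (\<pi> y, h)) ` topspace T"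
    by (rule local_Chebyshev[OF pi_in[OF y]]) (rule that)
  let ?N = "{z \<in> topspace Z. \<pi> (fst z) \<in> U}"
  have "continuous_map Z B (\<lambda>z. \<pi> (fst z))"
    using continuous_map_compose[OF continuous_map_fst Y_proj] by (simp add: o_def)
  then have "openin Z ?N" by (rule openin_continuous_map_preimage[OF _ U(2)])
  moreover have "z \<in> ?N" using z U by simp
  moreover have "continuous_map (subtopology Z ?N) euclidean (\<lambda>z. Min z p)"
  proof -
    have eq: "subtopology Z ?N = subtopology Z {z. \<pi> (fst z) \<in> U}"
      by (simp only: Collect_conj_eq Collect_mem_eq subtopology_restrict)
    show ?thesis
      unfolding eq
      by (rule continuous_map_eq[OF Chebyshev.minimiser_cont[OF C]])
        (use local_Min[OF C] img in \<open>auto\<close>)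
  qed
  ultimately show "\<exists>N. openin Z N \<and> z \<in> N \<and> continuous_map (subtopology Z N) euclidean (\<lambda>z. Min z p)"
    by blast
qed

text \<open>Translation by \<open>h\<close> only permutes the first residuals: the one at
  \<open>g\<close> over the moved point is the one at the product of \<open>g\<close> and
  \<open>h\<close> over \<open>y\<close>. The second residual of a translate is zero, whence an
  inequality.\<close>

lemma cost_translate:
  assumes y: "y \<in> Y" "s \<in> {0..1}" and h: "h \<in> carrier (Gr y)" and Q: "Q \<in> fsupp (I \<times> I)"
  shows "cost (act Yb h y, s) (mmul I (mmul I (R h y s) Q) (R (inv\<^bsub>Gr y\<^esub> h) (act Yb h y) t)) \<le> cost (y, s) Q"
    (is "cost (?y, s) ?N \<le> _")
proof (rule cost_leI)
  interpret group "Gr y" using Gr_group y by blast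
  note y' = act_Y[OF y(1) h]
  show "(?y, s) \<in> topspace Z" using y' y by simp
  fix g assume "g \<in> carrier (Gr (fst (?y, s)))"
  then have g: "g \<in> carrier (Gr y)" using y' by simp
  let ?gh = "g \<otimes>\<^bsub>Gr y\<^esub> h"
  have gh: "?gh \<in> carrier (Gr y)" using g h by simp
  have "mmul I (R (inv\<^bsub>Gr y\<^esub> h) ?y t) (R (inv\<^bsub>Gr y\<^esub> g) (act Yb g ?y) t)
      = R (inv\<^bsub>Gr y\<^esub> h \<otimes>\<^bsub>Gr y\<^esub> inv\<^bsub>Gr y\<^esub> g) (act Yb g ?y) t"
    using R_mult[of "act Yb g ?y" t "inv\<^bsub>Gr y\<^esub> g" "inv\<^bsub>Gr y\<^esub> h"] act_Y[OF y'(1), of g] act_Y_inv[OF y'(1), of g]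
      g h t y' by simp
  then have R_inv: "mmul I (R (inv\<^bsub>Gr y\<^esub> h) ?y t) (R (inv\<^bsub>Gr y\<^esub> g) (act Yb g ?y) t)
      = R (inv\<^bsub>Gr y\<^esub> ?gh) (act Yb g ?y) t"
    using inv_mult_group[OF g h] by simp
  have act_gh: "act Yb ?gh y = act Yb g ?y" using act_Y_mult[OF y(1) h g] .
  have "mmul I (mmul I (R g ?y s) ?N) (R (inv\<^bsub>Gr y\<^esub> g) (act Yb g ?y) t)
      = mmul I (mmul I (mmul I (R g ?y s) (R h y s)) Q) (mmul I (R (inv\<^bsub>Gr y\<^esub> h) ?y t) (R (inv\<^bsub>Gr y\<^esub> g) (act Yb g ?y) t))"
    by (simp only: mmul_assoc)
  also have "\<dots> = mmul I (mmul I (R ?gh y s) Q) (R (inv\<^bsub>Gr y\<^esub> ?gh) (act Yb ?gh y) t)"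
    unfolding R_inv R_mult[OF y h g] act_gh ..
  finally have res1: "res1 ?y s ?N g = res1 y s Q ?gh"
    unfolding res1_def act_gh y'(2) by simp
  have "mmul I (mmul I (idem ?y s) ?N) (idem ?y t)
      = mmul I (mmul I (mmul I (idem ?y s) (R h y s)) Q) (mmul I (R (inv\<^bsub>Gr y\<^esub> h) ?y t) (idem ?y t))"
    by (simp only: mmul_assoc)
  also have "\<dots> = ?N"
    using R_idem(2)[OF y h] R_idem(1)[OF y'(1) t, of "inv\<^bsub>Gr y\<^esub> h"] h y' by simp
  finally have res2: "res2 ?y s ?N = 0" unfolding res2_def by simp
  have "sumsq (?y, s) ?N g \<le> sumsq (y, s) Q ?gh"
    unfolding sumsq_def
    by (rule sum_mono) (auto simp: residual_def res1 res2)
  also have "\<dots> \<le> cost (y, s) Q"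
    using sumsq_le_cost[OF Z_in[OF y] Q] gh by simp
  finally show "sumsq (?y, s) ?N g \<le> cost (y, s) Q" .
qed

text \<open>A competitor \<open>Q\<close> at the moved point is translated back by the inverse of
  \<open>h\<close>, compared with \<open>Min (y, s)\<close> there, and \<open>cost_translate\<close>
  is used once in each direction. Uniqueness of the minimiser finishes.\<close>

lemma Min_translate:
  assumes y: "y \<in> Y" "s \<in> {0..1}" and h: "h \<in> carrier (Gr y)"
  shows "mmul I (mmul I (R h y s) (Min (y, s))) (R (inv\<^bsub>Gr y\<^esub> h) (act Yb h y) t) = Min (act Yb h y, s)"
    (is "?N = Min (?y, s)")
proof (rule Min_unique)
  interpret group "Gr y" using Gr_group y by blast
  note y' = act_Y[OF y(1) h]
  show z': "(?y, s) \<in> topspace Z" using y' y by simp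
  show "?N \<in> fsupp (I \<times> I)"
    by (intro mmul_fsupp R_fsupp Min_fsupp Z_in y)
  fix Q assume Q: "Q \<in> fsupp (I \<times> I)"
  let ?h = "inv\<^bsub>Gr y\<^esub> h"
  have h': "?h \<in> carrier (Gr ?y)" using h y' by simp
  let ?Q = "mmul I (mmul I (R ?h ?y s) Q) (R (inv\<^bsub>Gr ?y\<^esub> ?h) (act Yb ?h ?y) t)"
  have "cost (?y, s) ?N \<le> cost (y, s) (Min (y, s))"
    by (rule cost_translate[OF y h Min_fsupp[OF Z_in[OF y]]])
  also have "\<dots> \<le> cost (y, s) ?Q"
    by (intro Min_le Z_in y mmul_fsupp R_fsupp Q)
  also have "\<dots> = cost (act Yb ?h ?y, s) ?Q"
    using act_Y_inv[OF y(1) h] by simp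
  also have "\<dots> \<le> cost (?y, s) Q"
    by (rule cost_translate[OF y'(1) y(2) h' Q])
  finally show "cost (?y, s) ?N \<le> cost (?y, s) Q" .
qed

text \<open>Translation by the unit element is multiplication by the idempotents on both
  sides.\<close>

lemma Min_idem:
  assumes y: "y \<in> Y" "s \<in> {0..1}"
  shows "mmul I (Min (y, s)) (idem y t) = Min (y, s)" "mmul I (idem y s) (Min (y, s)) = Min (y, s)"
proof -
  interpret group "Gr y" using Gr_group y by blast
  have "mmul I (mmul I (idem y s) (Min (y, s))) (idem y t) = Min (y, s)"
    using Min_translate[OF y one_closed] R_one[OF y] R_one[OF y(1) t] act_Y_one[OF y(1)] by simp
  then have M: "Min (y, s) = mmul I (mmul I (idem y s) (Min (y, s))) (idem y t)" by simp
  show "mmul I (Min (y, s)) (idem y t) = Min (y, s)"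
    by (subst (1 2) M) (simp only: mmul_assoc idem_idem[OF y(1) t])
  show "mmul I (idem y s) (Min (y, s)) = Min (y, s)"
    by (subst (1 2) M) (simp only: mmul_assoc[symmetric] idem_idem[OF y])
qed

lemma Min_intertwines:
  assumes y: "y \<in> Y" "s \<in> {0..1}" and h: "h \<in> carrier (Gr y)"
  shows "mmul I (Min (act Yb h y, s)) (R h y t) = mmul I (R h y s) (Min (y, s))"
  unfolding Min_translate[OF y h, symmetric]
  by (simp only: mmul_assoc R_idem(3)[OF y(1) t h] Min_idem[OF y])

text \<open>For \<open>s = t\<close> the idempotent is carried to the idempotent by every
  \<open>g\<close>, so all residuals vanish and its cost is the least possible value 0.\<close>

lemma Min_diagonal:
  assumes y: "y \<in> Y"
  shows "Min (y, t) = idem y t"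
proof (rule Min_unique[symmetric, OF Z_in[OF y t] idem_fsupp])
  fix Q :: "'i \<times> 'i \<Rightarrow> complex" assume Q: "Q \<in> fsupp (I \<times> I)"
  have "cost (y, t) (idem y t) \<le> 0"
  proof (rule cost_leI[OF Z_in[OF y t]])
    fix g assume "g \<in> carrier (Gr (fst (y, t)))"
    then have g: "g \<in> carrier (Gr y)" by simp
    have "res1 y t (idem y t) g = 0"
      unfolding res1_def R_idem(1)[OF y t g] R_idem(4)[OF y t g] idem_idem[OF act_Y(1)[OF y g] t] by simp
    moreover have "res2 y t (idem y t) = 0"
      unfolding res2_def by (simp add: idem_idem[OF y t])
    ultimately have "residual k (y, t) (idem y t) g = 0" for k
      by (cases "fst k") (simp_all add: residual_def)
    then show "sumsq (y, t) (idem y t) g \<le> 0"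
      by (simp add: sumsq_def)
  qed
  also have "0 \<le> sumsq (y, t) Q \<one>\<^bsub>Gr y\<^esub>" by (simp add: sumsq_def sum_nonneg)
  also have "\<dots> \<le> cost (y, t) Q"
    using sumsq_le_cost[OF Z_in[OF y t] Q] one_in[OF y] by simp
  finally show "cost (y, t) (idem y t) \<le> cost (y, t) Q" .
qed

end

section \<open>Isomorphism of the pullbacks\<close>

context equivariant_homotopy
begin

abbreviation "pull s \<equiv> pullback_vb (f s) Yb E"

lemma tspace_pull: "tspace (pull s) = subtopology (prod_topology (tspace Yb) (tspace E)) {(y, e). f s y = bproj E e}"
  and bproj_pull: "bproj (pull s) = fst"
  and act_pull: "act (pull s) g (y, e) = (act Yb g y, act E g e)"
  by (simp_all add: pullback_vb_def)

lemma pull_D: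
  assumes "d \<in> topspace (tspace (pull s))"
  shows "fst d \<in> Y" "snd d \<in> V (fst d) s"
  using assms by (auto simp: tspace_pull fiber_def)

lemma pull_I:
  assumes "y \<in> Y" "e \<in> V y s"
  shows "(y, e) \<in> topspace (tspace (pull s))"
  using assms by (auto simp: tspace_pull fiber_def)

lemma act_pull_in:
  assumes "d \<in> topspace (tspace (pull s))" "s \<in> {0..1}" "g \<in> carrier (Gr (fst d))"
  shows "act (pull s) g d \<in> topspace (tspace (pull s))"
  using pull_D[OF assms(1)] act_Y[OF _ assms(3)] act_E[OF _ assms(2) _ assms(3)]
  by (cases d) (auto simp: act_pull intro: pull_I)

text \<open>\<open>P\<close> projects to the target fibre, so any matrix \<open>A\<close> is
  admissible; its effect is that of \<open>A\<close> compressed by \<open>idem y s\<close> on the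
  left and \<open>idem y r\<close> on the right.\<close>

definition bundle_map :: "real \<Rightarrow> real \<Rightarrow> ('y \<Rightarrow> 'i \<times> 'i \<Rightarrow> complex) \<Rightarrow> 'y \<times> 'e \<Rightarrow> 'y \<times> 'e" where
  "bundle_map r s A = (\<lambda>(y, e). (y, P (y, s) (mvec I (A y) (J (y, r) e))))"

lemma bundle_map_in:
  assumes "d \<in> topspace (tspace (pull r))" "s \<in> {0..1}"
  shows "bundle_map r s A d \<in> topspace (tspace (pull s))"
  using pull_D(1)[OF assms(1)] assms(2) by (cases d) (auto simp: bundle_map_def intro!: pull_I P_V)

lemma bundle_map_cont:
  assumes r: "r \<in> {0..1}" and s: "s \<in> {0..1}" and A: "\<And>p. continuous_map (tspace Yb) euclidean (\<lambda>y. A y p)"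
  shows "continuous_map (tspace (pull r)) (tspace (pull s)) (bundle_map r s A)"
proof -
  let ?S = "tspace (pull r)"
  have y: "continuous_map ?S (tspace Yb) fst" and e: "continuous_map ?S (tspace E) snd"
    unfolding tspace_pull by (intro continuous_map_from_subtopology continuous_map_fst continuous_map_snd)+
  have z: "continuous_map ?S Z (\<lambda>d. (fst d, r'))" if "r' \<in> {0..1}" for r'
    using that by (intro continuous_map_pairedI y) simp
  have "continuous_map ?S euclidean (\<lambda>d. J (fst d, r) (snd d) i)" for i
    by (rule J_comp_cont[OF z[OF r] e]) (auto simp: tspace_pull)
  moreover have "continuous_map ?S euclidean (\<lambda>d. A (fst d) p)" for p
    using continuous_map_compose[OF y A] by (simp add: o_def)
  ultimately have "continuous_map ?S euclidean (\<lambda>d. mvec I (A (fst d)) (J (fst d, r) (snd d)) i)" for i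
    by (intro continuous_map_mvec finite_I)
  then have "continuous_map ?S (tspace E) (\<lambda>d. P (fst d, s) (mvec I (A (fst d)) (J (fst d, r) (snd d))))"
    by (rule P_comp_cont[OF z[OF s]])
  from continuous_map_pairedI[OF y this]
  have "continuous_map ?S (prod_topology (tspace Yb) (tspace E)) (bundle_map r s A)"
    by (simp add: bundle_map_def case_prod_unfold)
  moreover have "bundle_map r s A \<in> topspace ?S \<rightarrow> {(y, e). f s y = bproj E e}"
    using bundle_map_in[OF _ s] unfolding tspace_pull[of s] by auto
  ultimately show ?thesis
    unfolding tspace_pull[of s] by (rule continuous_map_into_subtopology)
qed

lemma bundle_map_linear:
  assumes r: "r \<in> {0..1}" and s: "s \<in> {0..1}" and y: "y \<in> Y"
  shows "linear_map (vfiber (pull r) y) (vfiber (pull s) y) (bundle_map r s A)"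
  unfolding linear_map_def pullback_vb_def
  using P_V[OF y s]
  by (auto simp: carrier_vfiber[OF y r] carrier_vfiber[OF y s] bundle_map_def J_Z_add[OF y r] J_Z_smult[OF y r]
      mvec_add_right mvec_smult P_Z_add[OF y s] P_Z_smult[OF y s])

lemma bundle_map_compose:
  assumes d: "d \<in> topspace (tspace (pull r))" and r: "r \<in> {0..1}" and s: "s \<in> {0..1}"
    and A: "mmul I (A' (fst d)) (mmul I (idem (fst d) s) (A (fst d))) = idem (fst d) r"
  shows "bundle_map s r A' (bundle_map r s A d) = d"
proof -
  obtain y e where d_eq: "d = (y, e)" by force
  have y: "y \<in> Y" and e: "e \<in> V y r" using pull_D[OF d] d_eq by auto
  have "mvec I (A' y) (J (y, s) (P (y, s) (mvec I (A y) (J (y, r) e)))) = J (y, r) e"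
    using A idem_J[OF y r e] by (simp add: d_eq J_P[OF y s] flip: mvec_mmul)
  then show ?thesis by (simp add: d_eq bundle_map_def P_J_Z[OF y r e])
qed

lemma bundle_map_equivariant:
  assumes d: "d \<in> topspace (tspace (pull r))" and r: "r \<in> {0..1}" and s: "s \<in> {0..1}"
    and g: "g \<in> carrier (Gr (fst d))"
    and A: "mmul I (A (act Yb g (fst d))) (R g (fst d) r) = mmul I (R g (fst d) s) (A (fst d))"
  shows "bundle_map r s A (act (pull r) g d) = act (pull s) g (bundle_map r s A d)"
proof -
  obtain y e where d_eq: "d = (y, e)" by force
  have y: "y \<in> Y" and e: "e \<in> V y r" using pull_D[OF d] d_eq by auto
  have g': "g \<in> carrier (Gr y)" using g d_eq by simp
  note y' = act_Y(1)[OF y g']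
  have "mvec I (A (act Yb g y)) (J (act Yb g y, r) (act E g e))
      = mvec I (R g y s) (mvec I (A y) (J (y, r) e))"
    using A by (simp add: d_eq J_act[OF y r g' e] flip: mvec_mmul)
  also have "\<dots> = J (act Yb g y, s) (act E g (P (y, s) (mvec I (A y) (J (y, r) e))))"
    by (simp add: J_act_P[OF y s g'])
  finally show ?thesis
    by (simp add: d_eq bundle_map_def act_pull P_J_Z[OF y' s act_E[OF y s P_V[OF y s] g']])
qed

text \<open>Equivariance is asked of \<open>A\<close> alone, because the inverse of an equivariant
  bijection is equivariant. Both directions are stated since the final connectedness argument uses a
  symmetric relation.\<close>

lemma isomorphic_if_inverse_bundle_maps:
  assumes r: "r \<in> {0..1}" and s: "s \<in> {0..1}"
    and cont: "\<And>p. continuous_map (tspace Yb) euclidean (\<lambda>y. A y p)" "\<And>p. continuous_map (tspace Yb) euclidean (\<lambda>y. A' y p)"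
    and inv: "\<And>y. y \<in> Y \<Longrightarrow> mmul I (A' y) (mmul I (idem y s) (A y)) = idem y r"
      "\<And>y. y \<in> Y \<Longrightarrow> mmul I (A y) (mmul I (idem y r) (A' y)) = idem y s"
    and equivariant: "\<And>y g. \<lbrakk>y \<in> Y; g \<in> carrier (Gr y)\<rbrakk>
      \<Longrightarrow> mmul I (A (act Yb g y)) (R g y r) = mmul I (R g y s) (A y)"
  shows "equivariant_vb_isomorphic \<G> Yb (pull r) (pull s)" "equivariant_vb_isomorphic \<G> Yb (pull s) (pull r)"
proof -
  let ?\<Phi> = "bundle_map r s A" and ?\<Psi> = "bundle_map s r A'"
  have \<Psi>\<Phi>: "?\<Psi> (?\<Phi> d) = d" if "d \<in> topspace (tspace (pull r))" for d
    using bundle_map_compose[OF that r s] inv(1)[OF pull_D(1)[OF that]] by blast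
  have \<Phi>\<Psi>: "?\<Phi> (?\<Psi> d) = d" if "d \<in> topspace (tspace (pull s))" for d
    using bundle_map_compose[OF that s r] inv(2)[OF pull_D(1)[OF that]] by blast
  have maps: "homeomorphic_maps (tspace (pull r)) (tspace (pull s)) ?\<Phi> ?\<Psi>"
    unfolding homeomorphic_maps_def
    by (intro conjI ballI bundle_map_cont r s cont \<Psi>\<Phi> \<Phi>\<Psi>)
  have in_Gr: "g \<in> carrier (Gr (fst d))"
    if "d \<in> topspace (tspace (pull q))" "g \<in> topspace (tspace \<G>)" "bproj \<G> g = \<pi> (bproj (pull q) d)" for d g q
    using that pull_D(1)[OF that(1)] by (simp add: Gr_carrier bproj_pull)
  have \<Phi>_eq: "?\<Phi> (act (pull r) g d) = act (pull s) g (?\<Phi> d)"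
    if "d \<in> topspace (tspace (pull r))" "g \<in> carrier (Gr (fst d))" for d g
    by (rule bundle_map_equivariant[OF that(1) r s that(2)]) (rule equivariant[OF pull_D(1)[OF that(1)] that(2)])
  have \<Psi>_eq: "?\<Psi> (act (pull s) g d) = act (pull r) g (?\<Psi> d)"
    if d: "d \<in> topspace (tspace (pull s))" and g: "g \<in> carrier (Gr (fst d))" for d g
  proof -
    have d': "?\<Psi> d \<in> topspace (tspace (pull r))" using bundle_map_in[OF d r] .
    have g': "g \<in> carrier (Gr (fst (?\<Psi> d)))" using g by (simp add: bundle_map_def case_prod_unfold)
    have "?\<Psi> (act (pull s) g d) = ?\<Psi> (?\<Phi> (act (pull r) g (?\<Psi> d)))"
      using \<Phi>_eq[OF d' g'] \<Phi>\<Psi>[OF d] by simp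
    then show ?thesis using \<Psi>\<Phi>[OF act_pull_in[OF d' r g']] by simp
  qed
  show "equivariant_vb_isomorphic \<G> Yb (pull r) (pull s)"
    unfolding equivariant_vb_isomorphic_def
  proof (intro exI[of _ ?\<Phi>] conjI ballI impI)
    show "homeomorphic_map (tspace (pull r)) (tspace (pull s)) ?\<Phi>"
      using maps homeomorphic_map_maps by blast
  qed (use in_Gr \<Phi>_eq bundle_map_linear[OF r s] in \<open>auto simp: bproj_pull bundle_map_def case_prod_unfold\<close>)
  show "equivariant_vb_isomorphic \<G> Yb (pull s) (pull r)"
    unfolding equivariant_vb_isomorphic_def
  proof (intro exI[of _ ?\<Psi>] conjI ballI impI)
    show "homeomorphic_map (tspace (pull s)) (tspace (pull r)) ?\<Psi>"
      using maps homeomorphic_map_maps homeomorphic_maps_sym by blast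
  qed (use in_Gr \<Psi>_eq bundle_map_linear[OF s r] in \<open>auto simp: bproj_pull bundle_map_def case_prod_unfold\<close>)
qed

end

context equivariant_homotopy_at
begin

text \<open>Agrees with the minimiser on the image of \<open>idem y t\<close>, but equals the identity matrix at \<open>s = t\<close>,
  so that invertibility near \<open>t\<close> can be tested on all of \<open>\<complex>\<^sup>I\<close>.\<close>

definition completed :: "'y \<times> real \<Rightarrow> 'i \<times> 'i \<Rightarrow> complex" where
  "completed z = Min z + mmul I (mone I - idem (fst z) (snd z)) (mone I - idem (fst z) t)"

lemma completed_fsupp: "z \<in> topspace Z \<Longrightarrow> completed z \<in> fsupp (I \<times> I)"
  unfolding completed_def by (intro add_fsupp mmul_fsupp diff_fsupp mone_fsupp idem_fsupp Min_fsupp)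

lemma continuous_at_t: "continuous_map Z Z (\<lambda>z. (fst z, t))"
  using t by (intro continuous_map_pairedI continuous_map_fst) simp

lemma completed_cont: "continuous_map Z euclidean (\<lambda>z. completed z p)"
proof -
  have "continuous_map Z euclidean (\<lambda>z. (mone I - idem (fst z) (snd z)) p)" for p
    using idem_cont[OF continuous_map_id] by (simp add: id_def continuous_map_diff)
  moreover have "continuous_map Z euclidean (\<lambda>z. (mone I - idem (fst z) t) p)" for p
    using idem_cont[OF continuous_at_t] by (simp add: continuous_map_diff)
  ultimately show ?thesis
    unfolding completed_def plus_fun_apply
    by (intro continuous_map_add Min_cont continuous_map_mmul finite_I)
qed

text \<open>The added block is killed by \<open>idem y s\<close> on the left and by
  \<open>idem y t\<close> on the right.\<close>

lemma completed_idem: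
  assumes y: "y \<in> Y" "s \<in> {0..1}"
  shows "mmul I (idem y s) (completed (y, s)) = Min (y, s)"
    and "mmul I (completed (y, s)) (idem y t) = Min (y, s)"
proof -
  have "mmul I (idem y s) (mone I - idem y s) = 0" "mmul I (mone I - idem y t) (idem y t) = 0"
    by (simp_all add: mmul_diff_left mmul_diff_right mmul_mone_left mmul_mone_right finite_I idem_fsupp
        idem_idem[OF y] idem_idem[OF y(1) t])
  moreover have "mmul I 0 A = 0" "mmul I A 0 = 0" for A by (auto simp: mmul_def fun_eq_iff)
  ultimately show "mmul I (idem y s) (completed (y, s)) = Min (y, s)"
    "mmul I (completed (y, s)) (idem y t) = Min (y, s)"
    by (simp_all add: completed_def mmul_add_left mmul_add_right Min_idem[OF y] mmul_assoc)
      (simp add: mmul_assoc[symmetric])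
qed

lemma completed_diagonal:
  assumes y: "y \<in> Y"
  shows "completed (y, t) = mone I"
  by (simp add: completed_def Min_diagonal[OF y] mmul_diff_left mmul_diff_right mmul_mone_left
      mmul_mone_right finite_I idem_fsupp mone_fsupp diff_fsupp idem_idem[OF y t])

text \<open>Let \<open>C\<close> be the completed matrix and \<open>A'\<close> its inverse. From
  \<open>M = C e_t = e_s C\<close> follow \<open>A' M = e_t\<close> and \<open>M A' = e_s\<close>,
  so \<open>A'\<close> induces the inverse of the bundle map of \<open>M\<close>.\<close>

lemma isomorphic_if_near:
  assumes s: "s \<in> {0..1}" and near: "\<And>y. y \<in> Y \<Longrightarrow> l1norm (I \<times> I) (mone I - completed (y, s)) < 1/2"
  shows "equivariant_vb_isomorphic \<G> Yb (pull t) (pull s)" "equivariant_vb_isomorphic \<G> Yb (pull s) (pull t)"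
proof -
  have no: "near_one I (completed (y, s))" if "y \<in> Y" for y
    using near[OF that] completed_fsupp[OF Z_in[OF that s]] finite_I by (simp add: near_one_def)
  define A' where "A' = (\<lambda>y. near_one.inverse_matrix I (completed (y, s)))"
  have ys: "continuous_map (tspace Yb) Z (\<lambda>y. (y, s))"
    using s by (intro continuous_map_pairedI continuous_map_id[unfolded id_def]) simp
  have Min_s: "continuous_map (tspace Yb) euclidean (\<lambda>y. Min (y, s) p)" for p
    using continuous_map_compose[OF ys Min_cont] by (simp add: o_def)
  have "continuous_map (tspace Yb) euclidean (\<lambda>y. completed (y, s) p)" for p
    using continuous_map_compose[OF ys completed_cont] by (simp add: o_def)
  then have A'_cont: "continuous_map (tspace Yb) euclidean (\<lambda>y. A' y p)" for p
    unfolding A'_def by (intro continuous_inverse_matrix no)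
  have inv1: "mmul I (A' y) (mmul I (idem y s) (Min (y, s))) = idem y t" if y: "y \<in> Y" for y
  proof -
    have "mmul I (A' y) (Min (y, s)) = mmul I (mmul I (A' y) (completed (y, s))) (idem y t)"
      unfolding completed_idem(2)[OF y s, symmetric] mmul_assoc ..
    also have "\<dots> = idem y t"
      unfolding A'_def near_one.left_inverse[OF no[OF y]] by (simp add: mmul_mone_left finite_I idem_fsupp)
    finally show ?thesis by (simp add: Min_idem[OF y s])
  qed
  have inv2: "mmul I (Min (y, s)) (mmul I (idem y t) (A' y)) = idem y s" if y: "y \<in> Y" for y
  proof -
    have "mmul I (Min (y, s)) (mmul I (idem y t) (A' y)) = mmul I (Min (y, s)) (A' y)"
      by (simp add: mmul_assoc[symmetric] Min_idem[OF y s])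
    also have "\<dots> = mmul I (idem y s) (mmul I (completed (y, s)) (A' y))"
      unfolding completed_idem(1)[OF y s, symmetric] mmul_assoc ..
    also have "\<dots> = idem y s"
      unfolding A'_def near_one.right_inverse[OF no[OF y]] by (simp add: mmul_mone_right finite_I idem_fsupp)
    finally show ?thesis .
  qed
  note iso = isomorphic_if_inverse_bundle_maps[OF t s, of "\<lambda>y. Min (y, s)" A', OF Min_s A'_cont inv1 inv2 Min_intertwines[OF _ s]]
  show "equivariant_vb_isomorphic \<G> Yb (pull t) (pull s)" "equivariant_vb_isomorphic \<G> Yb (pull s) (pull t)"
    by (rule iso; assumption)+
qed

text \<open>The pairs where the completed matrix is far from the identity form a closed set. Its
  projection along the compact \<open>Y\<close> is closed and misses \<open>t\<close> by
  \<open>completed_diagonal\<close>.\<close>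

lemma isomorphic_nearby:
  obtains N where "openin (top_of_set {0..1}) N" "t \<in> N"
    "\<And>s. s \<in> N \<Longrightarrow> equivariant_vb_isomorphic \<G> Yb (pull t) (pull s) \<and> equivariant_vb_isomorphic \<G> Yb (pull s) (pull t)"
proof -
  let ?\<nu> = "\<lambda>z. l1norm (I \<times> I) (mone I - completed z)"
  define C where "C = {z \<in> topspace Z. ?\<nu> z \<in> {1/2..}}"
  have "continuous_map Z euclideanreal ?\<nu>"
    unfolding l1norm_def fun_diff_def
    by (intro continuous_map_sum continuous_map_norm continuous_map_diff completed_cont) (auto simp: finite_I)
  then have "closedin Z C"
    unfolding C_def by (rule closedin_continuous_map_preimage) simp
  then have closed: "closedin (top_of_set {0..1}) (snd ` C)"
    using closed_map_snd[OF Y_compact] unfolding closed_map_def by blast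
  show thesis
  proof
    show "openin (top_of_set {0..1}) ({0..1} - snd ` C)"
      using closed by (simp add: closedin_def)
    show "t \<in> {0..1} - snd ` C"
      using t by (auto simp: C_def completed_diagonal l1norm_def)
    fix s assume s: "s \<in> {0..1} - snd ` C"
    have "?\<nu> (y, s) < 1/2" if "y \<in> Y" for y
    proof (rule ccontr)
      assume "\<not> ?thesis"
      then have "(y, s) \<in> C" using that s by (simp add: C_def)
      then show False using s by (metis DiffD2 snd_conv image_eqI)
    qed
    then show "equivariant_vb_isomorphic \<G> Yb (pull t) (pull s) \<and> equivariant_vb_isomorphic \<G> Yb (pull s) (pull t)"
      using isomorphic_if_near s by blast
  qed
qed

end

section \<open>Composition of isomorphisms and connectedness of the interval\<close>

lemma linear_map_compose:
  assumes "linear_map M N h" "linear_map N Q k"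
  shows "linear_map M Q (k \<circ> h)"
  using assms unfolding linear_map_def by (auto simp: Pi_iff)

lemma equivariant_vb_isomorphic_trans:
  assumes "equivariant_vb_isomorphic \<G> Yb D E" "equivariant_vb_isomorphic \<G> Yb E F"
  shows "equivariant_vb_isomorphic \<G> Yb D F"
proof -
  obtain \<Phi> where \<Phi>: "homeomorphic_map (tspace D) (tspace E) \<Phi>"
      "\<And>d. d \<in> topspace (tspace D) \<Longrightarrow> bproj E (\<Phi> d) = bproj D d"
      "\<And>y. y \<in> topspace (tspace Yb) \<Longrightarrow> linear_map (vfiber D y) (vfiber E y) \<Phi>"
      "\<And>g d. \<lbrakk>g \<in> topspace (tspace \<G>); d \<in> topspace (tspace D); bproj \<G> g = bproj Yb (bproj D d)\<rbrakk>
        \<Longrightarrow> \<Phi> (act D g d) = act E g (\<Phi> d)"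
    using assms(1) unfolding equivariant_vb_isomorphic_def by blast
  obtain \<Psi> where \<Psi>: "homeomorphic_map (tspace E) (tspace F) \<Psi>"
      "\<And>d. d \<in> topspace (tspace E) \<Longrightarrow> bproj F (\<Psi> d) = bproj E d"
      "\<And>y. y \<in> topspace (tspace Yb) \<Longrightarrow> linear_map (vfiber E y) (vfiber F y) \<Psi>"
      "\<And>g d. \<lbrakk>g \<in> topspace (tspace \<G>); d \<in> topspace (tspace E); bproj \<G> g = bproj Yb (bproj E d)\<rbrakk>
        \<Longrightarrow> \<Psi> (act E g d) = act F g (\<Psi> d)"
    using assms(2) unfolding equivariant_vb_isomorphic_def by blast
  have in_E: "\<Phi> d \<in> topspace (tspace E)" if "d \<in> topspace (tspace D)" for d
    using homeomorphic_imp_surjective_map[OF \<Phi>(1)] that by blast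
  show ?thesis
    unfolding equivariant_vb_isomorphic_def
  proof (intro exI[of _ "\<Psi> \<circ> \<Phi>"] conjI ballI impI)
    show "homeomorphic_map (tspace D) (tspace F) (\<Psi> \<circ> \<Phi>)"
      by (rule homeomorphic_map_compose[OF \<Phi>(1) \<Psi>(1)])
    show "linear_map (vfiber D y) (vfiber F y) (\<Psi> \<circ> \<Phi>)" if "y \<in> topspace (tspace Yb)" for y
      by (rule linear_map_compose[OF \<Phi>(3)[OF that] \<Psi>(3)[OF that]])
  qed (simp_all add: in_E \<Phi>(2,4) \<Psi>(2,4))
qed

theorem lemma3p13:
  fixes B :: "'b topology"
    and G :: "'h monoid" and T :: "'h topology" and \<G> :: "('g, 'b) group_bundle"
    and FY :: "'k topology" and Yb :: "('y, 'b, 'g) G_space"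
    and FX :: "'l topology" and Xb :: "('x, 'b, 'g) G_space"
    and f :: "real \<Rightarrow> 'y \<Rightarrow> 'x"
    and E :: "('e, 'x, 'g) equivariant_vb"
  assumes "compact_space B" and "Hausdorff_space B"
    and "lie_group_bundle G T B \<G>"
    and "G_fiber_bundle FY B \<G> Yb" and "compact_space (tspace Yb)" and "Hausdorff_space (tspace Yb)"
    and "G_fiber_bundle FX B \<G> Xb" and "compact_space (tspace Xb)"
    and "continuous_map (prod_topology (tspace Yb) (top_of_set {0..1})) (tspace Xb) (\<lambda>(y, t). f t y)"
    and "\<And>t. t \<in> {0..1} \<Longrightarrow> G_map \<G> Yb Xb (f t)"
    and "equivariant_vector_bundle B \<G> Xb E"
  shows "equivariant_vb_isomorphic \<G> Yb (pullback_vb (f 0) Yb E) (pullback_vb (f 1) Yb E)"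
proof -
  have Yb: "continuous_map (tspace Yb) B (bproj Yb)" "fiberwise_action B \<G> (tspace Yb) (bproj Yb) (act Yb)"
    using assms(4) unfolding G_fiber_bundle_def fiber_bundle_def by blast+
  have "compact_space (prod_topology (tspace Yb) (top_of_set {0..1::real}))"
    using assms(5) by (simp add: compact_space_prod_topology compact_space_subtopology)
  moreover have "Hausdorff_space (prod_topology (tspace Yb) (top_of_set {0..1::real}))"
    using assms(6) by (simp add: Hausdorff_space_prod_topology Hausdorff_space_subtopology)
  moreover have "vector_bundle (tspace Xb) E"
    using assms(11) unfolding equivariant_vector_bundle_def by blast
  ultimately obtain I :: "(('y \<times> real) \<times> nat) set" and J P
    where frame: "vb_frame (prod_topology (tspace Yb) (top_of_set {0..1})) (\<lambda>(y, t). f t y) E I J P"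
    using vector_bundle_frame assms(9) by blast
  have homotopy: "equivariant_homotopy B G T \<G> Yb Xb f E I J P"
    using assms Yb frame by (simp add: equivariant_homotopy_def)
  let ?pull = "\<lambda>s. pullback_vb (f s) Yb E"
  let ?rel = "\<lambda>s r. equivariant_vb_isomorphic \<G> Yb (?pull s) (?pull r) \<and> equivariant_vb_isomorphic \<G> Yb (?pull r) (?pull s)"
  have "?rel 0 1"
  \<comment> \<open>A symmetric, transitive relation on a connected set that holds between each
    point and all nearby points holds throughout; symmetry is built into
    \<open>?rel\<close>.\<close>
  proof (rule connected_equivalence_relation[of "{0..1::real}" 0 1 ?rel])
    fix t :: real assume "t \<in> {0..1}"
    with homotopy interpret equivariant_homotopy_at B G T \<G> Yb Xb f E I J P t
      by (simp add: equivariant_homotopy_at_def equivariant_homotopy_at_axioms_def)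
    show "\<exists>N. openin (top_of_set {0..1}) N \<and> t \<in> N \<and> (\<forall>s\<in>N. ?rel t s)"
      using isomorphic_nearby by metis
  qed (auto intro: equivariant_vb_isomorphic_trans)
  then show ?thesis by blast
qed

end
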